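(* Let $E$ be a set, $I\subseteq E\times E$ an irreflexive symmetric relation, and $M(E,I)$ the corresponding free partially commutative monoid. Let $m\geq -1$ and $k\geq 1$ be integers, and let $X_m^{\bullet}$, $X_{m+1}^{\bullet}$ and $X_0^{\bullet}$ be the right pointed $M(E,I)$-sets defined in the context. Then there is an isomorphism of abelian groups $$\mathrm{Tor}\,(H_k(X_{m+1}^{\bullet}))\;\cong\;\mathrm{Tor}\,(H_k(X_m^{\bullet}))\oplus\mathrm{Tor}\,(H_k(X_0^{\bullet})),$$ where $\mathrm{Tor}\,(A)$ denotes the torsion subgroup of an abelian group $A$.
   Context: Free partially commutative monoid: for a set $E$ and an irreflexive symmetric relation $I\subseteq E\times E$, $M(E,I)$ is the monoid with generating set $E$ and relations $ab=ba$ for all $(a,b)\in I$. The $M(E,I)$-sets $X_n^{\bullet}$: for $n\geq 0$, $X_n^{\bullet}=\{x_0,x_1,\dots,x_n,*\}$ is a pointed set with $n+2$ distinct elements and base point $*$, with the right action of $M(E,I)$ determined by $x_i\cdot e=x_{i+1}$ for $0\leq i\leq n-1$, $x_n\cdot e=*$, $*\cdot e=*$, for all $e\in E$. For $n=-1$, $X_{-1}^{\bullet}=\{*\}$ is the one-point set with trivial action. Homology: for a right $M(E,I)$-set $X$, let $\mathscr{K}_*(X)$ (also written $(M(E,I)/X)^{op}$) be the small category whose objects are all elements of $X$ (including $*$) and whose morphisms $x\to x'$ are the triples $(x,\mu,x')$ with $\mu\in M(E,I)$ and $x\cdot\mu=x'$; the composite of $x\xrightarrow{\mu}x'$ followed by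 $x'\xrightarrow{\nu}x''$ is $x\xrightarrow{\mu\nu}x''$. Put $H_k(X)=\varinjlim_k^{\mathscr{K}_*(X)}\Delta\mathbb{Z}$, the $k$-th left derived functor of the colimit functor $\varinjlim:\mathrm{Ab}^{\mathscr{K}_*(X)}\to\mathrm{Ab}$ evaluated at the constant functor $\Delta\mathbb{Z}$ (with value $\mathbb{Z}$ on objects and $1_{\mathbb{Z}}$ on morphisms). Equivalently, this is the integral homology of the nerve of $\mathscr{K}_*(X)$. *)

theory Defs
  imports "HOL-Algebra.Algebra"
begin

section \<open>Free partially commutative monoids\<close>

inductive_set fpc_cong :: "'e set \<Rightarrow> ('e \<times> 'e) set \<Rightarrow> ('e list \<times> 'e list) set"
  for E :: "'e set" and I :: "('e \<times> 'e) set" where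
  swap: "\<lbrakk>(a, b) \<in> I; u \<in> lists E; v \<in> lists E\<rbrakk> \<Longrightarrow> (u @ [a, b] @ v, u @ [b, a] @ v) \<in> fpc_cong E I"
| refl: "w \<in> lists E \<Longrightarrow> (w, w) \<in> fpc_cong E I"
| sym: "(v, w) \<in> fpc_cong E I \<Longrightarrow> (w, v) \<in> fpc_cong E I"
| trans: "\<lbrakk>(u, v) \<in> fpc_cong E I; (v, w) \<in> fpc_cong E I\<rbrakk> \<Longrightarrow> (u, w) \<in> fpc_cong E I"

definition fpc_monoid :: "'e set \<Rightarrow> ('e \<times> 'e) set \<Rightarrow> 'e list set monoid" where
  "fpc_monoid E I =
    \<lparr>carrier = lists E // fpc_cong E I,
     monoid.mult = (\<lambda>\<mu> \<nu>. \<Union>u\<in>\<mu>. \<Union>v\<in>\<nu>. fpc_cong E I `` {u @ v}),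
     one = fpc_cong E I `` {[]}\<rparr>"


section \<open>Right sets over a monoid and the category of elements\<close>

record ('x, 'm) right_set =
  points :: "'x set"
  act :: "'x \<Rightarrow> 'm \<Rightarrow> 'x"

text \<open>Composition is written in diagrammatic order: \<open>cmps C f g\<close> is \<open>f\<close> followed by \<open>g\<close>.\<close>

record ('o, 'm) small_cat =
  obj :: "'o set"
  mor :: "'m set"
  src :: "'m \<Rightarrow> 'o"
  tgt :: "'m \<Rightarrow> 'o"
  idm :: "'o \<Rightarrow> 'm"
  cmps :: "'m \<Rightarrow> 'm \<Rightarrow> 'm"

definition elements_cat ::
  "'m monoid \<Rightarrow> ('x, 'm) right_set \<Rightarrow> ('x, 'x \<times> 'm \<times> 'x) small_cat" where
  "elements_cat M S =
    \<lparr>obj = points S,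
     mor = {(x, \<mu>, x'). x \<in> points S \<and> \<mu> \<in> carrier M \<and> x' \<in> points S \<and> act S x \<mu> = x'},
     src = (\<lambda>(x, \<mu>, x'). x),
     tgt = (\<lambda>(x, \<mu>, x'). x'),
     idm = (\<lambda>x. (x, \<one>\<^bsub>M\<^esub>, x)),
     cmps = (\<lambda>(x, \<mu>, x') (y, \<nu>, y'). (x, \<mu> \<otimes>\<^bsub>M\<^esub> \<nu>, y'))\<rparr>"

datatype pt = Base | Pt nat

text \<open>The generators all act in the same way, so their action respects the commutation relations,
  and all words representing an element of the monoid act in the same way.  For \<open>n = -1\<close> the only
  point is \<open>Base\<close>.\<close>

definition chain_step :: "int \<Rightarrow> pt \<Rightarrow> 'e \<Rightarrow> pt" where
  "chain_step n x e =
    (case x of Base \<Rightarrow> Base | Pt i \<Rightarrow> if int i < n then Pt (Suc i) else Base)"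

definition chain_set :: "int \<Rightarrow> (pt, 'e list set) right_set" where
  "chain_set n =
    \<lparr>points = insert Base {Pt i | i. int i \<le> n},
     act = (\<lambda>x \<mu>. the_elem (foldl (chain_step n) x ` \<mu>))\<rparr>"


section \<open>Functors to abelian groups\<close>

text \<open>Abelian groups are written multiplicatively, as commutative groups of HOL-Algebra.\<close>

record ('o, 'm, 'a) ab_fun =
  fobj :: "'o \<Rightarrow> 'a monoid"
  fmor :: "'m \<Rightarrow> 'a \<Rightarrow> 'a"

definition ab_functor :: "('o, 'm) small_cat \<Rightarrow> ('o, 'm, 'a) ab_fun \<Rightarrow> bool" where
  "ab_functor C F \<longleftrightarrow>
    (\<forall>c\<in>obj C. comm_group (fobj F c)) \<and>
    (\<forall>f\<in>mor C. fmor F f \<in> hom (fobj F (src C f)) (fobj F (tgt C f))) \<and>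
    (\<forall>c\<in>obj C. \<forall>x\<in>carrier (fobj F c). fmor F (idm C c) x = x) \<and>
    (\<forall>f\<in>mor C. \<forall>g\<in>mor C. tgt C f = src C g \<longrightarrow>
      (\<forall>x\<in>carrier (fobj F (src C f)). fmor F (cmps C f g) x = fmor F g (fmor F f x)))"

definition nat_trans ::
  "('o, 'm) small_cat \<Rightarrow> ('o, 'm, 'a) ab_fun \<Rightarrow> ('o, 'm, 'b) ab_fun \<Rightarrow> ('o \<Rightarrow> 'a \<Rightarrow> 'b) \<Rightarrow> bool" where
  "nat_trans C F G \<eta> \<longleftrightarrow>
    (\<forall>c\<in>obj C. \<eta> c \<in> hom (fobj F c) (fobj G c)) \<and>
    (\<forall>f\<in>mor C. \<forall>x\<in>carrier (fobj F (src C f)).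
      \<eta> (tgt C f) (fmor F f x) = fmor G f (\<eta> (src C f) x))"

text \<open>Epimorphisms of the functor category are the objectwise surjective transformations.\<close>

definition epi_trans ::
  "('o, 'm) small_cat \<Rightarrow> ('o, 'm, 'a) ab_fun \<Rightarrow> ('o, 'm, 'b) ab_fun \<Rightarrow> ('o \<Rightarrow> 'a \<Rightarrow> 'b) \<Rightarrow> bool" where
  "epi_trans C F G \<eta> \<longleftrightarrow>
    nat_trans C F G \<eta> \<and> (\<forall>c\<in>obj C. \<eta> c ` carrier (fobj F c) = carrier (fobj G c))"

definition const_functor :: "'a monoid \<Rightarrow> ('o, 'm, 'a) ab_fun" where
  "const_functor A = \<lparr>fobj = (\<lambda>c. A), fmor = (\<lambda>f x. x)\<rparr>"

text \<open>The lifting property is tested on functors whose values have elements in the same type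
  \<open>'a\<close> as those of \<open>P\<close>.  If \<open>'a\<close> is infinite and at least as large as the set of morphisms of \<open>C\<close>,
  the free functor covering \<open>P\<close> can be realised with elements in \<open>'a\<close>, so that \<open>P\<close> is a retract of
  a free functor and has the lifting property against all epimorphisms whatsoever.\<close>

definition projective_functor :: "('o, 'm) small_cat \<Rightarrow> ('o, 'm, 'a) ab_fun \<Rightarrow> bool" where
  "projective_functor C P \<longleftrightarrow>
    ab_functor C P \<and>
    (\<forall>(G :: ('o, 'm, 'a) ab_fun) (H :: ('o, 'm, 'a) ab_fun) \<epsilon> \<eta>.
      ab_functor C G \<and> ab_functor C H \<and> epi_trans C G H \<epsilon> \<and> nat_trans C P H \<eta> \<longrightarrow>
      (\<exists>\<theta>. nat_trans C P G \<theta> \<and> (\<forall>c\<in>obj C. \<forall>x\<in>carrier (fobj P c). \<epsilon> c (\<theta> c x) = \<eta> c x)))"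

definition projective_resolution ::
  "('o, 'm) small_cat \<Rightarrow> ('o, 'm, 'b) ab_fun \<Rightarrow>
    (nat \<Rightarrow> ('o, 'm, 'a) ab_fun) \<Rightarrow> (nat \<Rightarrow> 'o \<Rightarrow> 'a \<Rightarrow> 'a) \<Rightarrow> ('o \<Rightarrow> 'a \<Rightarrow> 'b) \<Rightarrow> bool" where
  "projective_resolution C F P d \<epsilon> \<longleftrightarrow>
    (\<forall>n. projective_functor C (P n)) \<and>
    (\<forall>n. nat_trans C (P (Suc n)) (P n) (d n)) \<and>
    epi_trans C (P 0) F \<epsilon> \<and>
    (\<forall>c\<in>obj C.
      d 0 c ` carrier (fobj (P 1) c) = kernel (fobj (P 0) c) (fobj F c) (\<epsilon> c)) \<and>
    (\<forall>n. \<forall>c\<in>obj C.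
      d (Suc n) c ` carrier (fobj (P (Suc (Suc n))) c) =
      kernel (fobj (P (Suc n)) c) (fobj (P n) c) (d n c))"


section \<open>The colimit functor\<close>

text \<open>The colimit of \<open>F\<close> is the direct sum of its values, modulo the identification of each \<open>x\<close> with
  its images under the maps of \<open>F\<close>.\<close>

definition sum_inj :: "('o, 'm) small_cat \<Rightarrow> ('o, 'm, 'a) ab_fun \<Rightarrow> 'o \<Rightarrow> 'a \<Rightarrow> 'o \<Rightarrow> 'a" where
  "sum_inj C F c x = (\<lambda>c'\<in>obj C. if c' = c then x else \<one>\<^bsub>fobj F c'\<^esub>)"

definition colim_relations ::
  "('o, 'm) small_cat \<Rightarrow> ('o, 'm, 'a) ab_fun \<Rightarrow> ('o \<Rightarrow> 'a) set" where
  "colim_relations C F =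
    generate (sum_group (obj C) (fobj F))
      {sum_inj C F (src C f) x
         \<otimes>\<^bsub>sum_group (obj C) (fobj F)\<^esub>
         inv\<^bsub>sum_group (obj C) (fobj F)\<^esub> (sum_inj C F (tgt C f) (fmor F f x))
       | f x. f \<in> mor C \<and> x \<in> carrier (fobj F (src C f))}"

definition colim :: "('o, 'm) small_cat \<Rightarrow> ('o, 'm, 'a) ab_fun \<Rightarrow> ('o \<Rightarrow> 'a) set monoid" where
  "colim C F = sum_group (obj C) (fobj F) Mod colim_relations C F"

text \<open>The map of colimits induced by a natural transformation \<open>\<eta>\<close> into \<open>G\<close>.\<close>

definition colim_map ::
  "('o, 'm) small_cat \<Rightarrow> ('o, 'm, 'b) ab_fun \<Rightarrow> ('o \<Rightarrow> 'a \<Rightarrow> 'b) \<Rightarrow>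
    ('o \<Rightarrow> 'a) set \<Rightarrow> ('o \<Rightarrow> 'b) set" where
  "colim_map C G \<eta> A =
    (\<Union>x\<in>A. colim_relations C G #>\<^bsub>sum_group (obj C) (fobj G)\<^esub> (\<lambda>c\<in>obj C. \<eta> c (x c)))"


section \<open>Left derived functors of the colimit\<close>

definition chain_cycles ::
  "(nat \<Rightarrow> 'a monoid) \<Rightarrow> (nat \<Rightarrow> 'a \<Rightarrow> 'a) \<Rightarrow> nat \<Rightarrow> 'a set" where
  "chain_cycles A d k =
    (case k of 0 \<Rightarrow> carrier (A 0) | Suc j \<Rightarrow> kernel (A (Suc j)) (A j) (d j))"

definition chain_homology ::
  "(nat \<Rightarrow> 'a monoid) \<Rightarrow> (nat \<Rightarrow> 'a \<Rightarrow> 'a) \<Rightarrow> nat \<Rightarrow> 'a set monoid" where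
  "chain_homology A d k =
    subgroup_generated (A k) (chain_cycles A d k) Mod (d k ` carrier (A (Suc k)))"

text \<open>An infinite type at least as large as \<open>'m\<close> and \<open>'b\<close>.  Every functor on a category with
  morphisms in \<open>'m\<close>, taking values in groups with elements in \<open>'b\<close>, has a projective resolution by
  functors whose values have elements in this type, and projectivity tested in this type is
  projectivity in the usual sense.\<close>

type_synonym ('m, 'b) universe = "('m \<times> 'b) list \<Rightarrow> int"

text \<open>As usual, the derived functors are computed from a chosen projective resolution; the result
  does not depend on the choice up to isomorphism.\<close>

definition left_derived_colim ::
  "('o, 'm) small_cat \<Rightarrow> ('o, 'm, 'b) ab_fun \<Rightarrow> nat \<Rightarrow>
    ('o \<Rightarrow> ('m, 'b) universe) set set monoid" where
  "left_derived_colim C F k =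
    (let (P, d, \<epsilon>) =
       (SOME (P :: nat \<Rightarrow> ('o, 'm, ('m, 'b) universe) ab_fun, d, \<epsilon>).
          projective_resolution C F P d \<epsilon>)
     in chain_homology (\<lambda>n. colim C (P n)) (\<lambda>n. colim_map C (P n) (d n)) k)"

definition fpc_homology ::
  "'e set \<Rightarrow> ('e \<times> 'e) set \<Rightarrow> nat \<Rightarrow> ('x, 'e list set) right_set \<Rightarrow>
    ('x \<Rightarrow> ('x \<times> 'e list set \<times> 'x, int) universe) set set monoid" where
  "fpc_homology E I k S =
    left_derived_colim (elements_cat (fpc_monoid E I) S) (const_functor integer_group) k"

definition torsion_subgroup :: "'a monoid \<Rightarrow> 'a monoid" where
  "torsion_subgroup G =
    subgroup_generated G {x \<in> carrier G. \<exists>n::nat. n > 0 \<and> x [^]\<^bsub>G\<^esub> n = \<one>\<^bsub>G\<^esub>}"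

end

theory Submission
  imports Defs
begin

text \<open>A two-sided Koszul construction gives a projective resolution of the constant functor: the
  generators in degree \<open>n\<close> are the pairs \<open>(x, \<sigma>)\<close> of a point and an \<open>n\<close>-clique \<open>\<sigma>\<close> of the commutation
  relation, placed at the object \<open>x \<cdot> \<sigma>\<close>.  Its value at an object is spanned by triples \<open>(x, \<sigma>, \<mu>)\<close>
  where \<open>\<sigma>\<close> consists of possible first letters of \<open>\<mu>\<close>; up to terms in which \<open>\<mu>\<close> gets shorter, the
  boundary is that of a full simplex on all first letters of \<open>\<mu>\<close>, so coning off the least first
  letter contracts the complex.  Hence the homology of \<open>X\<close> is computed by
  \<open>d (x, \<sigma>) = \<Sum> \<plusminus> ((x, \<sigma> - e) - (x e, \<sigma> - e))\<close>.

  For the chain sets, splitting off the base point leaves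
  \<open>\<int>[t]/(t^(m+1)) \<otimes> C\<close> with differential \<open>(1 - t) \<otimes> \<partial>\<close>, where \<open>(C, \<partial>)\<close> is the augmented complex of
  cliques.  As \<open>1 - t\<close> is invertible, its homology is a direct sum of \<open>m + 1\<close> copies of that of
  \<open>(C, \<partial>)\<close>, while the base point contributes the free group \<open>C\<close> itself.  So the torsion subgroup
  is a product of \<open>m + 1\<close> copies of one and the same group.\<close>

section \<open>Quotients and homology of complexes\<close>

lemma Mod_iso_of_epi:
  assumes "group G" "group H" "f \<in> hom G H" "f ` carrier G = carrier H"
    and "\<And>x. x \<in> carrier G \<Longrightarrow> f x = \<one>\<^bsub>H\<^esub> \<longleftrightarrow> x \<in> B" "B \<subseteq> carrier G"
  shows "G Mod B \<cong> H"
proof -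
  interpret group_hom G H f
    using assms by (simp add: group_hom_def group_hom_axioms_def)
  have "kernel G H f = B"
    using assms by (auto simp: kernel_def)
  then show ?thesis
    using FactGroup_iso assms(4) by simp
qed

lemma (in comm_group) r_coset_hom_Mod:
  assumes "subgroup B G"
  shows "(\<lambda>x. B #> x) \<in> hom G (G Mod B)"
  using normal.r_coset_hom_Mod subgroup_imp_normal[OF assms] by blast

lemma (in group) r_coset_eq_iff:
  assumes "subgroup B G" "x \<in> carrier G" "y \<in> carrier G"
  shows "B #> x = B #> y \<longleftrightarrow> x \<otimes> inv y \<in> B"
proof
  assume "B #> x = B #> y"
  then have "x \<in> B #> y"
    using assms rcos_self by blast
  then obtain b where "b \<in> B" "x = b \<otimes> y"
    by (auto simp: r_coset_def)
  then show "x \<otimes> inv y \<in> B"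
    using assms subgroup.subset[OF assms(1)] by (auto simp: m_assoc subset_iff)
next
  assume xy: "x \<otimes> inv y \<in> B"
  then have "x = (x \<otimes> inv y) \<otimes> y"
    using assms by (simp add: m_assoc)
  then have "x \<in> B #> y"
    using xy unfolding r_coset_def by auto
  then show "B #> x = B #> y"
    using assms repr_independence by blast
qed

lemma (in group) r_coset_eq_self_iff:
  assumes "subgroup B G" "x \<in> carrier G"
  shows "B #> x = B \<longleftrightarrow> x \<in> B"
  using r_coset_eq_iff[OF assms one_closed] assms subgroup.subset[OF assms(1)]
  by (simp add: coset_mult_one)

lemma Mod_iso_Mod:
  assumes G: "comm_group G" and H: "comm_group H" and B: "subgroup B G" "subgroup B' H"
    and f: "f \<in> hom G H"
    and ker: "\<And>x. x \<in> carrier G \<Longrightarrow> f x \<in> B' \<longleftrightarrow> x \<in> B"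
    and sur: "\<And>y. y \<in> carrier H \<Longrightarrow> \<exists>x\<in>carrier G. \<exists>b\<in>B'. y = b \<otimes>\<^bsub>H\<^esub> f x"
  shows "G Mod B \<cong> H Mod B'"
proof -
  interpret G: comm_group G by fact
  interpret H: comm_group H by fact
  have fc: "f x \<in> carrier H" if "x \<in> carrier G" for x
    using f that by (auto simp: hom_def)
  have "(\<lambda>x. B' #>\<^bsub>H\<^esub> f x) \<in> hom G (H Mod B')"
    using hom_compose[OF f H.r_coset_hom_Mod[OF B(2)]] by (simp add: o_def)
  moreover have "(\<lambda>x. B' #>\<^bsub>H\<^esub> f x) ` carrier G = carrier (H Mod B')"
  proof (intro equalityI subsetI)
    fix c assume "c \<in> carrier (H Mod B')"
    then obtain y where y: "y \<in> carrier H" "c = B' #>\<^bsub>H\<^esub> y"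
      by (auto simp: carrier_FactGroup)
    obtain x b where xb: "x \<in> carrier G" "b \<in> B'" "y = b \<otimes>\<^bsub>H\<^esub> f x"
      using sur[OF y(1)] by blast
    then have "y \<otimes>\<^bsub>H\<^esub> inv\<^bsub>H\<^esub> f x \<in> B'"
      using fc[OF xb(1)] subgroup.mem_carrier[OF B(2) xb(2)] by (simp add: H.m_assoc)
    then have "c = B' #>\<^bsub>H\<^esub> f x"
      using H.r_coset_eq_iff[OF B(2) y(1) fc[OF xb(1)]] y(2) by simp
    then show "c \<in> (\<lambda>x. B' #>\<^bsub>H\<^esub> f x) ` carrier G"
      using xb by blast
  qed (auto simp: carrier_FactGroup fc)
  moreover have "B' #>\<^bsub>H\<^esub> f x = \<one>\<^bsub>H Mod B'\<^esub> \<longleftrightarrow> x \<in> B" if "x \<in> carrier G" for x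
    using H.r_coset_eq_self_iff[OF B(2) fc[OF that]] ker[OF that] by simp
  ultimately show ?thesis
    using Mod_iso_of_epi[of G "H Mod B'"] H.abelian_FactGroup[OF B(2)] subgroup.subset[OF B(1)]
    by (auto simp: comm_group_def)
qed

definition chain_complex :: "(nat \<Rightarrow> 'a monoid) \<Rightarrow> (nat \<Rightarrow> 'a \<Rightarrow> 'a) \<Rightarrow> bool" where
  "chain_complex A d \<longleftrightarrow>
    (\<forall>n. comm_group (A n)) \<and> (\<forall>n. d n \<in> hom (A (Suc n)) (A n)) \<and>
    (\<forall>n. \<forall>x\<in>carrier (A (Suc (Suc n))). d n (d (Suc n) x) = \<one>\<^bsub>A n\<^esub>)"

lemma chain_complex_cycles:
  assumes "chain_complex A d"
  shows "subgroup (chain_cycles A d k) (A k)"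
    and "subgroup (d k ` carrier (A (Suc k))) (subgroup_generated (A k) (chain_cycles A d k))"
    and "comm_group (subgroup_generated (A k) (chain_cycles A d k))"
    and "carrier (subgroup_generated (A k) (chain_cycles A d k)) = chain_cycles A d k"
proof -
  have A: "\<And>n. comm_group (A n)" and d: "\<And>n. d n \<in> hom (A (Suc n)) (A n)"
    and dd: "\<And>n x. x \<in> carrier (A (Suc (Suc n))) \<Longrightarrow> d n (d (Suc n) x) = \<one>\<^bsub>A n\<^esub>"
    using assms by (auto simp: chain_complex_def)
  have gA: "group (A n)" for n
    using A comm_group_def by blast
  interpret d: group_hom "A (Suc n)" "A n" "d n" for n
    by (simp add: group_hom_def group_hom_axioms_def gA d)
  show Z: "subgroup (chain_cycles A d k) (A k)"
    by (cases k) (simp_all add: chain_cycles_def d.subgroup_kernel group.subgroup_self gA)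
  then show carr: "carrier (subgroup_generated (A k) (chain_cycles A d k)) = chain_cycles A d k"
    by (rule subgroup.carrier_subgroup_generated_subgroup)
  show "comm_group (subgroup_generated (A k) (chain_cycles A d k))"
    by (simp add: A gA group.abelian_subgroup_generated)
  have "subgroup (d k ` carrier (A (Suc k))) (A k)"
    by (rule d.img_is_subgroup)
  moreover have "d k ` carrier (A (Suc k)) \<subseteq> chain_cycles A d k"
    by (cases k) (auto simp: chain_cycles_def kernel_def dd)
  ultimately show "subgroup (d k ` carrier (A (Suc k))) (subgroup_generated (A k) (chain_cycles A d k))"
    using group.subgroup_subgroup_generated_iff[OF gA] carr by blast
qed

lemma comm_group_chain_homology:
  assumes "chain_complex A d"
  shows "comm_group (chain_homology A d k)"
  unfolding chain_homology_def
  using assms by (intro comm_group.abelian_FactGroup chain_complex_cycles)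

lemma chain_homology_iso:
  assumes A: "chain_complex A d" and A': "chain_complex A' d'"
    and f: "\<And>n. f n \<in> hom (A n) (A' n)" "\<And>n x. x \<in> carrier (A (Suc n)) \<Longrightarrow> f n (d n x) = d' n (f (Suc n) x)"
    and g: "\<And>n. g n \<in> hom (A' n) (A n)" "\<And>n x. x \<in> carrier (A' (Suc n)) \<Longrightarrow> g n (d' n x) = d n (g (Suc n) x)"
    and gf: "\<And>z. z \<in> chain_cycles A d k \<Longrightarrow> \<exists>w\<in>carrier (A (Suc k)). g k (f k z) = d k w \<otimes>\<^bsub>A k\<^esub> z"
    and fg: "\<And>z. z \<in> chain_cycles A' d' k \<Longrightarrow> \<exists>w\<in>carrier (A' (Suc k)). f k (g k z) = d' k w \<otimes>\<^bsub>A' k\<^esub> z"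
  shows "chain_homology A d k \<cong> chain_homology A' d' k"
  unfolding chain_homology_def
proof (rule Mod_iso_Mod)
  let ?Z = "chain_cycles A d k" and ?Z' = "chain_cycles A' d' k"
  let ?G = "subgroup_generated (A k) ?Z" and ?G' = "subgroup_generated (A' k) ?Z'"
  let ?B = "d k ` carrier (A (Suc k))" and ?B' = "d' k ` carrier (A' (Suc k))"
  note c = chain_complex_cycles[OF A, of k] and c' = chain_complex_cycles[OF A', of k]
  have gA: "group (A n)" "group (A' n)" for n
    using A A' by (auto simp: chain_complex_def comm_group_def)
  have fZ: "f k z \<in> ?Z'" if "z \<in> ?Z" for z
  proof (cases k)
    case 0
    with that show ?thesis using f(1)[of 0] by (auto simp: chain_cycles_def hom_def)
  next
    case (Suc j)
    have z: "z \<in> carrier (A (Suc j))" "d j z = \<one>\<^bsub>A j\<^esub>"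
      using that Suc by (auto simp: chain_cycles_def kernel_def)
    then have "d' j (f (Suc j) z) = \<one>\<^bsub>A' j\<^esub>"
      using f(2)[OF z(1)] hom_one[OF f(1)[of j] gA] by simp
    then show ?thesis
      using z(1) f(1)[of "Suc j"] Suc by (auto simp: chain_cycles_def kernel_def hom_def)
  qed
  have gZ: "g k z \<in> ?Z" if "z \<in> ?Z'" for z
  proof (cases k)
    case 0
    with that show ?thesis using g(1)[of 0] by (auto simp: chain_cycles_def hom_def)
  next
    case (Suc j)
    have z: "z \<in> carrier (A' (Suc j))" "d' j z = \<one>\<^bsub>A' j\<^esub>"
      using that Suc by (auto simp: chain_cycles_def kernel_def)
    then have "d j (g (Suc j) z) = \<one>\<^bsub>A j\<^esub>"
      using g(2)[OF z(1)] hom_one[OF g(1)[of j] gA(2,1)] by simp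
    then show ?thesis
      using z(1) g(1)[of "Suc j"] Suc by (auto simp: chain_cycles_def kernel_def hom_def)
  qed
  show "comm_group ?G" "comm_group ?G'"
    "subgroup ?B ?G"
    "subgroup ?B' ?G'"
    by (rule c c')+
  have sub: "?Z \<subseteq> carrier (A k)" "?Z' \<subseteq> carrier (A' k)"
    using c(1) c'(1) by (auto simp: subgroup_def)
  then show "f k \<in> hom ?G ?G'"
    using f(1)[of k] fZ unfolding hom_def c(4) c'(4) by (auto simp: subset_iff)
  have Bf: "f k x \<in> ?B'" if "x \<in> ?B" for x
    using that f(2)[of _ k] f(1)[of "Suc k"] by (auto simp: hom_def)
  have Bg: "g k x \<in> ?B" if "x \<in> ?B'" for x
    using that g(2)[of _ k] g(1)[of "Suc k"] by (auto simp: hom_def)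
  interpret Ak: group "A k" by (rule gA)
  have subB: "subgroup ?B (A k)"
    using c(2) gA(1) group.subgroup_subgroup_generated_iff by blast
  interpret B: subgroup "?B" "A k" by (rule subB)
  show "f k z \<in> ?B' \<longleftrightarrow> z \<in> ?B"
    if "z \<in> carrier ?G" for z
  proof
    have z: "z \<in> ?Z" using that c(4) by simp
    then have zc: "z \<in> carrier (A k)" using sub by blast
    assume "f k z \<in> ?B'"
    then have gfz: "g k (f k z) \<in> ?B" by (rule Bg)
    obtain w where w: "w \<in> carrier (A (Suc k))" "g k (f k z) = d k w \<otimes>\<^bsub>A k\<^esub> z"
      using gf[OF z] by blast
    then have dw: "d k w \<in> ?B" by blast
    have "z = inv\<^bsub>A k\<^esub> (d k w) \<otimes>\<^bsub>A k\<^esub> g k (f k z)"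
      using w dw zc by (simp add: Ak.inv_solve_left)
    then show "z \<in> ?B"
      using gfz dw by (metis B.m_closed B.m_inv_closed)
  qed (rule Bf)
  interpret Ak': group "A' k" by (rule gA)
  have subB': "subgroup ?B' (A' k)"
    using c'(2) gA(2) group.subgroup_subgroup_generated_iff by blast
  interpret B': subgroup "?B'" "A' k" by (rule subB')
  show "\<exists>x\<in>carrier ?G. \<exists>b\<in>?B'.
      y = b \<otimes>\<^bsub>?G'\<^esub> f k x"
    if "y \<in> carrier ?G'" for y
  proof -
    have y: "y \<in> ?Z'" using that c'(4) by simp
    then have yc: "y \<in> carrier (A' k)" using sub by blast
    obtain w where w: "w \<in> carrier (A' (Suc k))" "f k (g k y) = d' k w \<otimes>\<^bsub>A' k\<^esub> y"
      using fg[OF y] by blast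
    then have dw: "d' k w \<in> ?B'" by blast
    have "y = inv\<^bsub>A' k\<^esub> (d' k w) \<otimes>\<^bsub>A' k\<^esub> f k (g k y)"
      using w dw yc by (simp add: Ak'.inv_solve_left)
    moreover have "g k y \<in> ?Z" by (rule gZ[OF y])
    ultimately show ?thesis
      using dw c(4) by (metis B'.m_inv_closed mult_subgroup_generated)
  qed
qed

lemma chain_homology_iso_of_bij:
  assumes A: "chain_complex A d" and A': "chain_complex A' d'"
    and f: "\<And>n. f n \<in> iso (A n) (A' n)" "\<And>n x. x \<in> carrier (A (Suc n)) \<Longrightarrow> f n (d n x) = d' n (f (Suc n) x)"
  shows "chain_homology A d k \<cong> chain_homology A' d' k"
proof (rule chain_homology_iso[OF A A', where f = f and g = "\<lambda>n. inv_into (carrier (A n)) (f n)"])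
  have grp: "group (A n)" "group (A' n)" for n
    using A A' by (auto simp: chain_complex_def comm_group_def)
  have d: "d n x \<in> carrier (A n)" if "x \<in> carrier (A (Suc n))" for n x
    using A that by (auto simp: chain_complex_def hom_def)
  have bij: "bij_betw (f n) (carrier (A n)) (carrier (A' n))" for n
    using f(1) by (simp add: iso_def)
  note inv1 = bij_betw_inv_into_left[OF bij] and inv2 = bij_betw_inv_into_right[OF bij]
  show "f n \<in> hom (A n) (A' n)" for n using f(1) by (simp add: iso_def)
  show g: "inv_into (carrier (A n)) (f n) \<in> hom (A' n) (A n)" for n
    using group.iso_set_sym[OF grp(1) f(1)] by (simp add: iso_def)
  show "inv_into (carrier (A n)) (f n) (d' n x) = d n (inv_into (carrier (A (Suc n))) (f (Suc n)) x)"
    if "x \<in> carrier (A' (Suc n))" for n x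
  proof -
    let ?y = "inv_into (carrier (A (Suc n))) (f (Suc n)) x"
    have y: "?y \<in> carrier (A (Suc n))" using hom_in_carrier[OF g that] .
    have "d' n x = f n (d n ?y)" using f(2)[OF y] inv2[OF that] by simp
    then show ?thesis using inv1[OF d[OF y]] by simp
  qed
  have cyc: "z \<in> carrier (A k)" if "z \<in> chain_cycles A d k" for z
    using subgroup.subset[OF chain_complex_cycles(1)[OF A]] that by blast
  have cyc': "z \<in> carrier (A' k)" if "z \<in> chain_cycles A' d' k" for z
    using subgroup.subset[OF chain_complex_cycles(1)[OF A']] that by blast
  have d1: "d n \<one>\<^bsub>A (Suc n)\<^esub> = \<one>\<^bsub>A n\<^esub>" "d' n \<one>\<^bsub>A' (Suc n)\<^esub> = \<one>\<^bsub>A' n\<^esub>" for n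
    using A A' hom_one grp unfolding chain_complex_def by blast+
  show "\<exists>w\<in>carrier (A (Suc k)). inv_into (carrier (A k)) (f k) (f k z) = d k w \<otimes>\<^bsub>A k\<^esub> z"
    if "z \<in> chain_cycles A d k" for z
    using inv1[OF cyc[OF that]] cyc[OF that] d1(1)[of k] grp(1)
    by (intro bexI[of _ "\<one>\<^bsub>A (Suc k)\<^esub>"]) (auto simp: group.is_monoid)
  show "\<exists>w\<in>carrier (A' (Suc k)). f k (inv_into (carrier (A k)) (f k) z) = d' k w \<otimes>\<^bsub>A' k\<^esub> z"
    if "z \<in> chain_cycles A' d' k" for z
    using inv2[OF cyc'[OF that]] cyc'[OF that] d1(2)[of k] grp(2)
    by (intro bexI[of _ "\<one>\<^bsub>A' (Suc k)\<^esub>"]) (auto simp: group.is_monoid)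
qed (rule f(2))

lemma subgroup_torsion:
  assumes "comm_group G"
  shows "subgroup {x \<in> carrier G. \<exists>n::nat. n > 0 \<and> x [^]\<^bsub>G\<^esub> n = \<one>\<^bsub>G\<^esub>} G"
proof -
  interpret comm_group G by fact
  show ?thesis
  proof (rule subgroup.intro; clarify?)
    fix x y and m n :: nat
    assume *: "x \<in> carrier G" "y \<in> carrier G" "0 < m" "0 < n"
      "x [^]\<^bsub>G\<^esub> m = \<one>\<^bsub>G\<^esub>" "y [^]\<^bsub>G\<^esub> n = \<one>\<^bsub>G\<^esub>"
    have "x [^]\<^bsub>G\<^esub> (m * n) = (x [^]\<^bsub>G\<^esub> m) [^]\<^bsub>G\<^esub> n"
      "y [^]\<^bsub>G\<^esub> (m * n) = (y [^]\<^bsub>G\<^esub> n) [^]\<^bsub>G\<^esub> m"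
      using *(1,2) by (simp_all only: nat_pow_pow mult.commute[of m n])
    then have "(x \<otimes>\<^bsub>G\<^esub> y) [^]\<^bsub>G\<^esub> (m * n) = \<one>\<^bsub>G\<^esub>"
      using * by (simp only: nat_pow_distrib nat_pow_one l_one one_closed)
    then show "x \<otimes>\<^bsub>G\<^esub> y \<in> carrier G \<and> (\<exists>n::nat>0. (x \<otimes>\<^bsub>G\<^esub> y) [^]\<^bsub>G\<^esub> n = \<one>\<^bsub>G\<^esub>)"
      using * by (intro conjI exI[of _ "m * n"]) auto
  next
    fix x and n :: nat
    assume "x \<in> carrier G" "0 < n" "x [^]\<^bsub>G\<^esub> n = \<one>\<^bsub>G\<^esub>"
    then show "inv\<^bsub>G\<^esub> x \<in> carrier G \<and> (\<exists>n::nat>0. (inv\<^bsub>G\<^esub> x) [^]\<^bsub>G\<^esub> n = \<one>\<^bsub>G\<^esub>)"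
      by (auto simp: nat_pow_inv intro!: exI[of _ n])
  next
    show "\<one>\<^bsub>G\<^esub> \<in> carrier G \<and> (\<exists>n::nat>0. \<one>\<^bsub>G\<^esub> [^]\<^bsub>G\<^esub> n = \<one>\<^bsub>G\<^esub>)"
      by (intro conjI exI[of _ 1]) auto
  qed
qed

lemma carrier_torsion_subgroup:
  assumes "comm_group G"
  shows "carrier (torsion_subgroup G) = {x \<in> carrier G. \<exists>n::nat. n > 0 \<and> x [^]\<^bsub>G\<^esub> n = \<one>\<^bsub>G\<^esub>}"
  unfolding torsion_subgroup_def
  by (rule subgroup.carrier_subgroup_generated_subgroup[OF subgroup_torsion[OF assms]])

lemma comm_group_torsion_subgroup:
  assumes "comm_group G"
  shows "comm_group (torsion_subgroup G)"
  unfolding torsion_subgroup_def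
  using assms by (intro group.abelian_subgroup_generated) (auto simp: comm_group_def)

lemma torsion_subgroup_iso:
  assumes "comm_group G" "comm_group H" "G \<cong> H"
  shows "torsion_subgroup G \<cong> torsion_subgroup H"
proof -
  interpret G: comm_group G by fact
  interpret H: comm_group H by fact
  obtain f where f: "f \<in> iso G H" using assms(3) by (auto simp: is_iso_def)
  then interpret f: group_hom G H f
    by (simp add: group_hom_def group_hom_axioms_def iso_def)
  have bij: "bij_betw f (carrier G) (carrier H)" using f by (simp add: iso_def)
  let ?T = "\<lambda>G. {x \<in> carrier G. \<exists>n::nat. n > 0 \<and> x [^]\<^bsub>G\<^esub> n = \<one>\<^bsub>G\<^esub>}"
  have eq: "f x [^]\<^bsub>H\<^esub> n = \<one>\<^bsub>H\<^esub> \<longleftrightarrow> x [^]\<^bsub>G\<^esub> n = \<one>\<^bsub>G\<^esub>" if "x \<in> carrier G" for x and n :: nat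
  proof -
    have "inj_on f (carrier G)"
      using bij by (rule bij_betw_imp_inj_on)
    then have "f (x [^]\<^bsub>G\<^esub> n) = f \<one>\<^bsub>G\<^esub> \<longleftrightarrow> x [^]\<^bsub>G\<^esub> n = \<one>\<^bsub>G\<^esub>"
      by (rule inj_on_eq_iff) (use that in auto)
    then show ?thesis
      using that by (simp add: f.hom_nat_pow)
  qed
  have "f ` ?T G = ?T H"
  proof (intro equalityI subsetI)
    fix y assume y: "y \<in> ?T H"
    then obtain x where "x \<in> carrier G" "y = f x"
      using bij by (auto simp: bij_betw_def)
    with y eq show "y \<in> f ` ?T G" by auto
  qed (use eq in auto)
  then have "bij_betw f (?T G) (?T H)"
    using bij by (auto simp: bij_betw_def inj_on_def)
  then have "f \<in> iso (torsion_subgroup G) (torsion_subgroup H)"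
    unfolding iso_def hom_def carrier_torsion_subgroup[OF assms(1)] carrier_torsion_subgroup[OF assms(2)]
    by (auto simp: torsion_subgroup_def bij_betw_def)
  then show ?thesis by (rule is_isoI)
qed

lemma torsion_Mod_iso:
  assumes G: "comm_group G" and B: "subgroup B G" and H: "group H"
    and D: "D = {x \<in> carrier G. \<exists>n::nat. n > 0 \<and> x [^]\<^bsub>G\<^esub> n \<in> B}"
    and f: "\<And>x y. x \<in> D \<Longrightarrow> y \<in> D \<Longrightarrow> f (x \<otimes>\<^bsub>G\<^esub> y) = f x \<otimes>\<^bsub>H\<^esub> f y" "f ` D = carrier H"
    and ker: "\<And>x. x \<in> D \<Longrightarrow> f x = \<one>\<^bsub>H\<^esub> \<longleftrightarrow> x \<in> B"
  shows "torsion_subgroup (G Mod B) \<cong> H"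
proof -
  interpret G: comm_group G by fact
  interpret B: subgroup B G by fact
  interpret N: normal B G by (rule G.subgroup_imp_normal[OF B])
  let ?q = "\<lambda>x. B #>\<^bsub>G\<^esub> x"
  interpret Q: comm_group "G Mod B" by (rule G.abelian_FactGroup[OF B])
  have qhom: "?q \<in> hom G (G Mod B)" by (rule G.r_coset_hom_Mod[OF B])
  interpret q: group_hom G "G Mod B" ?q
    by (simp add: group_hom_def group_hom_axioms_def qhom)
  interpret T: comm_group "torsion_subgroup (G Mod B)"
    by (rule comm_group_torsion_subgroup[OF Q.comm_group_axioms])
  have qone: "?q x = \<one>\<^bsub>G Mod B\<^esub> \<longleftrightarrow> x \<in> B" if "x \<in> carrier G" for x
    using G.r_coset_eq_self_iff[OF B that] by simp
  have powq: "?q x [^]\<^bsub>G Mod B\<^esub> n = \<one>\<^bsub>G Mod B\<^esub> \<longleftrightarrow> x [^]\<^bsub>G\<^esub> n \<in> B" if "x \<in> carrier G" for x and n :: nat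
    using qone[of "x [^]\<^bsub>G\<^esub> n"] that N.FactGroup_pow[OF that] by simp
  have DG: "D \<subseteq> carrier G" using D by blast
  have DvT: "D = {x \<in> carrier G. ?q x \<in> carrier (torsion_subgroup (G Mod B))}"
    unfolding D carrier_torsion_subgroup[OF Q.comm_group_axioms] using powq by auto
  have subT: "subgroup (carrier (torsion_subgroup (G Mod B))) (G Mod B)"
    by (simp add: torsion_subgroup_def Q.subgroup_subgroup_generated)
  have subD: "subgroup D G"
  proof (rule subgroup.intro)
    show "x \<otimes>\<^bsub>G\<^esub> y \<in> D" if "x \<in> D" "y \<in> D" for x y
      using that subgroup.m_closed[OF subT] q.hom_mult unfolding DvT by auto
    show "inv\<^bsub>G\<^esub> x \<in> D" if "x \<in> D" for x
      using that subgroup.m_inv_closed[OF subT] q.hom_inv unfolding DvT by auto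
    show "\<one>\<^bsub>G\<^esub> \<in> D"
      using subgroup.one_closed[OF subT] q.hom_one unfolding DvT by auto
  qed (use D in blast)
  have BD: "B \<subseteq> D"
    unfolding D using B.subset by (auto intro!: exI[of _ 1])
  let ?D = "subgroup_generated G D"
  have cD: "carrier ?D = D"
    by (rule subgroup.carrier_subgroup_generated_subgroup[OF subD])
  have gD: "group ?D" by simp
  have "?D Mod B \<cong> torsion_subgroup (G Mod B)"
  proof (rule Mod_iso_of_epi[OF gD T.is_group, of ?q])
    show "?q \<in> hom ?D (torsion_subgroup (G Mod B))"
      unfolding hom_def cD using DvT q.hom_mult by (auto simp: torsion_subgroup_def)
    show "?q ` carrier ?D = carrier (torsion_subgroup (G Mod B))"
      unfolding cD using DvT subgroup.subset[OF subT] by (auto simp: carrier_FactGroup)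
    show "?q x = \<one>\<^bsub>torsion_subgroup (G Mod B)\<^esub> \<longleftrightarrow> x \<in> B" if "x \<in> carrier ?D" for x
      using qone[of x] that cD DG by (auto simp: torsion_subgroup_def)
  qed (use cD BD in auto)
  moreover have "group (?D Mod B)"
    using comm_group.abelian_FactGroup[of ?D B] G.abelian_subgroup_generated B BD cD
    by (simp add: G.subgroup_subgroup_generated_iff G.comm_group_axioms comm_group.axioms(2))
  ultimately have "torsion_subgroup (G Mod B) \<cong> ?D Mod B"
    using group.iso_sym by blast
  also have "?D Mod B \<cong> H"
    by (rule Mod_iso_of_epi[OF gD H, of f]) (use cD f ker BD in \<open>auto simp: hom_def\<close>)
  finally show ?thesis .
qed

section \<open>Functors and natural transformations\<close>

definition src_tgt_closed :: "('o, 'm) small_cat \<Rightarrow> bool" where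
  "src_tgt_closed C \<longleftrightarrow> (\<forall>f\<in>mor C. src C f \<in> obj C \<and> tgt C f \<in> obj C)"

lemma ab_functorD:
  assumes "ab_functor C F"
  shows "c \<in> obj C \<Longrightarrow> comm_group (fobj F c)" "c \<in> obj C \<Longrightarrow> group (fobj F c)"
    and "f \<in> mor C \<Longrightarrow> fmor F f \<in> hom (fobj F (src C f)) (fobj F (tgt C f))"
    and "f \<in> mor C \<Longrightarrow> x \<in> carrier (fobj F (src C f)) \<Longrightarrow> fmor F f x \<in> carrier (fobj F (tgt C f))"
  using assms by (auto simp: ab_functor_def comm_group_def hom_def)

lemma ab_functor_cmps:
  assumes "ab_functor C F" "f \<in> mor C" "g \<in> mor C" "tgt C f = src C g" "x \<in> carrier (fobj F (src C f))"
  shows "fmor F (cmps C f g) x = fmor F g (fmor F f x)"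
  using assms by (simp add: ab_functor_def)

lemma nat_transD:
  assumes "nat_trans C F G \<eta>"
  shows "c \<in> obj C \<Longrightarrow> \<eta> c \<in> hom (fobj F c) (fobj G c)"
    and "c \<in> obj C \<Longrightarrow> x \<in> carrier (fobj F c) \<Longrightarrow> \<eta> c x \<in> carrier (fobj G c)"
    and "f \<in> mor C \<Longrightarrow> x \<in> carrier (fobj F (src C f)) \<Longrightarrow>
      \<eta> (tgt C f) (fmor F f x) = fmor G f (\<eta> (src C f) x)"
  using assms by (auto simp: nat_trans_def hom_def)

lemma hom_mult_hom:
  assumes "comm_group H" "f \<in> hom G H" "g \<in> hom G H"
  shows "(\<lambda>x. f x \<otimes>\<^bsub>H\<^esub> g x) \<in> hom G H"
proof -
  interpret H: comm_group H by fact
  show ?thesis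
    using assms(2,3) by (auto simp: hom_def Pi_iff H.m_ac)
qed

lemma hom_inv_hom:
  assumes "group G" "comm_group H" "f \<in> hom G H"
  shows "(\<lambda>x. inv\<^bsub>H\<^esub> f x) \<in> hom G H"
proof -
  interpret H: comm_group H by fact
  show ?thesis
    using assms(3) by (auto simp: hom_def Pi_iff H.inv_mult)
qed

lemma nat_trans_comp:
  assumes "src_tgt_closed C" "nat_trans C F G \<eta>" "nat_trans C G H \<theta>"
  shows "nat_trans C F H (\<lambda>c x. \<theta> c (\<eta> c x))"
  using assms unfolding nat_trans_def src_tgt_closed_def
  by (auto simp: hom_def Pi_iff)

lemma nat_trans_id:
  assumes "ab_functor C F"
  shows "nat_trans C F F (\<lambda>c x. x)"
  using assms by (auto simp: nat_trans_def hom_def)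

lemma nat_trans_mult:
  assumes C: "src_tgt_closed C" and G: "ab_functor C G"
    and \<eta>: "nat_trans C F G \<eta>" and \<theta>: "nat_trans C F G \<theta>"
  shows "nat_trans C F G (\<lambda>c x. \<eta> c x \<otimes>\<^bsub>fobj G c\<^esub> \<theta> c x)"
  unfolding nat_trans_def
proof (intro conjI ballI)
  show "(\<lambda>x. \<eta> c x \<otimes>\<^bsub>fobj G c\<^esub> \<theta> c x) \<in> hom (fobj F c) (fobj G c)" if "c \<in> obj C" for c
    using that G \<eta> \<theta> by (intro hom_mult_hom ab_functorD(1) nat_transD(1))
  fix f x assume f: "f \<in> mor C" and x: "x \<in> carrier (fobj F (src C f))"
  have "src C f \<in> obj C" using C f by (simp add: src_tgt_closed_def)
  then show "\<eta> (tgt C f) (fmor F f x) \<otimes>\<^bsub>fobj G (tgt C f)\<^esub> \<theta> (tgt C f) (fmor F f x)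
      = fmor G f (\<eta> (src C f) x \<otimes>\<^bsub>fobj G (src C f)\<^esub> \<theta> (src C f) x)"
    using hom_mult[OF ab_functorD(3)[OF G f]] nat_transD[OF \<eta>] nat_transD[OF \<theta>] f x by simp
qed

lemma nat_trans_inv:
  assumes C: "src_tgt_closed C" and F: "ab_functor C F" and G: "ab_functor C G"
    and \<eta>: "nat_trans C F G \<eta>"
  shows "nat_trans C F G (\<lambda>c x. inv\<^bsub>fobj G c\<^esub> \<eta> c x)"
  unfolding nat_trans_def
proof (intro conjI ballI)
  show "(\<lambda>x. inv\<^bsub>fobj G c\<^esub> \<eta> c x) \<in> hom (fobj F c) (fobj G c)" if "c \<in> obj C" for c
    using that F G \<eta> by (intro hom_inv_hom ab_functorD(1,2) nat_transD(1))
  fix f x assume f: "f \<in> mor C" and x: "x \<in> carrier (fobj F (src C f))"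
  have ob: "src C f \<in> obj C" "tgt C f \<in> obj C" using C f by (auto simp: src_tgt_closed_def)
  interpret group_hom "fobj G (src C f)" "fobj G (tgt C f)" "fmor G f"
    using ob ab_functorD[OF G] f by (simp add: group_hom_def group_hom_axioms_def)
  show "inv\<^bsub>fobj G (tgt C f)\<^esub> \<eta> (tgt C f) (fmor F f x) = fmor G f (inv\<^bsub>fobj G (src C f)\<^esub> \<eta> (src C f) x)"
    using nat_transD[OF \<eta>] f x ob by simp
qed

lemma nat_trans_one:
  assumes "group (fobj F c)" "group (fobj G c)" "nat_trans C F G \<eta>" "c \<in> obj C"
  shows "\<eta> c \<one>\<^bsub>fobj F c\<^esub> = \<one>\<^bsub>fobj G c\<^esub>"
  using hom_one[OF nat_transD(1)[OF assms(3,4)] assms(1,2)] .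

definition copy_group :: "('a \<Rightarrow> 'b) \<Rightarrow> 'a monoid \<Rightarrow> 'b monoid" where
  "copy_group j G =
    \<lparr>carrier = j ` carrier G,
     monoid.mult = (\<lambda>x y. j (the_inv j x \<otimes>\<^bsub>G\<^esub> the_inv j y)),
     one = j \<one>\<^bsub>G\<^esub>\<rparr>"

lemma copy_group_simps:
  assumes "inj j"
  shows "carrier (copy_group j G) = j ` carrier G"
    and "j x \<otimes>\<^bsub>copy_group j G\<^esub> j y = j (x \<otimes>\<^bsub>G\<^esub> y)"
    and "\<one>\<^bsub>copy_group j G\<^esub> = j \<one>\<^bsub>G\<^esub>"
  using assms by (auto simp: copy_group_def the_inv_f_f)

lemma copy_group_hom:
  assumes "inj j"
  shows "j \<in> hom G (copy_group j G)" "the_inv j \<in> hom (copy_group j G) G"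
  using assms by (auto simp: hom_def copy_group_simps the_inv_f_f)

lemma comm_group_copy_group:
  assumes j: "inj j" and "comm_group G"
  shows "comm_group (copy_group j G)"
proof -
  interpret comm_group G by fact
  show ?thesis
  proof (rule comm_groupI; clarsimp simp: copy_group_simps[OF j] inj_image_mem_iff[OF j])
    fix x y assume "x \<in> carrier G" "y \<in> carrier G"
    then show "j (x \<otimes>\<^bsub>G\<^esub> y) = j (y \<otimes>\<^bsub>G\<^esub> x)"
      by (simp add: m_comm)
  next
    fix x assume "x \<in> carrier G"
    then show "\<exists>y\<in>carrier G. j (y \<otimes>\<^bsub>G\<^esub> x) = j \<one>\<^bsub>G\<^esub>"
      by (intro bexI[of _ "inv\<^bsub>G\<^esub> x"]) auto
  qed (simp add: m_assoc)
qed

definition copy_functor :: "('a \<Rightarrow> 'b) \<Rightarrow> ('o, 'm, 'a) ab_fun \<Rightarrow> ('o, 'm, 'b) ab_fun" where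
  "copy_functor j F =
    \<lparr>fobj = (\<lambda>c. copy_group j (fobj F c)), fmor = (\<lambda>f x. j (fmor F f (the_inv j x)))\<rparr>"

lemma copy_functor_simps [simp]:
  "fobj (copy_functor j F) c = copy_group j (fobj F c)"
  "fmor (copy_functor j F) f x = j (fmor F f (the_inv j x))"
  by (simp_all add: copy_functor_def)

lemma ab_functor_copy:
  assumes j: "inj j" and F: "ab_functor C F"
  shows "ab_functor C (copy_functor j F)"
  using F unfolding ab_functor_def
  by (auto simp: comm_group_copy_group[OF j] copy_group_simps[OF j] the_inv_f_f[OF j] hom_def Pi_iff)

lemma nat_trans_copy:
  assumes j: "inj j"
  shows "nat_trans C F (copy_functor j F) (\<lambda>c. j)"
    and "nat_trans C (copy_functor j F) F (\<lambda>c. the_inv j)"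
  by (auto simp: nat_trans_def copy_group_hom[OF j] copy_group_simps[OF j] the_inv_f_f[OF j])

section \<open>Projective resolutions\<close>

lemma projective_lift:
  fixes P Q Q' :: "('o, 'm, 'a) ab_fun" and Q'' :: "('o, 'm, 'c) ab_fun"
  assumes C: "src_tgt_closed C" and P: "projective_functor C P"
    and Q: "ab_functor C Q'" "ab_functor C Q" "ab_functor C Q''"
    and d: "nat_trans C Q' Q d" and e: "nat_trans C Q Q'' e"
    and exact: "\<And>c. c \<in> obj C \<Longrightarrow> d c ` carrier (fobj Q' c) = kernel (fobj Q c) (fobj Q'' c) (e c)"
    and \<eta>: "nat_trans C P Q \<eta>"
    and e\<eta>: "\<And>c x. c \<in> obj C \<Longrightarrow> x \<in> carrier (fobj P c) \<Longrightarrow> e c (\<eta> c x) = \<one>\<^bsub>fobj Q'' c\<^esub>"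
  shows "\<exists>\<theta>. nat_trans C P Q' \<theta> \<and> (\<forall>c\<in>obj C. \<forall>x\<in>carrier (fobj P c). d c (\<theta> c x) = \<eta> c x)"
proof -
  let ?K = "\<lambda>c. kernel (fobj Q c) (fobj Q'' c) (e c)"
  define H where "H = \<lparr>fobj = (\<lambda>c. subgroup_generated (fobj Q c) (?K c)), fmor = fmor Q\<rparr>"
  have e_hom: "group_hom (fobj Q c) (fobj Q'' c) (e c)" if "c \<in> obj C" for c
    using that ab_functorD(2)[OF Q(2)] ab_functorD(2)[OF Q(3)] nat_transD(1)[OF e]
    by (simp add: group_hom_def group_hom_axioms_def)
  have carH: "carrier (fobj H c) = ?K c" if "c \<in> obj C" for c
    unfolding H_def using group_hom.subgroup_kernel[OF e_hom[OF that]]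
    by (simp add: subgroup.carrier_subgroup_generated_subgroup)
  have multH: "monoid.mult (fobj H c) = monoid.mult (fobj Q c)" for c
    by (simp add: H_def)
  have K_sub: "?K c \<subseteq> carrier (fobj Q c)" for c
    by (auto simp: kernel_def)
  have ob: "src C f \<in> obj C" "tgt C f \<in> obj C" if "f \<in> mor C" for f
    using C that by (auto simp: src_tgt_closed_def)
  have K_mor: "fmor Q f x \<in> ?K (tgt C f)" if "f \<in> mor C" "x \<in> ?K (src C f)" for f x
  proof -
    have x: "x \<in> carrier (fobj Q (src C f))" "e (src C f) x = \<one>\<^bsub>fobj Q'' (src C f)\<^esub>"
      using that by (auto simp: kernel_def)
    have "e (tgt C f) (fmor Q f x) = fmor Q'' f \<one>\<^bsub>fobj Q'' (src C f)\<^esub>"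
      using nat_transD(3)[OF e that(1) x(1)] x(2) by simp
    also have "\<dots> = \<one>\<^bsub>fobj Q'' (tgt C f)\<^esub>"
      using hom_one[OF ab_functorD(3)[OF Q(3) that(1)]] ab_functorD(2)[OF Q(3)] ob[OF that(1)] by blast
    finally show ?thesis
      using ab_functorD(4)[OF Q(2) that(1) x(1)] by (simp add: kernel_def)
  qed
  have H: "ab_functor C H"
    unfolding ab_functor_def
  proof (intro conjI ballI impI)
    show "comm_group (fobj H c)" if "c \<in> obj C" for c
      using that ab_functorD(1,2)[OF Q(2)] by (simp add: H_def group.abelian_subgroup_generated)
    show "fmor H f \<in> hom (fobj H (src C f)) (fobj H (tgt C f))" if "f \<in> mor C" for f
      using that K_mor ab_functorD(3)[OF Q(2) that] K_sub ob[OF that]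
      by (auto simp: hom_def carH multH) (auto simp: H_def subset_iff)
    show "fmor H (idm C c) x = x" if "c \<in> obj C" "x \<in> carrier (fobj H c)" for c x
      using that K_sub Q(2) by (auto simp: ab_functor_def carH) (auto simp: H_def subset_iff)
    show "fmor H (cmps C f g) x = fmor H g (fmor H f x)"
      if "f \<in> mor C" "g \<in> mor C" "tgt C f = src C g" "x \<in> carrier (fobj H (src C f))" for f g x
      using that K_sub[of "src C f"] Q(2) carH[OF ob(1)[OF that(1)]]
      unfolding ab_functor_def by (auto simp: H_def)
  qed
  have "nat_trans C Q' H d"
    using d exact unfolding nat_trans_def
    by (auto simp: hom_def carH multH) (auto simp: H_def)
  then have epi: "epi_trans C Q' H d"
    using exact by (simp add: epi_trans_def carH)
  have "nat_trans C P H \<eta>"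
    using \<eta> e\<eta> unfolding nat_trans_def
    by (auto simp: hom_def carH multH kernel_def) (auto simp: H_def)
  with P Q(1) H epi show ?thesis
    unfolding projective_functor_def by blast
qed

lemma projective_lift_epi:
  fixes P Q :: "('o, 'm, 'a) ab_fun" and F :: "('o, 'm, 'b) ab_fun" and j :: "'b \<Rightarrow> 'a"
  assumes C: "src_tgt_closed C" and P: "projective_functor C P" and j: "inj j"
    and Q: "ab_functor C Q" and F: "ab_functor C F"
    and \<epsilon>: "epi_trans C Q F \<epsilon>" and \<eta>: "nat_trans C P F \<eta>"
  shows "\<exists>\<theta>. nat_trans C P Q \<theta> \<and> (\<forall>c\<in>obj C. \<forall>x\<in>carrier (fobj P c). \<epsilon> c (\<theta> c x) = \<eta> c x)"
proof -
  have "epi_trans C Q (copy_functor j F) (\<lambda>c x. j (\<epsilon> c x))"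
    unfolding epi_trans_def
  proof (intro conjI ballI)
    show "nat_trans C Q (copy_functor j F) (\<lambda>c x. j (\<epsilon> c x))"
      by (rule nat_trans_comp[OF C _ nat_trans_copy(1)[OF j]]) (use \<epsilon> in \<open>simp add: epi_trans_def\<close>)
    fix c assume "c \<in> obj C"
    then have "\<epsilon> c ` carrier (fobj Q c) = carrier (fobj F c)"
      using \<epsilon> by (simp add: epi_trans_def)
    then show "(\<lambda>x. j (\<epsilon> c x)) ` carrier (fobj Q c) = carrier (fobj (copy_functor j F) c)"
      unfolding copy_functor_simps copy_group_simps(1)[OF j] by (metis image_image)
  qed
  moreover have "nat_trans C P (copy_functor j F) (\<lambda>c x. j (\<eta> c x))"
    by (rule nat_trans_comp[OF C \<eta> nat_trans_copy(1)[OF j]])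
  ultimately obtain \<theta> where "nat_trans C P Q \<theta>" "\<forall>c\<in>obj C. \<forall>x\<in>carrier (fobj P c). j (\<epsilon> c (\<theta> c x)) = j (\<eta> c x)"
    using P Q ab_functor_copy[OF j F] unfolding projective_functor_def by blast
  then show ?thesis
    using j by (auto simp: inj_eq)
qed

lemma projective_functor_copy:
  fixes F :: "('o, 'm, 'c) ab_fun" and j :: "'c \<Rightarrow> 'a"
  assumes C: "src_tgt_closed C" and j: "inj j" and F: "ab_functor C F"
    and lift: "\<And>(G :: ('o, 'm, 'a) ab_fun) (H :: ('o, 'm, 'a) ab_fun) \<epsilon> \<eta>.
      ab_functor C G \<Longrightarrow> ab_functor C H \<Longrightarrow> epi_trans C G H \<epsilon> \<Longrightarrow> nat_trans C F H \<eta> \<Longrightarrow>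
      \<exists>\<theta>. nat_trans C F G \<theta> \<and> (\<forall>c\<in>obj C. \<forall>x\<in>carrier (fobj F c). \<epsilon> c (\<theta> c x) = \<eta> c x)"
  shows "projective_functor C (copy_functor j F)"
  unfolding projective_functor_def
proof (intro conjI allI impI; (elim conjE)?)
  show "ab_functor C (copy_functor j F)" by (rule ab_functor_copy[OF j F])
  fix G H :: "('o, 'm, 'a) ab_fun" and \<epsilon> \<eta>
  assume G: "ab_functor C G" "ab_functor C H" "epi_trans C G H \<epsilon>" and \<eta>: "nat_trans C (copy_functor j F) H \<eta>"
  obtain \<theta> where \<theta>: "nat_trans C F G \<theta>" "\<And>c x. c \<in> obj C \<Longrightarrow> x \<in> carrier (fobj F c) \<Longrightarrow> \<epsilon> c (\<theta> c x) = \<eta> c (j x)"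
    using lift[OF G nat_trans_comp[OF C nat_trans_copy(1)[OF j] \<eta>]] by blast
  show "\<exists>\<theta>. nat_trans C (copy_functor j F) G \<theta> \<and>
    (\<forall>c\<in>obj C. \<forall>x\<in>carrier (fobj (copy_functor j F) c). \<epsilon> c (\<theta> c x) = \<eta> c x)"
    using nat_trans_comp[OF C nat_trans_copy(2)[OF j] \<theta>(1)] \<theta>(2)
    by (intro exI[of _ "\<lambda>c x. \<theta> c (the_inv j x)"]) (auto simp: copy_group_simps[OF j] the_inv_f_f[OF j])
qed

lemma projective_resolutionD:
  assumes "projective_resolution C F P d \<epsilon>"
  shows "projective_functor C (P n)" "ab_functor C (P n)" "nat_trans C (P (Suc n)) (P n) (d n)"
    and "epi_trans C (P 0) F \<epsilon>" "nat_trans C (P 0) F \<epsilon>"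
    and "c \<in> obj C \<Longrightarrow> d 0 c ` carrier (fobj (P (Suc 0)) c) = kernel (fobj (P 0) c) (fobj F c) (\<epsilon> c)"
    and "c \<in> obj C \<Longrightarrow> d (Suc n) c ` carrier (fobj (P (Suc (Suc n))) c) =
        kernel (fobj (P (Suc n)) c) (fobj (P n) c) (d n c)"
    and "c \<in> obj C \<Longrightarrow> x \<in> carrier (fobj (P (Suc 0)) c) \<Longrightarrow> \<epsilon> c (d 0 c x) = \<one>\<^bsub>fobj F c\<^esub>"
    and "c \<in> obj C \<Longrightarrow> x \<in> carrier (fobj (P (Suc (Suc n))) c) \<Longrightarrow> d n c (d (Suc n) c x) = \<one>\<^bsub>fobj (P n) c\<^esub>"
proof -
  note R = assms[unfolded projective_resolution_def]
  show "projective_functor C (P n)" "nat_trans C (P (Suc n)) (P n) (d n)" and \<epsilon>: "epi_trans C (P 0) F \<epsilon>"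
    using R by auto
  then show "ab_functor C (P n)" "nat_trans C (P 0) F \<epsilon>"
    by (auto simp: projective_functor_def epi_trans_def)
  show 6: "d 0 c ` carrier (fobj (P (Suc 0)) c) = kernel (fobj (P 0) c) (fobj F c) (\<epsilon> c)" if "c \<in> obj C" for c
    using R that by simp
  show 7: "d (Suc n) c ` carrier (fobj (P (Suc (Suc n))) c) =
      kernel (fobj (P (Suc n)) c) (fobj (P n) c) (d n c)" if "c \<in> obj C" for c
    using R that by simp
  show "\<epsilon> c (d 0 c x) = \<one>\<^bsub>fobj F c\<^esub>" if "c \<in> obj C" "x \<in> carrier (fobj (P (Suc 0)) c)"
    using 6 that unfolding kernel_def by blast
  show "d n c (d (Suc n) c x) = \<one>\<^bsub>fobj (P n) c\<^esub>" if "c \<in> obj C" "x \<in> carrier (fobj (P (Suc (Suc n))) c)"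
    using 7 that unfolding kernel_def by blast
qed

definition resolution_map ::
  "('o, 'm) small_cat \<Rightarrow>
    (nat \<Rightarrow> ('o, 'm, 'a) ab_fun) \<Rightarrow> (nat \<Rightarrow> 'o \<Rightarrow> 'a \<Rightarrow> 'a) \<Rightarrow> ('o \<Rightarrow> 'a \<Rightarrow> 'b) \<Rightarrow>
    (nat \<Rightarrow> ('o, 'm, 'a) ab_fun) \<Rightarrow> (nat \<Rightarrow> 'o \<Rightarrow> 'a \<Rightarrow> 'a) \<Rightarrow> ('o \<Rightarrow> 'a \<Rightarrow> 'b) \<Rightarrow>
    (nat \<Rightarrow> 'o \<Rightarrow> 'a \<Rightarrow> 'a) \<Rightarrow> bool" where
  "resolution_map C P d \<epsilon> P' d' \<epsilon>' f \<longleftrightarrow>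
    (\<forall>n. nat_trans C (P n) (P' n) (f n)) \<and>
    (\<forall>c\<in>obj C. \<forall>x\<in>carrier (fobj (P 0) c). \<epsilon>' c (f 0 c x) = \<epsilon> c x) \<and>
    (\<forall>n. \<forall>c\<in>obj C. \<forall>x\<in>carrier (fobj (P (Suc n)) c). d' n c (f (Suc n) c x) = f n c (d n c x))"

lemma resolution_mapD:
  assumes "resolution_map C P d \<epsilon> P' d' \<epsilon>' f"
  shows "nat_trans C (P n) (P' n) (f n)"
    and "c \<in> obj C \<Longrightarrow> x \<in> carrier (fobj (P 0) c) \<Longrightarrow> \<epsilon>' c (f 0 c x) = \<epsilon> c x"
    and "c \<in> obj C \<Longrightarrow> x \<in> carrier (fobj (P (Suc n)) c) \<Longrightarrow> d' n c (f (Suc n) c x) = f n c (d n c x)"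
  using assms by (auto simp: resolution_map_def)

lemma resolution_chain_map:
  fixes P P' :: "nat \<Rightarrow> ('o, 'm, 'a) ab_fun" and F :: "('o, 'm, 'b) ab_fun" and j :: "'b \<Rightarrow> 'a"
  assumes C: "src_tgt_closed C" and F: "ab_functor C F" and j: "inj j"
    and P: "projective_resolution C F P d \<epsilon>" and P': "projective_resolution C F P' d' \<epsilon>'"
  shows "\<exists>f. resolution_map C P d \<epsilon> P' d' \<epsilon>' f"
proof -
  note p = projective_resolutionD[OF P] and p' = projective_resolutionD[OF P']
  define A where "A n f \<longleftrightarrow> nat_trans C (P n) (P' n) f \<and>
    (\<forall>c\<in>obj C. \<forall>x\<in>carrier (fobj (P (Suc n)) c).
      case n of 0 \<Rightarrow> \<epsilon>' c (f c (d n c x)) = \<one>\<^bsub>fobj F c\<^esub>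
      | Suc i \<Rightarrow> d' i c (f c (d n c x)) = \<one>\<^bsub>fobj (P' i) c\<^esub>) \<and>
    (n = 0 \<longrightarrow> (\<forall>c\<in>obj C. \<forall>x\<in>carrier (fobj (P 0) c). \<epsilon>' c (f c x) = \<epsilon> c x))" for n f
  define B where "B n f f' \<longleftrightarrow>
    (\<forall>c\<in>obj C. \<forall>x\<in>carrier (fobj (P (Suc n)) c). d' n c (f' c x) = f c (d n c x))" for n f f'
  have "\<exists>f. \<forall>n. A n (f n) \<and> B n (f n) (f (Suc n))"
  proof (rule dependent_nat_choice)
    obtain f where "nat_trans C (P 0) (P' 0) f" "\<forall>c\<in>obj C. \<forall>x\<in>carrier (fobj (P 0) c). \<epsilon>' c (f c x) = \<epsilon> c x"
      using projective_lift_epi[OF C p(1) j p'(2) F p'(4) p(5)] by blast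
    then show "\<exists>f. A 0 f"
      using p(8) nat_transD(2)[OF p(3)] by (auto simp: A_def intro!: exI[of _ f])
  next
    fix f n assume f: "A n f"
    then have fn: "nat_trans C (P n) (P' n) f" by (simp add: A_def)
    have \<eta>: "nat_trans C (P (Suc n)) (P' n) (\<lambda>c x. f c (d n c x))"
      by (rule nat_trans_comp[OF C p(3) fn])
    have "\<exists>f'. nat_trans C (P (Suc n)) (P' (Suc n)) f' \<and> B n f f'"
    proof (cases n)
      case 0
      show ?thesis
        unfolding B_def 0
        by (rule projective_lift[OF C p(1) p'(2) p'(2) F p'(3) p'(5) p'(6)])
          (use f \<eta> 0 in \<open>auto simp: A_def\<close>)
    next
      case (Suc i)
      show ?thesis
        unfolding B_def Suc
        by (rule projective_lift[OF C p(1) p'(2) p'(2) p'(2) p'(3) p'(3) p'(7)])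
          (use f \<eta> Suc in \<open>auto simp: A_def\<close>)
    qed
    then obtain f' where f': "nat_trans C (P (Suc n)) (P' (Suc n)) f'" "B n f f'" by blast
    have "d' n c (f' c (d (Suc n) c x)) = \<one>\<^bsub>fobj (P' n) c\<^esub>"
      if "c \<in> obj C" "x \<in> carrier (fobj (P (Suc (Suc n))) c)" for c x
    proof -
      have "d' n c (f' c (d (Suc n) c x)) = f c (d n c (d (Suc n) c x))"
        using f'(2) nat_transD(2)[OF p(3) that] that unfolding B_def by blast
      then show ?thesis
        using that p(9) nat_trans_one[OF _ _ fn] ab_functorD(2)[OF p(2)] ab_functorD(2)[OF p'(2)] by simp
    qed
    then have "A (Suc n) f'"
      using f' by (simp add: A_def)
    then show "\<exists>f'. A (Suc n) f' \<and> B n f f'"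
      using f'(2) by blast
  qed
  then obtain f where f: "\<And>n. A n (f n)" "\<And>n. B n (f n) (f (Suc n))" by blast
  have "nat_trans C (P n) (P' n) (f n)" for n
    using f(1)[of n] by (simp add: A_def)
  moreover have "\<forall>c\<in>obj C. \<forall>x\<in>carrier (fobj (P 0) c). \<epsilon>' c (f 0 c x) = \<epsilon> c x"
    using f(1)[of 0] by (simp add: A_def)
  ultimately show ?thesis
    using f(2) unfolding B_def resolution_map_def by (intro exI[of _ f]) blast
qed

lemma resolution_null_homotopy:
  fixes P P' :: "nat \<Rightarrow> ('o, 'm, 'a) ab_fun" and F :: "('o, 'm, 'b) ab_fun"
  assumes C: "src_tgt_closed C" and F: "ab_functor C F"
    and P: "projective_resolution C F P d \<epsilon>" and P': "projective_resolution C F P' d' \<epsilon>'"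
    and u: "\<And>n. nat_trans C (P n) (P' n) (u n)"
    and \<epsilon>u: "\<And>c x. c \<in> obj C \<Longrightarrow> x \<in> carrier (fobj (P 0) c) \<Longrightarrow> \<epsilon>' c (u 0 c x) = \<one>\<^bsub>fobj F c\<^esub>"
    and du: "\<And>n c x. c \<in> obj C \<Longrightarrow> x \<in> carrier (fobj (P (Suc n)) c) \<Longrightarrow> d' n c (u (Suc n) c x) = u n c (d n c x)"
  shows "\<exists>s. (\<forall>n. nat_trans C (P n) (P' (Suc n)) (s n)) \<and>
    (\<forall>n. \<forall>c\<in>obj C. \<forall>x\<in>carrier (fobj (P (Suc n)) c).
      u (Suc n) c x = d' (Suc n) c (s (Suc n) c x) \<otimes>\<^bsub>fobj (P' (Suc n)) c\<^esub> s n c (d n c x))"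
proof -
  let ?Q = "\<lambda>n c. fobj (P' n) c"
  note p = projective_resolutionD[OF P] and p' = projective_resolutionD[OF P']
  define A where "A n s \<longleftrightarrow> nat_trans C (P n) (P' (Suc n)) s \<and>
    (\<forall>c\<in>obj C. \<forall>x\<in>carrier (fobj (P (Suc n)) c). u n c (d n c x) = d' n c (s c (d n c x)))" for n s
  define B where "B n s s' \<longleftrightarrow>
    (\<forall>c\<in>obj C. \<forall>x\<in>carrier (fobj (P (Suc n)) c).
      u (Suc n) c x = d' (Suc n) c (s' c x) \<otimes>\<^bsub>?Q (Suc n) c\<^esub> s c (d n c x))" for n s s'
  have "\<exists>s. \<forall>n. A n (s n) \<and> B n (s n) (s (Suc n))"
  proof (rule dependent_nat_choice)
    have "\<exists>s. nat_trans C (P 0) (P' (Suc 0)) s \<and> (\<forall>c\<in>obj C. \<forall>x\<in>carrier (fobj (P 0) c). d' 0 c (s c x) = u 0 c x)"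
      by (rule projective_lift[OF C p(1) p'(2) p'(2) F p'(3) p'(5) p'(6) u \<epsilon>u])
    then show "\<exists>s. A 0 s"
      unfolding A_def using nat_transD(2)[OF p(3)] by metis
  next
    fix s n assume s: "A n s"
    then have sn: "nat_trans C (P n) (P' (Suc n)) s" by (simp add: A_def)
    define v where "v c x = u (Suc n) c x \<otimes>\<^bsub>?Q (Suc n) c\<^esub> inv\<^bsub>?Q (Suc n) c\<^esub> s c (d n c x)" for c x
    have v: "nat_trans C (P (Suc n)) (P' (Suc n)) v"
      unfolding v_def by (intro nat_trans_mult nat_trans_inv nat_trans_comp[OF C p(3) sn] u C p(2) p'(2))
    have dv: "d' n c (v c x) = \<one>\<^bsub>?Q n c\<^esub>" if c: "c \<in> obj C" "x \<in> carrier (fobj (P (Suc n)) c)" for c x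
    proof -
      interpret group_hom "?Q (Suc n) c" "fobj (P' n) c" "d' n c"
        using c ab_functorD(2)[OF p'(2)] nat_transD(1)[OF p'(3)] by (simp add: group_hom_def group_hom_axioms_def)
      have cl: "u (Suc n) c x \<in> carrier (?Q (Suc n) c)" "s c (d n c x) \<in> carrier (?Q (Suc n) c)"
        using nat_transD(2)[OF u c] nat_transD(2)[OF sn c(1)] nat_transD(2)[OF p(3) c] by auto
      have "d' n c (u (Suc n) c x) = d' n c (s c (d n c x))"
        using du[OF c] s c by (simp add: A_def)
      then show ?thesis
        using cl by (simp add: v_def)
    qed
    have "\<exists>s'. nat_trans C (P (Suc n)) (P' (Suc (Suc n))) s' \<and>
        (\<forall>c\<in>obj C. \<forall>x\<in>carrier (fobj (P (Suc n)) c). d' (Suc n) c (s' c x) = v c x)"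
      by (rule projective_lift[OF C p(1) p'(2) p'(2) p'(2) p'(3) p'(3) p'(7) v dv])
    then obtain s' where s': "nat_trans C (P (Suc n)) (P' (Suc (Suc n))) s'"
      "\<And>c x. c \<in> obj C \<Longrightarrow> x \<in> carrier (fobj (P (Suc n)) c) \<Longrightarrow> d' (Suc n) c (s' c x) = v c x" by blast
    have B: "B n s s'"
      unfolding B_def
    proof (intro ballI)
      fix c x assume c: "c \<in> obj C" "x \<in> carrier (fobj (P (Suc n)) c)"
      interpret group "?Q (Suc n) c" using c ab_functorD(2)[OF p'(2)] by blast
      have cl: "u (Suc n) c x \<in> carrier (?Q (Suc n) c)" "s c (d n c x) \<in> carrier (?Q (Suc n) c)"
        using nat_transD(2)[OF u c] nat_transD(2)[OF sn c(1)] nat_transD(2)[OF p(3) c] by auto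
      then show "u (Suc n) c x = d' (Suc n) c (s' c x) \<otimes>\<^bsub>?Q (Suc n) c\<^esub> s c (d n c x)"
        unfolding s'(2)[OF c] v_def by (simp add: m_assoc)
    qed
    have "u (Suc n) c (d (Suc n) c x) = d' (Suc n) c (s' c (d (Suc n) c x))"
      if c: "c \<in> obj C" "x \<in> carrier (fobj (P (Suc (Suc n))) c)" for c x
    proof -
      interpret group "?Q (Suc n) c" using c ab_functorD(2)[OF p'(2)] by blast
      have dx: "d (Suc n) c x \<in> carrier (fobj (P (Suc n)) c)" by (rule nat_transD(2)[OF p(3) c])
      have "s c (d n c (d (Suc n) c x)) = \<one>\<^bsub>?Q (Suc n) c\<^esub>"
        using p(9)[OF c] nat_trans_one[OF _ _ sn c(1)] ab_functorD(2)[OF p(2) c(1)] is_group by simp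
      moreover have "d' (Suc n) c (s' c (d (Suc n) c x)) \<in> carrier (?Q (Suc n) c)"
        by (rule nat_transD(2)[OF p'(3) c(1) nat_transD(2)[OF s'(1) c(1) dx]])
      ultimately show ?thesis
        using B dx c(1) by (simp add: B_def)
    qed
    then show "\<exists>s'. A (Suc n) s' \<and> B n s s'"
      using B s'(1) by (auto simp: A_def)
  qed
  then show ?thesis
    unfolding A_def B_def by blast
qed

section \<open>Colimits\<close>

definition colim_inj :: "('o, 'm) small_cat \<Rightarrow> ('o, 'm, 'a) ab_fun \<Rightarrow> 'o \<Rightarrow> 'a \<Rightarrow> ('o \<Rightarrow> 'a) set" where
  "colim_inj C F c x = colim_relations C F #>\<^bsub>sum_group (obj C) (fobj F)\<^esub> sum_inj C F c x"

locale colimit =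
  fixes C :: "('o, 'm) small_cat" and F :: "('o, 'm, 'a) ab_fun"
  assumes C: "src_tgt_closed C" and F: "ab_functor C F"
begin

abbreviation (input) "S \<equiv> sum_group (obj C) (fobj F)"

abbreviation (input) "R \<equiv> colim_relations C F"

lemma group_fobj: "c \<in> obj C \<Longrightarrow> group (fobj F c)"
  using ab_functorD(2)[OF F] .

lemma carrier_S: "carrier S = {x \<in> \<Pi>\<^sub>E c\<in>obj C. carrier (fobj F c). finite {c \<in> obj C. x c \<noteq> \<one>\<^bsub>fobj F c\<^esub>}}"
  by (rule carrier_sum_group[OF group_fobj])

sublocale S: comm_group S
proof -
  interpret S: group S by (rule sum_group[OF group_fobj])
  have comm: "x \<otimes>\<^bsub>fobj F c\<^esub> y = y \<otimes>\<^bsub>fobj F c\<^esub> x"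
    if "c \<in> obj C" "x \<in> carrier (fobj F c)" "y \<in> carrier (fobj F c)" for c x y
    using comm_groupE(4)[OF ab_functorD(1)[OF F]] that by blast
  show "comm_group S"
    by (rule S.group_comm_groupI) (auto simp: carrier_S PiE_iff intro!: restrict_ext comm)
qed

lemma sum_inj_hom:
  assumes "c \<in> obj C"
  shows "sum_inj C F c \<in> hom (fobj F c) S"
proof (rule homI)
  fix x assume x: "x \<in> carrier (fobj F c)"
  have "finite {c' \<in> obj C. sum_inj C F c x c' \<noteq> \<one>\<^bsub>fobj F c'\<^esub>}"
    by (rule finite_subset[of _ "{c}"]) (auto simp: sum_inj_def)
  moreover have "\<one>\<^bsub>fobj F c'\<^esub> \<in> carrier (fobj F c')" if "c' \<in> obj C" for c'
    using group_fobj[OF that] by (simp add: group.is_monoid)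
  ultimately show "sum_inj C F c x \<in> carrier S"
    using x by (auto simp: carrier_S sum_inj_def)
next
  fix x y
  show "sum_inj C F c (x \<otimes>\<^bsub>fobj F c\<^esub> y) = sum_inj C F c x \<otimes>\<^bsub>S\<^esub> sum_inj C F c y"
    by (auto simp: sum_inj_def fun_eq_iff monoid.l_one[OF group.is_monoid[OF group_fobj]]
       monoid.one_closed[OF group.is_monoid[OF group_fobj]])
qed

lemma sum_inj_closed:
  "c \<in> obj C \<Longrightarrow> x \<in> carrier (fobj F c) \<Longrightarrow> sum_inj C F c x \<in> carrier S"
  using sum_inj_hom by (rule hom_in_carrier)

lemma src_tgt:
  assumes "f \<in> mor C"
  shows "src C f \<in> obj C" "tgt C f \<in> obj C"
  using C assms by (auto simp: src_tgt_closed_def)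

lemma R_generators:
  "{sum_inj C F (src C f) x \<otimes>\<^bsub>S\<^esub> inv\<^bsub>S\<^esub> (sum_inj C F (tgt C f) (fmor F f x))
    | f x. f \<in> mor C \<and> x \<in> carrier (fobj F (src C f))} \<subseteq> carrier S"
  using sum_inj_closed src_tgt ab_functorD(4)[OF F] S.inv_closed S.m_closed
  by (blast del: subsetI intro: subsetI)

lemma subgroup_R: "subgroup R S"
  unfolding colim_relations_def by (rule S.generate_is_subgroup[OF R_generators])

sublocale Q: comm_group "colim C F"
  unfolding colim_def by (rule S.abelian_FactGroup[OF subgroup_R])

lemma quotient_hom: "(\<lambda>x. R #>\<^bsub>S\<^esub> x) \<in> hom S (colim C F)"
  unfolding colim_def by (rule S.r_coset_hom_Mod[OF subgroup_R])

lemma colim_inj_hom: "c \<in> obj C \<Longrightarrow> colim_inj C F c \<in> hom (fobj F c) (colim C F)"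
  using hom_compose[OF sum_inj_hom quotient_hom] by (simp add: o_def colim_inj_def[abs_def])

lemma colim_inj_closed:
  "c \<in> obj C \<Longrightarrow> x \<in> carrier (fobj F c) \<Longrightarrow> colim_inj C F c x \<in> carrier (colim C F)"
  using colim_inj_hom by (rule hom_in_carrier)

lemma colim_inj_fmor:
  assumes f: "f \<in> mor C" and x: "x \<in> carrier (fobj F (src C f))"
  shows "colim_inj C F (tgt C f) (fmor F f x) = colim_inj C F (src C f) x"
proof -
  have "sum_inj C F (src C f) x \<otimes>\<^bsub>S\<^esub> inv\<^bsub>S\<^esub> (sum_inj C F (tgt C f) (fmor F f x)) \<in> R"
    unfolding colim_relations_def using f x by (intro generate.incl) blast
  then show ?thesis
    unfolding colim_inj_def
    using S.r_coset_eq_iff[OF subgroup_R] sum_inj_closed src_tgt[OF f] ab_functorD(4)[OF F f x] x by metis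
qed

lemma sum_group_generated:
  assumes H: "subgroup H S" and inj: "\<And>c x. c \<in> obj C \<Longrightarrow> x \<in> carrier (fobj F c) \<Longrightarrow> sum_inj C F c x \<in> H"
  shows "carrier S \<subseteq> H"
proof -
  have "x \<in> H" if "finite T" "x \<in> carrier S" "{c \<in> obj C. x c \<noteq> \<one>\<^bsub>fobj F c\<^esub>} = T" for T x
    using that
  proof (induction T arbitrary: x)
    case empty
    then have "x = \<one>\<^bsub>S\<^esub>"
      by (auto simp: carrier_S PiE_iff extensional_def fun_eq_iff)
    then show ?case
      using subgroup.one_closed[OF H] by (simp only:)
  next
    case (insert c T)
    have c: "c \<in> obj C" using insert.prems(2) by blast
    have xc: "x c' \<in> carrier (fobj F c')" if "c' \<in> obj C" for c'
      using insert.prems(1) that by (auto simp: carrier_S)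
    define y where "y = (\<lambda>c'\<in>obj C. if c' = c then \<one>\<^bsub>fobj F c'\<^esub> else x c')"
    have yT: "{c' \<in> obj C. y c' \<noteq> \<one>\<^bsub>fobj F c'\<^esub>} = T"
      using insert.prems(2) insert.hyps(2) by (auto simp: y_def)
    have y: "y \<in> carrier S"
      using yT insert.hyps(1) xc group_fobj by (auto simp: carrier_S) (auto simp: y_def group.is_monoid)
    have "x = sum_inj C F c (x c) \<otimes>\<^bsub>S\<^esub> y"
      using xc insert.prems(1) group_fobj
      by (auto simp: sum_inj_def y_def fun_eq_iff carrier_S PiE_iff extensional_def
         monoid.l_one[OF group.is_monoid] monoid.r_one[OF group.is_monoid])
    then show ?case
      using subgroup.m_closed[OF H inj[OF c xc[OF c]] insert.IH[OF y yT]] by simp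
  qed
  then show ?thesis
    by (auto simp: carrier_S)
qed

lemma colim_hom_eqI:
  assumes A: "group A" and h: "h \<in> hom (colim C F) A" "h' \<in> hom (colim C F) A"
    and eq: "\<And>c x. c \<in> obj C \<Longrightarrow> x \<in> carrier (fobj F c) \<Longrightarrow> h (colim_inj C F c x) = h' (colim_inj C F c x)"
    and z: "z \<in> carrier (colim C F)"
  shows "h z = h' z"
proof -
  define k k' where "k = (\<lambda>x. h (R #>\<^bsub>S\<^esub> x))" and "k' = (\<lambda>x. h' (R #>\<^bsub>S\<^esub> x))"
  interpret k: group_hom S A k
    using hom_compose[OF quotient_hom h(1)] A S.is_group
    by (simp add: group_hom_def group_hom_axioms_def k_def o_def)
  interpret k': group_hom S A k'
    using hom_compose[OF quotient_hom h(2)] A S.is_group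
    by (simp add: group_hom_def group_hom_axioms_def k'_def o_def)
  have "subgroup {x \<in> carrier S. k x = k' x} S"
    by (rule S.subgroupI) (auto intro!: exI[of _ "\<one>\<^bsub>S\<^esub>"] simp del: one_sum_group mult_sum_group inv_sum_group)
  then have "carrier S \<subseteq> {x \<in> carrier S. k x = k' x}"
    by (rule sum_group_generated) (use sum_inj_closed eq in \<open>auto simp: k_def k'_def colim_inj_def\<close>)
  moreover obtain x where "x \<in> carrier S" "z = R #>\<^bsub>S\<^esub> x"
    using z by (auto simp: colim_def carrier_FactGroup)
  ultimately show ?thesis
    by (auto simp: k_def k'_def)
qed

lemma hom_sum_kills_R:
  assumes h: "h \<in> hom S A" and A: "group A"
    and eq: "\<And>f x. f \<in> mor C \<Longrightarrow> x \<in> carrier (fobj F (src C f)) \<Longrightarrow>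
      h (sum_inj C F (tgt C f) (fmor F f x)) = h (sum_inj C F (src C f) x)"
    and xy: "x \<in> carrier S" "y \<in> carrier S" "R #>\<^bsub>S\<^esub> x = R #>\<^bsub>S\<^esub> y"
  shows "h x = h y"
proof -
  interpret h: group_hom S A h
    using h A S.is_group by (simp add: group_hom_def group_hom_axioms_def)
  have "R \<subseteq> kernel S A h"
    unfolding colim_relations_def
  proof (rule S.generate_subgroup_incl[OF _ h.subgroup_kernel], clarify)
    fix f x assume f: "f \<in> mor C" "x \<in> carrier (fobj F (src C f))"
    then have c: "sum_inj C F (src C f) x \<in> carrier S" "sum_inj C F (tgt C f) (fmor F f x) \<in> carrier S"
      using sum_inj_closed src_tgt ab_functorD(4)[OF F] by auto
    then show "sum_inj C F (src C f) x \<otimes>\<^bsub>S\<^esub> inv\<^bsub>S\<^esub> (sum_inj C F (tgt C f) (fmor F f x)) \<in> kernel S A h"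
      using eq[OF f] by (simp add: kernel_def del: mult_sum_group inv_sum_group)
  qed
  then have "x \<otimes>\<^bsub>S\<^esub> inv\<^bsub>S\<^esub> y \<in> kernel S A h"
    using S.r_coset_eq_iff[OF subgroup_R xy(1,2)] xy(3) by blast
  then have "h x \<otimes>\<^bsub>A\<^esub> inv\<^bsub>A\<^esub> h y = \<one>\<^bsub>A\<^esub>"
    using xy by (simp add: kernel_def del: mult_sum_group inv_sum_group)
  then show ?thesis
    using xy h.H.inv_solve_right[of "\<one>\<^bsub>A\<^esub>" "h x" "h y"] by (simp add: h.hom_closed)
qed

lemma colim_universal:
  assumes A: "comm_group A" and l: "\<And>c. c \<in> obj C \<Longrightarrow> l c \<in> hom (fobj F c) A"
    and eq: "\<And>f x. f \<in> mor C \<Longrightarrow> x \<in> carrier (fobj F (src C f)) \<Longrightarrow> l (tgt C f) (fmor F f x) = l (src C f) x"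
  shows "\<exists>h. h \<in> hom (colim C F) A \<and> (\<forall>c\<in>obj C. \<forall>x\<in>carrier (fobj F c). h (colim_inj C F c x) = l c x)"
proof -
  interpret A: comm_group A by fact
  define k where "k = (\<lambda>x. gfinprod A (\<lambda>c. l c (x c)) (obj C))"
  have k: "k \<in> hom S A"
    unfolding k_def by (rule A.hom_group_sum[OF l group_fobj])
  have k_inj: "k (sum_inj C F c x) = l c x" if c: "c \<in> obj C" "x \<in> carrier (fobj F c)" for c x
  proof -
    have lx: "l c x \<in> carrier A" using l c by (auto simp: hom_def)
    have one: "l c' \<one>\<^bsub>fobj F c'\<^esub> = \<one>\<^bsub>A\<^esub>" if "c' \<in> obj C" for c'
      using hom_one[OF l[OF that] group_fobj[OF that] A.is_group] .
    have "gfinprod A (\<lambda>c'. l c x) {c} = k (sum_inj C F c x)"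
      unfolding k_def
      by (rule A.gfinprod_mono_neutral_cong_left) (use c one lx in \<open>auto simp: sum_inj_def\<close>)
    then show ?thesis
      using lx by simp
  qed
  have "k (sum_inj C F (tgt C f) (fmor F f x)) = k (sum_inj C F (src C f) x)"
    if "f \<in> mor C" "x \<in> carrier (fobj F (src C f))" for f x
    using k_inj eq that src_tgt ab_functorD(4)[OF F] by simp
  note kill = hom_sum_kills_R[OF k A.is_group this]
  obtain h where h: "h \<in> hom (S Mod R) A" "\<And>x. x \<in> carrier S \<Longrightarrow> h (R #>\<^bsub>S\<^esub> x) = k x"
    using FactGroup_universal[OF k S.subgroup_imp_normal[OF subgroup_R] kill] by blast
  then show ?thesis
    using k_inj sum_inj_closed by (intro exI[of _ h]) (auto simp: colim_def colim_inj_def)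
qed

end

lemma colim_map:
  assumes C: "src_tgt_closed C" and F: "ab_functor C F" and G: "ab_functor C G" and \<eta>: "nat_trans C F G \<eta>"
  shows "colim_map C G \<eta> \<in> hom (colim C F) (colim C G)"
    and "\<And>c x. c \<in> obj C \<Longrightarrow> x \<in> carrier (fobj F c) \<Longrightarrow>
      colim_map C G \<eta> (colim_inj C F c x) = colim_inj C G c (\<eta> c x)"
proof -
  interpret F: colimit C F by unfold_locales fact+
  interpret G: colimit C G by unfold_locales fact+
  let ?S = "sum_group (obj C) (fobj F)" and ?R = "colim_relations C F"
  let ?S' = "sum_group (obj C) (fobj G)" and ?R' = "colim_relations C G"
  define e where "e x = (\<lambda>c\<in>obj C. \<eta> c (x c))" for x
  have one: "\<eta> c \<one>\<^bsub>fobj F c\<^esub> = \<one>\<^bsub>fobj G c\<^esub>" if "c \<in> obj C" for c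
    using nat_trans_one[OF F.group_fobj[OF that] G.group_fobj[OF that] \<eta> that] .
  have e_inj: "e (sum_inj C F c x) = sum_inj C G c (\<eta> c x)" if "c \<in> obj C" for c x
    using one that by (auto simp: e_def sum_inj_def fun_eq_iff)
  have e: "e \<in> hom ?S ?S'"
  proof (rule homI)
    fix x assume x: "x \<in> carrier ?S"
    have "finite {c \<in> obj C. e x c \<noteq> \<one>\<^bsub>fobj G c\<^esub>}"
      by (rule finite_subset[of _ "{c \<in> obj C. x c \<noteq> \<one>\<^bsub>fobj F c\<^esub>}"])
        (use x one in \<open>auto simp: e_def F.carrier_S\<close>)
    then show "e x \<in> carrier ?S'"
      using x nat_transD(2)[OF \<eta>] by (auto simp: F.carrier_S G.carrier_S) (auto simp: e_def)
  next
    fix x y assume "x \<in> carrier ?S" "y \<in> carrier ?S"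
    then show "e (x \<otimes>\<^bsub>?S\<^esub> y) = e x \<otimes>\<^bsub>?S'\<^esub> e y"
      using hom_mult[OF nat_transD(1)[OF \<eta>]] by (auto simp: e_def F.carrier_S fun_eq_iff PiE_iff)
  qed
  define k where "k x = ?R' #>\<^bsub>?S'\<^esub> e x" for x
  have k: "k \<in> hom ?S (colim C G)"
    using hom_compose[OF e G.quotient_hom] by (simp add: k_def[abs_def] o_def)
  have k_inj: "k (sum_inj C F c x) = colim_inj C G c (\<eta> c x)" if "c \<in> obj C" for c x
    using e_inj[OF that] by (simp add: k_def colim_inj_def)
  have keq: "k (sum_inj C F (tgt C f) (fmor F f x)) = k (sum_inj C F (src C f) x)"
    if "f \<in> mor C" "x \<in> carrier (fobj F (src C f))" for f x
    using that F.src_tgt[OF that(1)] nat_transD(3)[OF \<eta> that] nat_transD(2)[OF \<eta>]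
    by (simp add: k_inj G.colim_inj_fmor)
  have kill: "k x = k y" if "x \<in> carrier ?S" "y \<in> carrier ?S"
    "?R #>\<^bsub>?S\<^esub> x =
      ?R #>\<^bsub>?S\<^esub> y" for x y
    by (rule F.hom_sum_kills_R[OF k G.Q.is_group _ that]) (rule keq)
  have map_coset: "colim_map C G \<eta> (?R #>\<^bsub>?S\<^esub> x) = k x"
    if x: "x \<in> carrier ?S" for x
  proof -
    let ?X = "?R #>\<^bsub>?S\<^esub> x"
    have const: "k y = k x" if "y \<in> ?X" for y
    proof (rule kill)
      show "y \<in> carrier ?S"
        using F.S.r_coset_subset_G[OF subgroup.subset[OF F.subgroup_R] x] that by blast
      show "?R #>\<^bsub>?S\<^esub> y = ?X"
        using F.S.repr_independence[OF that x F.subgroup_R] by simp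
    qed (rule x)
    have "x \<in> ?X"
      by (rule F.S.rcos_self[OF x F.subgroup_R])
    then have "?X \<noteq> {}"
      by blast
    moreover have "colim_map C G \<eta> ?X = (\<Union>y\<in>?X. k y)"
      by (simp add: colim_map_def k_def e_def)
    ultimately show ?thesis
      using SUP_eq_const[of ?X k "k x", OF _ const] by simp
  qed
  have carF: "carrier (colim C F) =
      (\<lambda>x. ?R #>\<^bsub>?S\<^esub> x) ` carrier ?S"
    by (simp add: colim_def carrier_FactGroup)
  show "colim_map C G \<eta> \<in> hom (colim C F) (colim C G)"
  proof (rule homI)
    fix V assume "V \<in> carrier (colim C F)"
    then show "colim_map C G \<eta> V \<in> carrier (colim C G)"
      using map_coset hom_in_carrier[OF k] unfolding carF by auto
  next
    fix V W assume "V \<in> carrier (colim C F)"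
      "W \<in> carrier (colim C F)"
    then obtain x y where xy: "x \<in> carrier ?S" "y \<in> carrier ?S"
      "V = ?R #>\<^bsub>?S\<^esub> x"
      "W = ?R #>\<^bsub>?S\<^esub> y"
      unfolding carF by blast
    have XY: "V \<otimes>\<^bsub>colim C F\<^esub> W =
        ?R #>\<^bsub>?S\<^esub> (x \<otimes>\<^bsub>?S\<^esub> y)"
      using hom_mult[OF F.quotient_hom xy(1,2)] xy(3,4) by simp
    show "colim_map C G \<eta> (V \<otimes>\<^bsub>colim C F\<^esub> W) =
        colim_map C G \<eta> V \<otimes>\<^bsub>colim C G\<^esub> colim_map C G \<eta> W"
      unfolding XY map_coset[OF F.S.m_closed[OF xy(1,2)]] hom_mult[OF k xy(1,2)]
      unfolding xy(3,4) map_coset[OF xy(1)] map_coset[OF xy(2)] ..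
  qed
  show "colim_map C G \<eta> (colim_inj C F c x) = colim_inj C G c (\<eta> c x)"
    if "c \<in> obj C" "x \<in> carrier (fobj F c)" for c x
    using map_coset[OF F.sum_inj_closed[OF that]] k_inj[OF that(1)] by (simp add: colim_inj_def)
qed

lemma chain_complex_colim:
  assumes C: "src_tgt_closed C" and P: "projective_resolution C F P d \<epsilon>"
  shows "chain_complex (\<lambda>n. colim C (P n)) (\<lambda>n. colim_map C (P n) (d n))"
  unfolding chain_complex_def
proof (intro conjI allI ballI)
  let ?D = "\<lambda>n. colim_map C (P n) (d n)"
  note p = projective_resolutionD[OF P]
  have col: "colimit C (P n)" for n
    using C p(2) by unfold_locales
  note D = colim_map[OF C p(2) p(2) p(3)]
  show "comm_group (colim C (P n))" for n
  proof -
    interpret P: colimit C "P n" by (rule col)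
    show ?thesis by (rule P.Q.comm_group_axioms)
  qed
  fix n
  interpret P: colimit C "P n" by (rule col)
  interpret P': colimit C "P (Suc n)" by (rule col)
  interpret P'': colimit C "P (Suc (Suc n))" by (rule col)
  show "?D n \<in> hom (colim C (P (Suc n))) (colim C (P n))" by (rule D)
  fix x assume x: "x \<in> carrier (colim C (P (Suc (Suc n))))"
  show "?D n (?D (Suc n) x) = \<one>\<^bsub>colim C (P n)\<^esub>"
  proof (rule P''.colim_hom_eqI[OF P.Q.is_group _ _ _ x])
    show "(\<lambda>x. ?D n (?D (Suc n) x)) \<in> hom (colim C (P (Suc (Suc n)))) (colim C (P n))"
      using hom_compose[OF D(1) D(1)] by (simp add: o_def)
    show "(\<lambda>x. \<one>\<^bsub>colim C (P n)\<^esub>) \<in> hom (colim C (P (Suc (Suc n)))) (colim C (P n))"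
      by (rule trivial_hom[OF P.Q.is_group])
    fix c x assume c: "c \<in> obj C" "x \<in> carrier (fobj (P (Suc (Suc n))) c)"
    show "?D n (?D (Suc n) (colim_inj C (P (Suc (Suc n))) c x)) = \<one>\<^bsub>colim C (P n)\<^esub>"
      using c nat_transD(2)[OF p(3) c] p(9)[OF c] hom_one[OF P.colim_inj_hom P.group_fobj P.Q.is_group]
      by (simp add: D(2))
  qed
qed

lemma colim_homology_retract:
  fixes P P' :: "nat \<Rightarrow> ('o, 'm, 'a) ab_fun" and F :: "('o, 'm, 'b) ab_fun"
  assumes C: "src_tgt_closed C" and F: "ab_functor C F"
    and P: "projective_resolution C F P d \<epsilon>" and P': "projective_resolution C F P' d' \<epsilon>'"
    and fmap: "resolution_map C P d \<epsilon> P' d' \<epsilon>' f" and gmap: "resolution_map C P' d' \<epsilon>' P d \<epsilon> g"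
    and z: "z \<in> carrier (colim C (P (Suc k)))" "colim_map C (P k) (d k) z = \<one>\<^bsub>colim C (P k)\<^esub>"
  shows "\<exists>w\<in>carrier (colim C (P (Suc (Suc k)))).
    colim_map C (P (Suc k)) (g (Suc k)) (colim_map C (P' (Suc k)) (f (Suc k)) z) =
      colim_map C (P (Suc k)) (d (Suc k)) w \<otimes>\<^bsub>colim C (P (Suc k))\<^esub> z"
proof -
  let ?Q = "colim C (P (Suc k))"
  note p = projective_resolutionD[OF P] and p' = projective_resolutionD[OF P']
    and f = resolution_mapD[OF fmap] and g = resolution_mapD[OF gmap]
  have col: "colimit C (P n)" "colimit C (P' n)" for n
    using C p(2) p'(2) by unfold_locales
  define u where "u n c x = g n c (f n c x) \<otimes>\<^bsub>fobj (P n) c\<^esub> inv\<^bsub>fobj (P n) c\<^esub> x" for n c x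
  have grp: "group (fobj (P n) c)" "group (fobj F c)" if "c \<in> obj C" for n c
    using ab_functorD(2)[OF p(2)] ab_functorD(2)[OF F] that by auto
  have gf: "nat_trans C (P n) (P n) (\<lambda>c x. g n c (f n c x))" for n
    by (rule nat_trans_comp[OF C f(1) g(1)])
  have "\<exists>s. (\<forall>n. nat_trans C (P n) (P (Suc n)) (s n)) \<and>
    (\<forall>n. \<forall>c\<in>obj C. \<forall>x\<in>carrier (fobj (P (Suc n)) c).
      u (Suc n) c x = d (Suc n) c (s (Suc n) c x) \<otimes>\<^bsub>fobj (P (Suc n)) c\<^esub> s n c (d n c x))"
  proof (rule resolution_null_homotopy[OF C F P P])
    show "nat_trans C (P n) (P n) (u n)" for n
      unfolding u_def by (intro nat_trans_mult C p(2) gf nat_trans_inv nat_trans_id)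
  next
    fix c x assume c: "c \<in> obj C" "x \<in> carrier (fobj (P 0) c)"
    interpret group_hom "fobj (P 0) c" "fobj F c" "\<epsilon> c"
      using grp[OF c(1)] nat_transD(1)[OF p(5)] c by (simp add: group_hom_def group_hom_axioms_def)
    show "\<epsilon> c (u 0 c x) = \<one>\<^bsub>fobj F c\<^esub>"
      using c f(2)[OF c] g(2)[OF c(1) nat_transD(2)[OF f(1) c]] nat_transD(2)[OF gf c]
      by (simp add: u_def)
  next
    fix n c x assume c: "c \<in> obj C" "x \<in> carrier (fobj (P (Suc n)) c)"
    interpret group_hom "fobj (P (Suc n)) c" "fobj (P n) c" "d n c"
      using grp[OF c(1)] nat_transD(1)[OF p(3)] c by (simp add: group_hom_def group_hom_axioms_def)
    show "d n c (u (Suc n) c x) = u n c (d n c x)"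
      using c f(3)[OF c] g(3)[OF c(1) nat_transD(2)[OF f(1) c]] nat_transD(2)[OF gf c]
      by (simp add: u_def)
  qed
  then obtain s where s: "\<And>n. nat_trans C (P n) (P (Suc n)) (s n)"
    and us: "\<And>n c x. c \<in> obj C \<Longrightarrow> x \<in> carrier (fobj (P (Suc n)) c) \<Longrightarrow>
      u (Suc n) c x = d (Suc n) c (s (Suc n) c x) \<otimes>\<^bsub>fobj (P (Suc n)) c\<^esub> s n c (d n c x)"
    by blast
  interpret P: colimit C "P (Suc k)" by (rule col)
  interpret P0: colimit C "P k" by (rule col)
  let ?D = "\<lambda>n. colim_map C (P n) (d n)" and ?s = "\<lambda>n. colim_map C (P (Suc n)) (s n)"
  let ?g = "colim_map C (P (Suc k)) (g (Suc k))" and ?f = "colim_map C (P' (Suc k)) (f (Suc k))"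
  let ?i = "colim_inj C (P (Suc k))"
  note D = colim_map[OF C p(2) p(2) p(3)] and Sm = colim_map[OF C p(2) p(2) s]
    and fm = colim_map[OF C p(2) p'(2) f(1)] and gm = colim_map[OF C p'(2) p(2) g(1)]
  have "?g (?f z) = ?D (Suc k) (?s (Suc k) z) \<otimes>\<^bsub>?Q\<^esub> (?s k (?D k z) \<otimes>\<^bsub>?Q\<^esub> z)"
  proof (rule P.colim_hom_eqI[OF P.Q.is_group _ _ _ z(1)])
    show "(\<lambda>z. ?g (?f z)) \<in> hom ?Q ?Q"
      using hom_compose[OF fm(1) gm(1)] by (simp add: o_def)
    show "(\<lambda>z. ?D (Suc k) (?s (Suc k) z) \<otimes>\<^bsub>?Q\<^esub> (?s k (?D k z) \<otimes>\<^bsub>?Q\<^esub> z))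
      \<in> hom ?Q ?Q"
      using hom_compose[OF Sm(1) D(1)] hom_compose[OF D(1) Sm(1)]
      by (intro hom_mult_hom P.Q.comm_group_axioms) (auto simp: o_def hom_def)
    fix c x assume c: "c \<in> obj C" "x \<in> carrier (fobj (P (Suc k)) c)"
    interpret Pc: group "fobj (P (Suc k)) c" using grp c by blast
    note cl = nat_transD(2)[OF s c] nat_transD(2)[OF p(3) c] nat_transD(2)[OF p(3) c(1) nat_transD(2)[OF s c]]
      nat_transD(2)[OF s c(1) nat_transD(2)[OF p(3) c]] nat_transD(2)[OF f(1) c] nat_transD(2)[OF gf c]
    have "u (Suc k) c x \<otimes>\<^bsub>fobj (P (Suc k)) c\<^esub> x = g (Suc k) c (f (Suc k) c x)"
      using cl(6) c by (simp add: u_def Pc.m_assoc)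
    then have gfx: "g (Suc k) c (f (Suc k) c x) =
        d (Suc k) c (s (Suc k) c x) \<otimes>\<^bsub>fobj (P (Suc k)) c\<^esub> (s k c (d k c x) \<otimes>\<^bsub>fobj (P (Suc k)) c\<^esub> x)"
      using us[OF c] c cl by (simp add: Pc.m_assoc)
    note hm = hom_mult[OF P.colim_inj_hom[OF c(1)]]
    show "?g (?f (?i c x)) = ?D (Suc k) (?s (Suc k) (?i c x))
        \<otimes>\<^bsub>?Q\<^esub> (?s k (?D k (?i c x))
        \<otimes>\<^bsub>?Q\<^esub> ?i c x)"
      by (simp add: fm(2) gm(2) D(2) Sm(2) c cl gfx hm)
  qed
  moreover have "?s k (?D k z) = \<one>\<^bsub>?Q\<^esub>"
    unfolding z(2) by (rule hom_one[OF Sm(1) P0.Q.is_group P.Q.is_group])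
  ultimately show ?thesis
    using z(1) hom_in_carrier[OF Sm(1) z(1)] by (intro bexI[of _ "?s (Suc k) z"]) auto
qed

lemma colim_chain_map:
  assumes C: "src_tgt_closed C"
    and P: "projective_resolution C F P d \<epsilon>" and P': "projective_resolution C F P' d' \<epsilon>'"
    and fmap: "resolution_map C P d \<epsilon> P' d' \<epsilon>' f" and x: "x \<in> carrier (colim C (P (Suc n)))"
  shows "colim_map C (P' n) (f n) (colim_map C (P n) (d n) x) =
    colim_map C (P' n) (d' n) (colim_map C (P' (Suc n)) (f (Suc n)) x)"
proof -
  note p = projective_resolutionD[OF P] and p' = projective_resolutionD[OF P']
    and f = resolution_mapD[OF fmap]
  interpret P: colimit C "P (Suc n)" using C p(2) by unfold_locales
  interpret P': colimit C "P' n" using C p'(2) by unfold_locales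
  note D = colim_map[OF C p(2) p(2) p(3)] and D' = colim_map[OF C p'(2) p'(2) p'(3)]
    and fm = colim_map[OF C p(2) p'(2) f(1)]
  show ?thesis
  proof (rule P.colim_hom_eqI[OF P'.Q.is_group _ _ _ x])
    show "(\<lambda>x. colim_map C (P' n) (f n) (colim_map C (P n) (d n) x)) \<in> hom (colim C (P (Suc n))) (colim C (P' n))"
      using hom_compose[OF D(1) fm(1)] by (simp add: o_def)
    show "(\<lambda>x. colim_map C (P' n) (d' n) (colim_map C (P' (Suc n)) (f (Suc n)) x)) \<in> hom (colim C (P (Suc n))) (colim C (P' n))"
      using hom_compose[OF fm(1) D'(1)] by (simp add: o_def)
  qed (simp add: D D' fm nat_transD(2)[OF p(3)] nat_transD(2)[OF f(1)] f(3))
qed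

theorem resolution_homology_unique:
  fixes P P' :: "nat \<Rightarrow> ('o, 'm, 'a) ab_fun" and F :: "('o, 'm, 'b) ab_fun" and j :: "'b \<Rightarrow> 'a"
  assumes C: "src_tgt_closed C" and F: "ab_functor C F" and j: "inj j"
    and P: "projective_resolution C F P d \<epsilon>" and P': "projective_resolution C F P' d' \<epsilon>'"
    and k: "k \<ge> 1"
  shows "chain_homology (\<lambda>n. colim C (P n)) (\<lambda>n. colim_map C (P n) (d n)) k \<cong>
    chain_homology (\<lambda>n. colim C (P' n)) (\<lambda>n. colim_map C (P' n) (d' n)) k"
proof -
  obtain i where i: "k = Suc i" using k by (cases k) auto
  note p = projective_resolutionD[OF P] and p' = projective_resolutionD[OF P']
  obtain f where f: "resolution_map C P d \<epsilon> P' d' \<epsilon>' f"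
    using resolution_chain_map[OF C F j P P'] ..
  obtain g where g: "resolution_map C P' d' \<epsilon>' P d \<epsilon> g"
    using resolution_chain_map[OF C F j P' P] ..
  show ?thesis
  proof (rule chain_homology_iso[OF chain_complex_colim[OF C P] chain_complex_colim[OF C P'],
        where f = "\<lambda>n. colim_map C (P' n) (f n)" and g = "\<lambda>n. colim_map C (P n) (g n)"])
    show "colim_map C (P' n) (f n) \<in> hom (colim C (P n)) (colim C (P' n))" for n
      by (rule colim_map(1)[OF C p(2) p'(2) resolution_mapD(1)[OF f]])
    show "colim_map C (P n) (g n) \<in> hom (colim C (P' n)) (colim C (P n))" for n
      by (rule colim_map(1)[OF C p'(2) p(2) resolution_mapD(1)[OF g]])
    show "\<exists>w\<in>carrier (colim C (P (Suc k))). colim_map C (P k) (g k) (colim_map C (P' k) (f k) z) =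
        colim_map C (P k) (d k) w \<otimes>\<^bsub>colim C (P k)\<^esub> z"
      if "z \<in> chain_cycles (\<lambda>n. colim C (P n)) (\<lambda>n. colim_map C (P n) (d n)) k" for z
      using colim_homology_retract[OF C F P P' f g, of z i] that i by (auto simp: chain_cycles_def kernel_def)
    show "\<exists>w\<in>carrier (colim C (P' (Suc k))). colim_map C (P' k) (f k) (colim_map C (P k) (g k) z) =
        colim_map C (P' k) (d' k) w \<otimes>\<^bsub>colim C (P' k)\<^esub> z"
      if "z \<in> chain_cycles (\<lambda>n. colim C (P' n)) (\<lambda>n. colim_map C (P' n) (d' n)) k" for z
      using colim_homology_retract[OF C F P' P g f, of z i] that i by (auto simp: chain_cycles_def kernel_def)
  qed (fact colim_chain_map[OF C P P' f] colim_chain_map[OF C P' P g])+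
qed

section \<open>Words and their first letters\<close>

fun front :: "('e \<times> 'e) set \<Rightarrow> 'e \<Rightarrow> 'e list \<Rightarrow> bool" where
  "front I e [] \<longleftrightarrow> False"
| "front I e (a # w) \<longleftrightarrow> a = e \<or> (a, e) \<in> I \<and> front I e w"

lemma front_in_set: "front I e w \<Longrightarrow> e \<in> set w"
  by (induction w) auto

lemma front_append: "front I e w \<Longrightarrow> front I e (w @ v)"
  by (induction w) auto

lemma front_remove1:
  assumes "sym I" "front I e w" "front I f w" "e \<noteq> f"
  shows "(e, f) \<in> I \<and> front I f (remove1 e w)"
  using assms(2,3)
proof (induction w)
  case (Cons a w)
  then show ?case
    using assms(1,4) by (cases "a = e"; cases "a = f") (auto dest: symD)
qed simp

declare in_lists_conv_set [simp del] in_listsD [rule del] in_listsI [rule del]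

locale fpc =
  fixes E :: "'e set" and I :: "('e \<times> 'e) set"
  assumes I_sub: "I \<subseteq> E \<times> E" and I_irrefl: "irrefl I" and I_sym: "sym I"
begin

abbreviation (input) "W \<equiv> fpc_cong E I"

lemma cong_lists: "(u, v) \<in> W \<Longrightarrow> u \<in> lists E \<and> v \<in> lists E"
  by (induction rule: fpc_cong.induct) (use I_sub in auto)

lemma cong_context:
  assumes "(u, v) \<in> W" "p \<in> lists E" "q \<in> lists E"
  shows "(p @ u @ q, p @ v @ q) \<in> W"
  using assms(1)
proof (induction rule: fpc_cong.induct)
  case (swap a b u v)
  then have "((p @ u) @ [a, b] @ v @ q, (p @ u) @ [b, a] @ v @ q) \<in> W"
    using assms(2,3) by (intro fpc_cong.swap) auto
  then show ?case by simp
next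
  case (refl w)
  then show ?case using assms(2,3) by (intro fpc_cong.refl) auto
qed (blast intro: fpc_cong.sym fpc_cong.trans)+

lemma cong_append:
  assumes "(u, v) \<in> W" "(u', v') \<in> W"
  shows "(u @ u', v @ v') \<in> W"
proof -
  have "(u @ u', v @ u') \<in> W"
    using cong_context[OF assms(1), of "[]" u'] cong_lists[OF assms(2)] by simp
  also have "(v @ u', v @ v') \<in> W"
    using cong_context[OF assms(2), of v "[]"] cong_lists[OF assms(1)] by simp
  finally (fpc_cong.trans) show ?thesis .
qed

lemma cong_length: "(u, v) \<in> W \<Longrightarrow> length u = length v"
  by (induction rule: fpc_cong.induct) auto

lemma front_swap:
  assumes "(a, b) \<in> I"
  shows "front I e (u @ [a, b] @ v) \<longleftrightarrow> front I e (u @ [b, a] @ v)"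
  by (induction u) (use assms I_sym in \<open>auto dest: symD\<close>)

lemma cong_front: "(u, v) \<in> W \<Longrightarrow> front I e u \<longleftrightarrow> front I e v"
proof (induction rule: fpc_cong.induct)
  case (swap a b u v)
  show ?case by (rule front_swap[OF swap(1)])
qed simp_all

lemma lists_remove1:
  assumes "u \<in> lists E"
  shows "remove1 e u \<in> lists E"
proof -
  have "set (remove1 e u) \<subseteq> set u" by (rule set_remove1_subset)
  then show ?thesis using assms unfolding in_lists_conv_set by blast
qed

lemma remove1_swap:
  assumes "(a, b) \<in> I" "u \<in> lists E" "v \<in> lists E"
  shows "(remove1 e (u @ [a, b] @ v), remove1 e (u @ [b, a] @ v)) \<in> W"
proof -
  have ab: "a \<noteq> b" "a \<in> E" "b \<in> E"
    using assms(1) I_irrefl I_sub by (auto simp: irrefl_def)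
  consider "e \<in> set u" | "e \<notin> set u" "e = a \<or> e = b" | "e \<notin> set u" "e \<noteq> a" "e \<noteq> b" by blast
  then show ?thesis
  proof cases
    case 1
    then show ?thesis
      using fpc_cong.swap[OF assms(1) lists_remove1[OF assms(2)] assms(3)] by (simp add: remove1_append)
  next
    case 2
    then show ?thesis
      using ab assms by (auto simp: remove1_append intro!: fpc_cong.refl)
  next
    case 3
    then show ?thesis
      using fpc_cong.swap[OF assms(1) assms(2) lists_remove1[OF assms(3)]] by (simp add: remove1_append)
  qed
qed

lemma cong_remove1: "(u, v) \<in> W \<Longrightarrow> (remove1 e u, remove1 e v) \<in> W"
proof (induction rule: fpc_cong.induct)
  case (swap a b u v)
  then show ?case by (rule remove1_swap)
next
  case (refl w)
  then show ?case by (intro fpc_cong.refl lists_remove1)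
qed (blast intro: fpc_cong.sym fpc_cong.trans)+

lemma front_cong_Cons:
  assumes "front I e w" "w \<in> lists E"
  shows "(w, e # remove1 e w) \<in> W"
  using assms
proof (induction w)
  case (Cons a w)
  show ?case
  proof (cases "a = e")
    case True
    then show ?thesis using Cons.prems fpc_cong.refl[of "e # w"] by simp
  next
    case False
    then have ae: "(a, e) \<in> I" "front I e w" using Cons.prems by auto
    then have "(w, e # remove1 e w) \<in> W"
      using Cons by auto
    then have "(a # w, a # e # remove1 e w) \<in> W"
      using cong_context[of w "e # remove1 e w" "[a]" "[]"] Cons.prems by simp
    moreover have "(a # e # remove1 e w, e # a # remove1 e w) \<in> W"
      using fpc_cong.swap[OF ae(1), where u = "[]" and v = "remove1 e w"] lists_remove1 Cons.prems by auto
    ultimately show ?thesis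
      using False by (auto intro: fpc_cong.trans)
  qed
qed simp

section \<open>The free partially commutative monoid\<close>

abbreviation (input) "M \<equiv> fpc_monoid E I"

abbreviation (input) times_M (infixl \<open>\<odot>\<close> 70) where
  "\<mu> \<odot> \<nu> \<equiv> \<mu> \<otimes>\<^bsub>M\<^esub> \<nu>"

definition cls :: "'e list \<Rightarrow> 'e list set" where
  "cls u = W `` {u}"

lemma equiv_W: "equiv (lists E) W"
  by (rule equivI) (auto simp: refl_on_def intro: fpc_cong.refl symI transI
      dest: cong_lists fpc_cong.sym fpc_cong.trans)

lemma cls_eq_iff: "u \<in> lists E \<Longrightarrow> v \<in> lists E \<Longrightarrow> cls u = cls v \<longleftrightarrow> (u, v) \<in> W"
  unfolding cls_def using eq_equiv_class_iff[OF equiv_W] by blast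

lemma mem_cls: "v \<in> cls u \<longleftrightarrow> (u, v) \<in> W"
  by (simp add: cls_def)

lemma self_mem_cls: "u \<in> lists E \<Longrightarrow> u \<in> cls u"
  by (simp add: mem_cls fpc_cong.refl)

lemma carrier_M: "carrier M = cls ` lists E"
  by (auto simp: fpc_monoid_def quotient_def cls_def)

lemma cls_closed [simp]: "u \<in> lists E \<Longrightarrow> cls u \<in> carrier M"
  by (simp add: carrier_M)

lemma one_M: "\<one>\<^bsub>M\<^esub> = cls []"
  by (simp add: fpc_monoid_def cls_def)

lemma mult_cls:
  assumes "u \<in> lists E" "v \<in> lists E"
  shows "cls u \<odot> cls v = cls (u @ v)"
proof -
  have "cls (u' @ v') = cls (u @ v)" if "u' \<in> cls u" "v' \<in> cls v" for u' v'
    using that cong_append[of u u' v v'] cong_lists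
    by (subst cls_eq_iff) (auto simp: mem_cls intro: fpc_cong.sym)
  then have "(\<Union>u'\<in>cls u. \<Union>v'\<in>cls v. cls (u' @ v')) = cls (u @ v)"
    using self_mem_cls assms by blast
  then show ?thesis
    by (simp add: fpc_monoid_def cls_def)
qed

definition len :: "'e list set \<Rightarrow> nat" where
  "len \<mu> = length (SOME u. u \<in> \<mu>)"

definition fronts :: "'e list set \<Rightarrow> 'e set" where
  "fronts \<mu> = {e. \<exists>u\<in>\<mu>. front I e u}"

text \<open>\<open>lquot e \<mu>\<close> is a left quotient only if \<open>e\<close> is a first letter of \<open>\<mu>\<close>.\<close>

definition lquot :: "'e \<Rightarrow> 'e list set \<Rightarrow> 'e list set" where
  "lquot e \<mu> = (\<Union>u\<in>\<mu>. cls (remove1 e u))"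

lemma len_cls: "u \<in> lists E \<Longrightarrow> len (cls u) = length u"
  unfolding len_def using someI[of "\<lambda>v. v \<in> cls u", OF self_mem_cls] cong_length
  by (fastforce simp: mem_cls)

lemma fronts_cls: "u \<in> lists E \<Longrightarrow> fronts (cls u) = {e. front I e u}"
  using self_mem_cls cong_front by (auto simp: fronts_def mem_cls)

lemma lquot_cls:
  assumes u: "u \<in> lists E"
  shows "lquot e (cls u) = cls (remove1 e u)"
proof -
  have "cls (remove1 e v) = cls (remove1 e u)" if "v \<in> cls u" for v
    using that u cong_lists cong_remove1 lists_remove1
    by (subst cls_eq_iff) (auto simp: mem_cls intro: fpc_cong.sym)
  then show ?thesis
    unfolding lquot_def using self_mem_cls[OF u] by blast
qed

lemma lquot_closed: "\<mu> \<in> carrier M \<Longrightarrow> lquot e \<mu> \<in> carrier M"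
  by (auto simp: carrier_M lquot_cls lists_remove1)

lemma fronts_sub:
  assumes "\<mu> \<in> carrier M"
  shows "fronts \<mu> \<subseteq> E"
proof -
  obtain u where u: "u \<in> lists E" "\<mu> = cls u"
    using assms by (auto simp: carrier_M)
  then have "fronts \<mu> \<subseteq> set u"
    using front_in_set by (auto simp: fronts_cls)
  then show ?thesis
    using u(1) unfolding in_lists_conv_set by blast
qed

lemma finite_fronts:
  assumes "\<mu> \<in> carrier M"
  shows "finite (fronts \<mu>)"
proof -
  obtain u where u: "u \<in> lists E" "\<mu> = cls u"
    using assms by (auto simp: carrier_M)
  then have "fronts \<mu> \<subseteq> set u"
    using front_in_set by (auto simp: fronts_cls)
  then show ?thesis
    by (rule finite_subset) simp
qed

lemma fronts_eq_empty:
  assumes "\<mu> \<in> carrier M" "fronts \<mu> = {}"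
  shows "\<mu> = \<one>\<^bsub>M\<^esub>"
proof -
  obtain u where u: "u \<in> lists E" "\<mu> = cls u"
    using assms(1) by (auto simp: carrier_M)
  then have "u = []"
    using assms(2) by (cases u) (auto simp: fronts_cls)
  then show ?thesis
    using u by (simp add: one_M)
qed

lemma fronts_lquot:
  assumes "\<mu> \<in> carrier M" "e \<in> fronts \<mu>" "f \<in> fronts \<mu>" "e \<noteq> f"
  shows "f \<in> fronts (lquot e \<mu>)" "(e, f) \<in> I"
  using assms front_remove1[OF I_sym] by (auto simp: carrier_M fronts_cls lquot_cls lists_remove1)

lemma lquot_commute: "\<mu> \<in> carrier M \<Longrightarrow> lquot e (lquot f \<mu>) = lquot f (lquot e \<mu>)"
  by (auto simp: carrier_M lquot_cls lists_remove1 remove1_commute)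

lemma len_lquot:
  assumes "\<mu> \<in> carrier M" "e \<in> fronts \<mu>"
  shows "len \<mu> = Suc (len (lquot e \<mu>))"
proof -
  obtain u where u: "u \<in> lists E" "\<mu> = cls u"
    using assms by (auto simp: carrier_M)
  then have "e \<in> set u"
    using assms(2) front_in_set by (auto simp: fronts_cls)
  then show ?thesis
    using u length_pos_if_in_set[of e u] by (simp add: lquot_cls lists_remove1 len_cls length_remove1)
qed

lemma mult_closed: "\<mu> \<in> carrier M \<Longrightarrow> \<nu> \<in> carrier M \<Longrightarrow> \<mu> \<odot> \<nu> \<in> carrier M"
  by (auto simp: carrier_M mult_cls)

lemma one_closed: "\<one>\<^bsub>M\<^esub> \<in> carrier M"
  by (simp add: one_M)

lemma mult_assoc:
  "\<mu> \<in> carrier M \<Longrightarrow> \<nu> \<in> carrier M \<Longrightarrow> \<rho> \<in> carrier M \<Longrightarrow>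
    (\<mu> \<odot> \<nu>) \<odot> \<rho> = \<mu> \<odot> (\<nu> \<odot> \<rho>)"
  by (auto simp: carrier_M mult_cls)

lemma mult_one: "\<mu> \<in> carrier M \<Longrightarrow> \<mu> \<odot> \<one>\<^bsub>M\<^esub> = \<mu>"
  by (auto simp: carrier_M one_M mult_cls)

lemma fronts_mult: "\<mu> \<in> carrier M \<Longrightarrow> \<nu> \<in> carrier M \<Longrightarrow> fronts \<mu> \<subseteq> fronts (\<mu> \<odot> \<nu>)"
  by (auto simp: carrier_M mult_cls fronts_cls front_append)

lemma lquot_mult:
  assumes "\<mu> \<in> carrier M" "\<nu> \<in> carrier M" "e \<in> fronts \<mu>"
  shows "lquot e (\<mu> \<odot> \<nu>) = lquot e \<mu> \<odot> \<nu>"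
proof -
  obtain u v where u: "u \<in> lists E" "\<mu> = cls u" and v: "v \<in> lists E" "\<nu> = cls v"
    using assms by (auto simp: carrier_M)
  then have "e \<in> set u"
    using assms(3) front_in_set by (auto simp: fronts_cls)
  then show ?thesis
    using u v by (simp add: mult_cls lquot_cls lists_remove1 remove1_append)
qed

definition clique :: "'e set \<Rightarrow> bool" where
  "clique \<sigma> \<longleftrightarrow> finite \<sigma> \<and> \<sigma> \<subseteq> E \<and> (\<forall>a\<in>\<sigma>. \<forall>b\<in>\<sigma>. a \<noteq> b \<longrightarrow> (a, b) \<in> I)"

lemma clique_fronts:
  assumes "\<mu> \<in> carrier M" "\<sigma> \<subseteq> fronts \<mu>"
  shows "clique \<sigma>"
  unfolding clique_def
proof (intro conjI ballI impI)
  show "finite \<sigma>" "\<sigma> \<subseteq> E"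
    using assms finite_fronts[OF assms(1)] fronts_sub[OF assms(1)] by (auto intro: finite_subset)
  show "(a, b) \<in> I" if "a \<in> \<sigma>" "b \<in> \<sigma>" "a \<noteq> b" for a b
    using fronts_lquot(2)[OF assms(1) _ _ that(3)] that assms(2) by blast
qed

lemma clique_subset: "clique \<sigma> \<Longrightarrow> \<tau> \<subseteq> \<sigma> \<Longrightarrow> clique \<tau>"
  unfolding clique_def by (meson finite_subset order_trans subsetD)

definition enum :: "'e set \<Rightarrow> 'e list" where
  "enum \<sigma> = (SOME es. set es = \<sigma> \<and> distinct es)"

lemma enum:
  assumes "clique \<sigma>"
  shows "set (enum \<sigma>) = \<sigma>" "distinct (enum \<sigma>)" "enum \<sigma> \<in> lists E"
proof -
  have "\<exists>es. set es = \<sigma> \<and> distinct es"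
    using assms by (intro finite_distinct_list) (simp add: clique_def)
  from someI_ex[OF this] show *: "set (enum \<sigma>) = \<sigma>" "distinct (enum \<sigma>)"
    unfolding enum_def by blast+
  show "enum \<sigma> \<in> lists E"
    using assms unfolding in_lists_conv_set clique_def * by blast
qed

lemma front_clique:
  assumes "clique \<sigma>" "set es \<subseteq> \<sigma>" "e \<in> set es"
  shows "front I e es"
  using assms(2,3)
proof (induction es)
  case (Cons a es)
  have "(a, e) \<in> I" if "a \<noteq> e"
    using assms(1) Cons.prems that unfolding clique_def by (meson list.set_intros(1) subsetD)
  then show ?case
    using Cons by auto
qed simp

lemma fronts_factor:
  assumes "distinct es" "w \<in> lists E" "\<And>e. e \<in> set es \<Longrightarrow> front I e w"
  shows "\<exists>v\<in>lists E. (w, es @ v) \<in> W"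
  using assms
proof (induction es arbitrary: w)
  case Nil
  then show ?case by (auto intro: fpc_cong.refl)
next
  case (Cons e es)
  have e: "front I e w" using Cons.prems by simp
  have "front I f (remove1 e w)" if "f \<in> set es" for f
    using front_remove1[OF I_sym e, of f] Cons.prems that by auto
  then obtain v where v: "v \<in> lists E" "(remove1 e w, es @ v) \<in> W"
    using Cons.IH[of "remove1 e w"] Cons.prems lists_remove1 by auto
  have "e \<in> E" using front_in_set[OF e] Cons.prems(2) unfolding in_lists_conv_set by blast
  then have "(e # remove1 e w, e # es @ v) \<in> W"
    using cong_context[OF v(2), of "[e]" "[]"] by simp
  then show ?case
    using v(1) front_cong_Cons[OF e Cons.prems(2)] by (auto intro: fpc_cong.trans)
qed

lemma cong_cancel:
  assumes "(es @ u, es @ v) \<in> W"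
  shows "(u, v) \<in> W"
  using assms
proof (induction es)
  case (Cons e es)
  then show ?case
    using cong_remove1[of "(e # es) @ u" "(e # es) @ v" e] by simp
qed simp

definition clique_elem :: "'e set \<Rightarrow> 'e list set" where
  "clique_elem \<sigma> = cls (enum \<sigma>)"

lemma clique_elem_closed: "clique \<sigma> \<Longrightarrow> clique_elem \<sigma> \<in> carrier M"
  by (simp add: clique_elem_def enum)

lemma fronts_clique_elem: "clique \<sigma> \<Longrightarrow> \<sigma> \<subseteq> fronts (clique_elem \<sigma>)"
  using front_clique[of \<sigma> "enum \<sigma>"] enum[of \<sigma>] by (auto simp: clique_elem_def fronts_cls)

lemma clique_elem_factor:
  assumes "clique \<sigma>" "\<mu> \<in> carrier M" "\<sigma> \<subseteq> fronts \<mu>"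
  shows "\<exists>!\<nu>. \<nu> \<in> carrier M \<and> clique_elem \<sigma> \<odot> \<nu> = \<mu>"
proof -
  obtain w where w: "w \<in> lists E" "\<mu> = cls w"
    using assms(2) by (auto simp: carrier_M)
  then have "front I e w" if "e \<in> set (enum \<sigma>)" for e
    using that assms enum(1) by (auto simp: fronts_cls)
  then obtain v where v: "v \<in> lists E" "(w, enum \<sigma> @ v) \<in> W"
    using fronts_factor[of "enum \<sigma>" w] w enum[OF assms(1)] by blast
  have "clique_elem \<sigma> \<odot> cls v = \<mu>"
    using v w enum(3)[OF assms(1)] by (simp add: clique_elem_def mult_cls cls_eq_iff fpc_cong.sym)
  moreover have "\<nu> = cls v" if \<nu>: "\<nu> \<in> carrier M" "clique_elem \<sigma> \<odot> \<nu> = \<mu>" for \<nu>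
  proof -
    obtain u where u: "u \<in> lists E" "\<nu> = cls u" using \<nu>(1) by (auto simp: carrier_M)
    then have "(enum \<sigma> @ u, w) \<in> W"
      using \<nu>(2) w enum(3)[OF assms(1)] by (simp add: clique_elem_def mult_cls cls_eq_iff)
    then have "(enum \<sigma> @ u, enum \<sigma> @ v) \<in> W"
      using v(2) by (rule fpc_cong.trans)
    then show ?thesis
      using cong_cancel u v cls_eq_iff by blast
  qed
  ultimately show ?thesis
    using v(1) by (intro ex1I[of _ "cls v"]) auto
qed

end

section \<open>Free abelian groups\<close>

abbreviation supp :: "('a \<Rightarrow>\<^sub>0 int) \<Rightarrow> 'a set" where
  "supp \<equiv> Poly_Mapping.keys"

lemma frag_extend_frag_extend:
  "frag_extend f (frag_extend g z) = frag_extend (\<lambda>x. frag_extend f (g x)) z"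
  using subset_UNIV by (induction z rule: frag_induction) (auto simp: frag_extend_diff)

lemma frag_extend_fun_diff:
  "frag_extend (\<lambda>x. f x - g x) z = frag_extend f z - frag_extend g z"
  using subset_UNIV by (induction z rule: frag_induction) (auto simp: frag_extend_diff)

lemma frag_extend_sum_of:
  assumes "finite A"
  shows "frag_extend f (\<Sum>e\<in>A. frag_cmul (c e) (frag_of (g e))) = (\<Sum>e\<in>A. frag_cmul (c e) (f (g e)))"
  using assms by (simp add: frag_extend_sum frag_extend_cmul o_def)

lemma frag_cmul_diff_distrib2: "frag_cmul c (a - b) = frag_cmul c a - frag_cmul c b"
  using frag_cmul_distrib2[of c a "- b"] by (simp add: poly_mapping_eq_iff fun_eq_iff lookup_minus algebra_simps)

lemma keys_frag_extend_subset:
  assumes "supp z \<subseteq> A" "\<And>a. a \<in> A \<Longrightarrow> supp (f a) \<subseteq> B"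
  shows "supp (frag_extend f z) \<subseteq> B"
  using keys_frag_extend[of f z] assms by blast

lemma frag_extend_hom:
  assumes "\<And>a. a \<in> A \<Longrightarrow> supp (f a) \<subseteq> B"
  shows "frag_extend f \<in> hom (free_Abelian_group A) (free_Abelian_group B)"
proof (rule homI)
  fix x assume "x \<in> carrier (free_Abelian_group A)"
  then show "frag_extend f x \<in> carrier (free_Abelian_group B)"
    using keys_frag_extend_subset[of x A f B, OF _ assms] by simp
qed (simp add: frag_extend_add)

lemma keys_sum_subset:
  assumes "\<And>e. e \<in> A \<Longrightarrow> supp (f e) \<subseteq> B"
  shows "supp (sum f A) \<subseteq> B"
  using keys_sum[of f A] assms by blast

lemma free_Abelian_group_hom_eqI:
  assumes H: "group H" and f: "f \<in> hom (free_Abelian_group A) H" "g \<in> hom (free_Abelian_group A) H"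
    and eq: "\<And>a. a \<in> A \<Longrightarrow> f (frag_of a) = g (frag_of a)"
    and z: "supp z \<subseteq> A"
  shows "f z = g z"
  using z
proof (rule free_Abelian_group_induct)
  interpret f: group_hom "free_Abelian_group A" H f
    using H f by (simp add: group_hom_def group_hom_axioms_def)
  interpret g: group_hom "free_Abelian_group A" H g
    using H f by (simp add: group_hom_def group_hom_axioms_def)
  show "f 0 = g 0"
    using f.hom_one g.hom_one by simp
  show "f (x - y) = g (x - y)"
    if "supp x \<subseteq> A" "supp y \<subseteq> A" "f x = g x" "f y = g y" for x y
  proof -
    have "x - y = x \<otimes>\<^bsub>free_Abelian_group A\<^esub> inv\<^bsub>free_Abelian_group A\<^esub> y"
      using that by simp
    moreover have dist: "h (x \<otimes>\<^bsub>free_Abelian_group A\<^esub> inv\<^bsub>free_Abelian_group A\<^esub> y) = h x \<otimes>\<^bsub>H\<^esub> inv\<^bsub>H\<^esub> h y"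
      if "group_hom (free_Abelian_group A) H h" for h
    proof -
      interpret h: group_hom "free_Abelian_group A" H h by fact
      have c: "x \<in> carrier (free_Abelian_group A)" "y \<in> carrier (free_Abelian_group A)"
        using \<open>supp x \<subseteq> A\<close> \<open>supp y \<subseteq> A\<close> by simp_all
      show ?thesis
        by (simp only: h.hom_mult[OF c(1) group.inv_closed[OF group_free_Abelian_group c(2)]] h.hom_inv[OF c(2)])
    qed
    ultimately show ?thesis
      using that dist[OF f.group_hom_axioms] dist[OF g.group_hom_axioms] by simp
  qed
qed (rule eq)

section \<open>The Koszul resolution\<close>

locale fpc_act = fpc E I for E :: "'e set" and I +
  fixes lt :: "'e \<Rightarrow> 'e \<Rightarrow> bool" and pts :: "'x set" and st :: "'x \<Rightarrow> 'e \<Rightarrow> 'x"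
  assumes lt_irrefl: "\<not> lt a a" and lt_trans: "lt a b \<Longrightarrow> lt b c \<Longrightarrow> lt a c"
    and lt_total: "a \<noteq> b \<Longrightarrow> lt a b \<or> lt b a"
    and st_closed: "x \<in> pts \<Longrightarrow> e \<in> E \<Longrightarrow> st x e \<in> pts"
    and st_comm: "x \<in> pts \<Longrightarrow> (a, b) \<in> I \<Longrightarrow> st (st x a) b = st (st x b) a"
begin

definition sg :: "'e set \<Rightarrow> 'e \<Rightarrow> int" where
  "sg \<sigma> e = (- 1) ^ card {f \<in> \<sigma>. lt f e}"

lemma lt_asym: "lt a b \<Longrightarrow> \<not> lt b a"
  using lt_trans lt_irrefl by blast

lemma sg_anticommute:
  assumes "finite \<sigma>" "e \<in> \<sigma>" "f \<in> \<sigma>" "e \<noteq> f"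
  shows "sg \<sigma> e * sg (\<sigma> - {e}) f = - (sg \<sigma> f * sg (\<sigma> - {f}) e)"
proof -
  have *: "sg \<sigma> f = - sg (\<sigma> - {e}) f \<and> sg (\<sigma> - {f}) e = sg \<sigma> e"
    if "e \<in> \<sigma>" "lt e f" for e f
  proof
    have "{g \<in> \<sigma>. lt g f} = insert e {g \<in> \<sigma> - {e}. lt g f}"
      using that by blast
    then have "card {g \<in> \<sigma>. lt g f} = Suc (card {g \<in> \<sigma> - {e}. lt g f})"
      using assms(1) by simp
    then show "sg \<sigma> f = - sg (\<sigma> - {e}) f"
      by (simp add: sg_def)
    have "{g \<in> \<sigma> - {f}. lt g e} = {g \<in> \<sigma>. lt g e}"
      using that lt_asym by blast
    then show "sg (\<sigma> - {f}) e = sg \<sigma> e"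
      by (simp add: sg_def)
  qed
  from lt_total[OF assms(4)] show ?thesis
  proof
    assume "lt e f"
    with *[OF assms(2)] show ?thesis by simp
  next
    assume "lt f e"
    with *[OF assms(3)] show ?thesis by simp
  qed
qed

lemma alternating_sum_eq_0:
  assumes fin: "finite \<sigma>" and B: "\<And>e f. e \<in> \<sigma> \<Longrightarrow> f \<in> \<sigma> \<Longrightarrow> e \<noteq> f \<Longrightarrow> B e f = B f e"
  shows "(\<Sum>e\<in>\<sigma>. frag_cmul (sg \<sigma> e) (\<Sum>f\<in>\<sigma> - {e}. frag_cmul (sg (\<sigma> - {e}) f) (B e f))) = 0"
proof -
  define a where "a e f = (if e = f then 0 else frag_cmul (sg \<sigma> e * sg (\<sigma> - {e}) f) (B e f))" for e f
  have "frag_cmul (sg \<sigma> e) (\<Sum>f\<in>\<sigma> - {e}. frag_cmul (sg (\<sigma> - {e}) f) (B e f)) = (\<Sum>f\<in>\<sigma>. a e f)"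
    if "e \<in> \<sigma>" for e
    unfolding frag_cmul_sum by (rule sum.mono_neutral_cong_left) (use fin in \<open>auto simp: a_def\<close>)
  then have T: "(\<Sum>e\<in>\<sigma>. frag_cmul (sg \<sigma> e) (\<Sum>f\<in>\<sigma> - {e}. frag_cmul (sg (\<sigma> - {e}) f) (B e f)))
      = (\<Sum>e\<in>\<sigma>. \<Sum>f\<in>\<sigma>. a e f)" (is "?T = _")
    by (intro sum.cong) auto
  have aa: "a f e = - a e f" if "e \<in> \<sigma>" "f \<in> \<sigma>" for e f
    using B[OF that] sg_anticommute[OF fin that] by (auto simp: a_def)
  have "?T = (\<Sum>f\<in>\<sigma>. \<Sum>e\<in>\<sigma>. a e f)"
    unfolding T by (rule sum.swap)
  also have "\<dots> = (\<Sum>f\<in>\<sigma>. \<Sum>e\<in>\<sigma>. - a f e)"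
    by (rule sum.cong[OF HOL.refl], rule sum.cong[OF HOL.refl]) (rule aa)
  also have "\<dots> = - ?T"
    unfolding T by (simp only: sum_negf)
  finally have "?T + ?T = 0"
    by (simp add: eq_neg_iff_add_eq_0)
  then have "frag_cmul (1 + 1) ?T = 0"
    by (simp only: frag_cmul_distrib frag_cmul_one)
  then show ?thesis
    by (simp only: frag_cmul_eq_0_iff) simp
qed

definition actm :: "'x \<Rightarrow> 'e list set \<Rightarrow> 'x" where
  "actm x \<mu> = the_elem (foldl st x ` \<mu>)"

lemma foldl_closed: "x \<in> pts \<Longrightarrow> u \<in> lists E \<Longrightarrow> foldl st x u \<in> pts"
  by (induction u arbitrary: x) (auto simp: st_closed)

lemma cong_foldl: "(u, v) \<in> W \<Longrightarrow> x \<in> pts \<Longrightarrow> foldl st x u = foldl st x v"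
proof (induction rule: fpc_cong.induct)
  case (swap a b u v)
  then show ?case
    using st_comm[OF foldl_closed[OF swap(4,2)] swap(1)] by simp
qed simp_all

lemma actm_cls:
  assumes "u \<in> lists E" "x \<in> pts"
  shows "actm x (cls u) = foldl st x u"
proof -
  have "foldl st x v = foldl st x u" if "v \<in> cls u" for v
    using cong_foldl[OF _ assms(2), of u v] that by (simp add: mem_cls)
  then have "foldl st x ` cls u \<subseteq> {foldl st x u}"
    by blast
  then have "foldl st x ` cls u = {foldl st x u}"
    using self_mem_cls[OF assms(1)] by blast
  then show ?thesis by (simp add: actm_def)
qed

lemma actm_closed: "x \<in> pts \<Longrightarrow> \<mu> \<in> carrier M \<Longrightarrow> actm x \<mu> \<in> pts"
  by (auto simp: carrier_M actm_cls foldl_closed)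

lemma actm_one: "x \<in> pts \<Longrightarrow> actm x \<one>\<^bsub>M\<^esub> = x"
  by (simp add: one_M actm_cls)

lemma actm_mult: "x \<in> pts \<Longrightarrow> \<mu> \<in> carrier M \<Longrightarrow> \<nu> \<in> carrier M \<Longrightarrow> actm x (\<mu> \<odot> \<nu>) = actm (actm x \<mu>) \<nu>"
  by (auto simp: carrier_M actm_cls mult_cls foldl_closed)

lemma actm_lquot:
  assumes "x \<in> pts" "\<mu> \<in> carrier M" "e \<in> fronts \<mu>"
  shows "actm (st x e) (lquot e \<mu>) = actm x \<mu>"
proof -
  obtain u where u: "u \<in> lists E" "\<mu> = cls u"
    using assms by (auto simp: carrier_M)
  then have e: "front I e u" "e \<in> E"
    using assms fronts_sub[OF assms(2)] by (auto simp: fronts_cls)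
  show ?thesis
    using cong_foldl[OF front_cong_Cons[OF e(1) u(1)] assms(1)] u assms(1) e(2)
    by (simp add: lquot_cls actm_cls lists_remove1 st_closed)
qed

definition gens :: "nat \<Rightarrow> 'x \<Rightarrow> ('x \<times> 'e set \<times> 'e list set) set" where
  "gens n c = {(x, \<sigma>, \<mu>). x \<in> pts \<and> \<mu> \<in> carrier M \<and> \<sigma> \<subseteq> fronts \<mu> \<and> card \<sigma> = n \<and> actm x \<mu> = c}"

lemma gensD:
  assumes "(x, \<sigma>, \<mu>) \<in> gens n c"
  shows "x \<in> pts" "\<mu> \<in> carrier M" "\<sigma> \<subseteq> fronts \<mu>" "card \<sigma> = n" "actm x \<mu> = c" "finite \<sigma>"
proof -
  show "x \<in> pts" "\<mu> \<in> carrier M" "\<sigma> \<subseteq> fronts \<mu>" "card \<sigma> = n" "actm x \<mu> = c"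
    using assms by (simp_all add: gens_def)
  then show "finite \<sigma>"
    using finite_fronts finite_subset by blast
qed

definition bd1 :: "'x \<times> 'e set \<times> 'e list set \<Rightarrow> ('x \<times> 'e set \<times> 'e list set) \<Rightarrow>\<^sub>0 int" where
  "bd1 = (\<lambda>(x, \<sigma>, \<mu>). \<Sum>e\<in>\<sigma>. frag_cmul (sg \<sigma> e) (frag_of (x, \<sigma> - {e}, \<mu>)))"

definition bd2 :: "'x \<times> 'e set \<times> 'e list set \<Rightarrow> ('x \<times> 'e set \<times> 'e list set) \<Rightarrow>\<^sub>0 int" where
  "bd2 = (\<lambda>(x, \<sigma>, \<mu>). \<Sum>e\<in>\<sigma>. frag_cmul (sg \<sigma> e) (frag_of (st x e, \<sigma> - {e}, lquot e \<mu>)))"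

definition bd :: "'x \<times> 'e set \<times> 'e list set \<Rightarrow> ('x \<times> 'e set \<times> 'e list set) \<Rightarrow>\<^sub>0 int" where
  "bd b = bd1 b - bd2 b"

lemma bd_eq:
  "bd (x, \<sigma>, \<mu>) = (\<Sum>e\<in>\<sigma>. frag_cmul (sg \<sigma> e) (frag_of (x, \<sigma> - {e}, \<mu>) - frag_of (st x e, \<sigma> - {e}, lquot e \<mu>)))"
  by (simp add: bd_def bd1_def bd2_def sum_subtractf frag_cmul_diff_distrib2)

lemma gens_faces:
  assumes "(x, \<sigma>, \<mu>) \<in> gens (Suc n) c" "e \<in> \<sigma>"
  shows "(x, \<sigma> - {e}, \<mu>) \<in> gens n c" "(st x e, \<sigma> - {e}, lquot e \<mu>) \<in> gens n c"
    "len \<mu> = Suc (len (lquot e \<mu>))"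
proof -
  have b: "x \<in> pts" "\<mu> \<in> carrier M" "\<sigma> \<subseteq> fronts \<mu>" "card \<sigma> = Suc n" "actm x \<mu> = c"
    using gensD[OF assms(1)] by auto
  have e: "e \<in> fronts \<mu>" "e \<in> E"
    using assms(2) b(3) fronts_sub[OF b(2)] by auto
  have card: "card (\<sigma> - {e}) = n"
    using assms(2) b(4) by simp
  show "(x, \<sigma> - {e}, \<mu>) \<in> gens n c"
    using b card by (auto simp: gens_def)
  have "\<sigma> - {e} \<subseteq> fronts (lquot e \<mu>)"
    using fronts_lquot(1)[OF b(2) e(1)] b(3) by blast
  then show "(st x e, \<sigma> - {e}, lquot e \<mu>) \<in> gens n c"
    using b card e st_closed lquot_closed actm_lquot by (auto simp: gens_def)
  show "len \<mu> = Suc (len (lquot e \<mu>))"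
    by (rule len_lquot[OF b(2) e(1)])
qed

lemma keys_bd1:
  assumes "b \<in> gens (Suc n) c"
  shows "supp (bd1 b) \<subseteq> gens n c"
proof -
  obtain x \<sigma> \<mu> where b: "b = (x, \<sigma>, \<mu>)" by (cases b)
  show ?thesis
    unfolding b bd1_def prod.case
    by (rule keys_sum_subset) (use gens_faces(1) assms b in \<open>auto dest!: subsetD[OF keys_cmul]\<close>)
qed

lemma keys_bd2:
  assumes "b \<in> gens (Suc n) c"
  shows "supp (bd2 b) \<subseteq> {b' \<in> gens n c. len (snd (snd b')) < len (snd (snd b))}"
proof -
  obtain x \<sigma> \<mu> where b: "b = (x, \<sigma>, \<mu>)" by (cases b)
  show ?thesis
    unfolding b bd2_def prod.case
    by (rule keys_sum_subset) (use gens_faces(2,3) assms b in \<open>auto dest!: subsetD[OF keys_cmul]\<close>)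
qed

lemma keys_bd: "b \<in> gens (Suc n) c \<Longrightarrow> supp (bd b) \<subseteq> gens n c"
  unfolding bd_def using keys_diff[of "bd1 b" "bd2 b"] keys_bd1 keys_bd2 by blast

lemma bd_bd:
  assumes "b \<in> gens n c"
  shows "frag_extend bd (bd b) = 0"
proof -
  obtain x \<sigma> \<mu> where b: "b = (x, \<sigma>, \<mu>)" by (cases b)
  have fin: "finite \<sigma>" and x: "x \<in> pts" and \<mu>: "\<mu> \<in> carrier M" and \<sigma>: "\<sigma> \<subseteq> fronts \<mu>"
    using gensD[OF assms[unfolded b]] by auto
  define B where "B e f = frag_of (x, \<sigma> - {e} - {f}, \<mu>) - frag_of (st x f, \<sigma> - {e} - {f}, lquot f \<mu>)
     - (frag_of (st x e, \<sigma> - {e} - {f}, lquot e \<mu>) - frag_of (st (st x e) f, \<sigma> - {e} - {f}, lquot f (lquot e \<mu>)))" for e f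
  have "frag_extend bd (frag_of (x, \<sigma> - {e}, \<mu>) - frag_of (st x e, \<sigma> - {e}, lquot e \<mu>)) =
      (\<Sum>f\<in>\<sigma> - {e}. frag_cmul (sg (\<sigma> - {e}) f) (B e f))" for e
    by (simp add: frag_extend_diff bd_eq B_def sum_subtractf frag_cmul_diff_distrib2)
  then have "frag_extend bd (bd b) =
      (\<Sum>e\<in>\<sigma>. frag_cmul (sg \<sigma> e) (\<Sum>f\<in>\<sigma> - {e}. frag_cmul (sg (\<sigma> - {e}) f) (B e f)))"
    unfolding b bd_eq frag_extend_sum[OF fin] o_def frag_extend_cmul by simp
  also have "\<dots> = 0"
  proof (rule alternating_sum_eq_0[OF fin])
    fix e f assume ef: "e \<in> \<sigma>" "f \<in> \<sigma>" "e \<noteq> f"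
    then have "(e, f) \<in> I"
      using fronts_lquot(2)[OF \<mu>] \<sigma> by blast
    then have "st (st x e) f = st (st x f) e" by (rule st_comm[OF x])
    moreover have "\<sigma> - {e} - {f} = \<sigma> - {f} - {e}" by blast
    ultimately show "B e f = B f e"
      unfolding B_def by (simp add: lquot_commute[OF \<mu>, of f e])
  qed
  finally show ?thesis .
qed

definition least :: "'e set \<Rightarrow> 'e" where
  "least A = (SOME m. m \<in> A \<and> (\<forall>f\<in>A. f \<noteq> m \<longrightarrow> lt m f))"

lemma least:
  assumes "finite A" "A \<noteq> {}"
  shows "least A \<in> A" "f \<in> A \<Longrightarrow> f \<noteq> least A \<Longrightarrow> lt (least A) f"
proof -
  have "\<exists>m. m \<in> A \<and> (\<forall>f\<in>A. f \<noteq> m \<longrightarrow> lt m f)"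
    using assms
  proof (induction A rule: finite_ne_induct)
    case (insert a A)
    then obtain m where m: "m \<in> A" "\<And>f. f \<in> A \<Longrightarrow> f \<noteq> m \<Longrightarrow> lt m f" by blast
    show ?case
    proof (cases "lt m a")
      case True
      with m show ?thesis by (intro exI[of _ m]) auto
    next
      case False
      then have "lt a m" using lt_total m(1) insert.hyps by metis
      then have "lt a f" if "f \<in> A" for f using m that lt_trans by metis
      then show ?thesis by (intro exI[of _ a]) auto
    qed
  qed blast
  from someI_ex[OF this]
  show "least A \<in> A" "f \<in> A \<Longrightarrow> f \<noteq> least A \<Longrightarrow> lt (least A) f"
    unfolding least_def by blast+
qed

definition hb :: "'x \<times> 'e set \<times> 'e list set \<Rightarrow> ('x \<times> 'e set \<times> 'e list set) \<Rightarrow>\<^sub>0 int" where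
  "hb = (\<lambda>(x, \<sigma>, \<mu>). if fronts \<mu> = {} \<or> least (fronts \<mu>) \<in> \<sigma> then 0
    else frag_of (x, insert (least (fronts \<mu>)) \<sigma>, \<mu>))"

lemma keys_hb:
  assumes "b \<in> gens n c"
  shows "supp (hb b) \<subseteq> {b' \<in> gens (Suc n) c. snd (snd b') = snd (snd b)}"
proof -
  obtain x \<sigma> \<mu> where b: "b = (x, \<sigma>, \<mu>)" by (cases b)
  have "\<mu> \<in> carrier M" "finite \<sigma>"
    using gensD[OF assms[unfolded b]] by auto
  then show ?thesis
    using assms least(1)[OF finite_fronts] by (auto simp: b hb_def gens_def)
qed

lemma bd1_hb:
  assumes b: "(x, \<sigma>, \<mu>) \<in> gens n c" and ne: "fronts \<mu> \<noteq> {}"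
  shows "frag_extend bd1 (hb (x, \<sigma>, \<mu>)) + frag_extend hb (bd1 (x, \<sigma>, \<mu>)) = frag_of (x, \<sigma>, \<mu>)"
proof -
  let ?m = "least (fronts \<mu>)"
  have \<mu>: "\<mu> \<in> carrier M" and \<sigma>: "\<sigma> \<subseteq> fronts \<mu>" and fin: "finite \<sigma>"
    using gensD[OF b] by auto
  note m = least[OF finite_fronts[OF \<mu>] ne]
  have sg_m: "sg \<tau> ?m = 1" if "\<tau> \<subseteq> fronts \<mu>" for \<tau>
  proof -
    have "{f \<in> \<tau>. lt f ?m} = {}"
      using that m(2) lt_asym lt_irrefl by blast
    then have "card {f \<in> \<tau>. lt f ?m} = 0"
      by (simp only: card.empty)
    then show ?thesis by (simp add: sg_def)
  qed
  have hbd: "frag_extend hb (bd1 (x, \<sigma>, \<mu>)) = (\<Sum>e\<in>\<sigma>. frag_cmul (sg \<sigma> e) (hb (x, \<sigma> - {e}, \<mu>)))"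
    by (simp add: bd1_def frag_extend_sum_of[OF fin])
  show ?thesis
  proof (cases "?m \<in> \<sigma>")
    case False
    have sg_e: "sg (insert ?m \<sigma>) e = - sg \<sigma> e" if "e \<in> \<sigma>" for e
    proof -
      have "lt ?m e" using m(2)[of e] that \<sigma> False by blast
      then have "{f \<in> insert ?m \<sigma>. lt f e} = insert ?m {f \<in> \<sigma>. lt f e}" by blast
      then have "card {f \<in> insert ?m \<sigma>. lt f e} = Suc (card {f \<in> \<sigma>. lt f e})"
        using False fin by simp
      then show ?thesis by (simp add: sg_def)
    qed
    have "frag_extend bd1 (hb (x, \<sigma>, \<mu>)) = bd1 (x, insert ?m \<sigma>, \<mu>)"
      using False ne by (simp add: hb_def)
    also have "\<dots> = frag_cmul (sg (insert ?m \<sigma>) ?m) (frag_of (x, insert ?m \<sigma> - {?m}, \<mu>)) +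
        (\<Sum>e\<in>\<sigma>. frag_cmul (sg (insert ?m \<sigma>) e) (frag_of (x, insert ?m \<sigma> - {e}, \<mu>)))"
      unfolding bd1_def prod.case by (rule sum.insert[OF fin False])
    also have "\<dots> = frag_of (x, \<sigma>, \<mu>) + (\<Sum>e\<in>\<sigma>. - frag_cmul (sg \<sigma> e) (hb (x, \<sigma> - {e}, \<mu>)))"
    proof -
      have "insert ?m \<sigma> - {?m} = \<sigma>" using False by blast
      moreover have "frag_cmul (sg (insert ?m \<sigma>) e) (frag_of (x, insert ?m \<sigma> - {e}, \<mu>)) =
          - frag_cmul (sg \<sigma> e) (hb (x, \<sigma> - {e}, \<mu>))" if "e \<in> \<sigma>" for e
      proof -
        have "insert ?m \<sigma> - {e} = insert ?m (\<sigma> - {e})" using False that by blast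
        then show ?thesis
          using False ne that by (simp add: sg_e hb_def)
      qed
      ultimately show ?thesis
        using sg_m[of "insert ?m \<sigma>"] \<sigma> m(1) by simp
    qed
    finally show ?thesis
      unfolding hbd by (simp add: sum_negf del: minus_frag_cmul)
  next
    case True
    have z: "hb (x, \<sigma> - {e}, \<mu>) = 0" if "e \<in> \<sigma> - {?m}" for e
      using that True by (auto simp: hb_def)
    have "frag_extend hb (bd1 (x, \<sigma>, \<mu>)) = frag_cmul (sg \<sigma> ?m) (hb (x, \<sigma> - {?m}, \<mu>))"
      unfolding hbd using sum.remove[OF fin True, of "\<lambda>e. frag_cmul (sg \<sigma> e) (hb (x, \<sigma> - {e}, \<mu>))"] z by simp
    moreover have "insert ?m (\<sigma> - {?m}) = \<sigma>" using True by blast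
    ultimately show ?thesis
      using True ne sg_m[OF \<sigma>] by (simp add: hb_def)
  qed
qed

lemma homotopy_remainder:
  assumes b: "b \<in> gens (Suc n) c"
  shows "supp (frag_of b - frag_extend bd (hb b) - frag_extend hb (bd b))
    \<subseteq> {b' \<in> gens (Suc n) c. len (snd (snd b')) < len (snd (snd b))}" (is "_ \<subseteq> ?A")
proof -
  obtain x \<sigma> \<mu> where beq: "b = (x, \<sigma>, \<mu>)" by (cases b)
  have ne: "fronts \<mu> \<noteq> {}"
    using b by (auto simp: beq gens_def)
  have "frag_extend bd1 (hb b) + frag_extend hb (bd1 b) = frag_of b"
    using bd1_hb[OF b[unfolded beq] ne] beq by simp
  moreover have "frag_extend bd (hb b) = frag_extend bd1 (hb b) - frag_extend bd2 (hb b)"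
    unfolding bd_def[abs_def] by (rule frag_extend_fun_diff)
  moreover have "frag_extend hb (bd b) = frag_extend hb (bd1 b) - frag_extend hb (bd2 b)"
    unfolding bd_def by (rule frag_extend_diff)
  ultimately have eq: "frag_of b - frag_extend bd (hb b) - frag_extend hb (bd b) =
      frag_extend bd2 (hb b) + frag_extend hb (bd2 b)"
    by (simp add: algebra_simps)
  have "supp (frag_extend bd2 (hb b)) \<subseteq> ?A"
  proof (rule keys_frag_extend_subset[OF keys_hb[OF b]])
    fix a assume a: "a \<in> {b' \<in> gens (Suc (Suc n)) c. snd (snd b') = snd (snd b)}"
    then have "a \<in> gens (Suc (Suc n)) c" by blast
    from keys_bd2[OF this] show "supp (bd2 a) \<subseteq> ?A"
      using a by auto
  qed
  moreover have "supp (frag_extend hb (bd2 b)) \<subseteq> ?A"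
  proof (rule keys_frag_extend_subset[OF keys_bd2[OF b]])
    fix a assume a: "a \<in> {b' \<in> gens n c. len (snd (snd b')) < len (snd (snd b))}"
    then have "a \<in> gens n c" by blast
    from keys_hb[OF this] show "supp (hb a) \<subseteq> ?A"
      using a by auto
  qed
  ultimately show ?thesis
    unfolding eq using keys_add[of "frag_extend bd2 (hb b)" "frag_extend hb (bd2 b)"] by blast
qed

lemma bd_exact:
  assumes "supp z \<subseteq> gens (Suc n) c" "frag_extend bd z = 0"
  shows "\<exists>y. supp y \<subseteq> gens (Suc (Suc n)) c \<and> frag_extend bd y = z"
proof -
  have "\<exists>y. supp y \<subseteq> gens (Suc (Suc n)) c \<and> frag_extend bd y = z"
    if "supp z \<subseteq> {b \<in> gens (Suc n) c. len (snd (snd b)) < L}" "frag_extend bd z = 0" for L z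
    using that
  proof (induction L arbitrary: z)
    case 0
    then have "z = 0" by simp
    then show ?case by (intro exI[of _ 0]) simp
  next
    case (Suc L)
    have zg: "supp z \<subseteq> gens (Suc n) c" using Suc.prems(1) by blast
    let ?y = "frag_extend hb z"
    have y: "supp ?y \<subseteq> gens (Suc (Suc n)) c"
      by (rule keys_frag_extend_subset[OF zg]) (use keys_hb in blast)
    define z' where "z' = z - frag_extend bd ?y"
    have "frag_extend (\<lambda>b. frag_of b - frag_extend bd (hb b) - frag_extend hb (bd b)) z =
        frag_extend frag_of z - frag_extend (\<lambda>b. frag_extend bd (hb b)) z - frag_extend (\<lambda>b. frag_extend hb (bd b)) z"
      by (simp only: frag_extend_fun_diff)
    also have "\<dots> = z'"
      using frag_extend_frag_extend[of hb bd z] frag_extend_frag_extend[of bd hb z] Suc.prems(2)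
      by (simp add: z'_def frag_expansion[symmetric])
    finally have z': "frag_extend (\<lambda>b. frag_of b - frag_extend bd (hb b) - frag_extend hb (bd b)) z = z'" .
    have "supp z' \<subseteq> {b \<in> gens (Suc n) c. len (snd (snd b)) < L}"
      unfolding z'[symmetric]
    proof (rule keys_frag_extend_subset[OF Suc.prems(1)])
      fix b assume b: "b \<in> {b \<in> gens (Suc n) c. len (snd (snd b)) < Suc L}"
      then have "b \<in> gens (Suc n) c" by blast
      from homotopy_remainder[OF this]
      show "supp (frag_of b - frag_extend bd (hb b) - frag_extend hb (bd b))
          \<subseteq> {b \<in> gens (Suc n) c. len (snd (snd b)) < L}"
        using b by auto
    qed
    moreover have "frag_extend bd z' = 0"
    proof -
      have "frag_extend bd (frag_extend bd ?y) = 0"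
        unfolding frag_extend_frag_extend[of bd bd ?y]
        by (rule frag_extend_eq_0) (use y bd_bd in blast)
      then show ?thesis
        using Suc.prems(2) by (simp add: z'_def frag_extend_diff)
    qed
    ultimately obtain y' where "supp y' \<subseteq> gens (Suc (Suc n)) c" "frag_extend bd y' = z'"
      using Suc.IH by blast
    then show ?case
      using y keys_add[of y' ?y] by (intro exI[of _ "y' + ?y"]) (auto simp: frag_extend_add z'_def)
  qed
  moreover obtain L where "\<And>b. b \<in> supp z \<Longrightarrow> len (snd (snd b)) < L"
  proof
    fix b assume "b \<in> supp z"
    then show "len (snd (snd b)) < Suc (Max ((\<lambda>b. len (snd (snd b))) ` supp z))"
      by (simp add: le_imp_less_Suc)
  qed
  ultimately show ?thesis
    using assms by blast
qed

definition aug :: "(('x \<times> 'e set \<times> 'e list set) \<Rightarrow>\<^sub>0 int) \<Rightarrow> int" where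
  "aug z = poly_mapping.lookup (frag_extend (\<lambda>_. frag_of ()) z) ()"

lemma aug_simps:
  "aug (frag_of b) = 1" "aug 0 = 0" "aug (y + z) = aug y + aug z" "aug (y - z) = aug y - aug z"
  by (simp_all add: aug_def frag_extend_add frag_extend_diff lookup_add lookup_minus)

lemma aug_bd:
  assumes "supp z \<subseteq> gens (Suc n) c"
  shows "aug (frag_extend bd z) = 0"
proof -
  have aug0: "aug (bd b) = 0" for b
  proof -
    obtain x \<sigma> \<mu> where b: "b = (x, \<sigma>, \<mu>)" by (cases b)
    have "frag_extend (\<lambda>_. frag_of ()) (\<Sum>e\<in>\<sigma>. frag_cmul (sg \<sigma> e) (frag_of (x, \<sigma> - {e}, \<mu>) - frag_of (st x e, \<sigma> - {e}, lquot e \<mu>))) = 0"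
      by (cases "finite \<sigma>") (simp_all add: frag_extend_sum frag_extend_cmul frag_extend_diff)
    then show ?thesis
      by (simp add: aug_def b bd_eq)
  qed
  show ?thesis
    using assms by (induction z rule: frag_induction) (simp_all add: aug_simps frag_extend_diff aug0)
qed

lemma gens_0_connected:
  assumes "b \<in> gens 0 c"
  shows "\<exists>y. supp y \<subseteq> gens (Suc 0) c \<and> frag_extend bd y = frag_of b - frag_of (c, {}, \<one>\<^bsub>M\<^esub>)"
  using assms
proof (induction "len (snd (snd b))" arbitrary: b rule: less_induct)
  case less
  obtain x \<sigma> \<mu> where b: "b = (x, \<sigma>, \<mu>)" by (cases b)
  have \<mu>: "\<mu> \<in> carrier M" and x: "x \<in> pts" and \<sigma>: "\<sigma> = {}" and c: "actm x \<mu> = c"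
    using gensD[OF less.prems[unfolded b]] by auto
  show ?case
  proof (cases "fronts \<mu> = {}")
    case True
    then have "\<mu> = \<one>\<^bsub>M\<^esub>" by (rule fronts_eq_empty[OF \<mu>])
    then have "b = (c, {}, \<one>\<^bsub>M\<^esub>)"
      using c x by (simp add: b \<sigma> actm_one)
    then show ?thesis by (intro exI[of _ 0]) simp
  next
    case False
    then obtain e where e: "e \<in> fronts \<mu>" by blast
    have g: "(x, {e}, \<mu>) \<in> gens (Suc 0) c"
      using \<mu> x c e by (auto simp: gens_def)
    have bd: "bd (x, {e}, \<mu>) = frag_of b - frag_of (st x e, {}, lquot e \<mu>)"
      by (simp add: bd_eq sg_def lt_irrefl b \<sigma> cong: conj_cong)
    have "(st x e, {}, lquot e \<mu>) \<in> gens 0 c" "len (lquot e \<mu>) < len \<mu>"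
      using gens_faces(2,3)[OF g, of e] by auto
    then obtain y where y: "supp y \<subseteq> gens (Suc 0) c"
      "frag_extend bd y = frag_of (st x e, {}, lquot e \<mu>) - frag_of (c, {}, \<one>\<^bsub>M\<^esub>)"
      using less.hyps[of "(st x e, {}, lquot e \<mu>)"] b by auto
    then show ?thesis
      using g keys_add[of "frag_of (x, {e}, \<mu>)" y]
      by (intro exI[of _ "frag_of (x, {e}, \<mu>) + y"]) (auto simp: frag_extend_add bd)
  qed
qed

lemma aug_exact:
  assumes "supp z \<subseteq> gens 0 c" "aug z = 0"
  shows "\<exists>y. supp y \<subseteq> gens (Suc 0) c \<and> frag_extend bd y = z"
proof -
  have "\<exists>y. supp y \<subseteq> gens (Suc 0) c \<and> frag_extend bd y = z - frag_cmul (aug z) (frag_of (c, {}, \<one>\<^bsub>M\<^esub>))"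
    using assms(1)
  proof (induction z rule: frag_induction)
    case zero
    then show ?case by (intro exI[of _ 0]) (simp add: aug_simps)
  next
    case (one b)
    then show ?case using gens_0_connected[of b c] by (simp add: aug_simps)
  next
    case (diff z w)
    then obtain y y' where
      "supp y \<subseteq> gens (Suc 0) c" "frag_extend bd y = z - frag_cmul (aug z) (frag_of (c, {}, \<one>\<^bsub>M\<^esub>))"
      "supp y' \<subseteq> gens (Suc 0) c" "frag_extend bd y' = w - frag_cmul (aug w) (frag_of (c, {}, \<one>\<^bsub>M\<^esub>))"
      by blast
    then show ?case
      using keys_diff[of y y']
      by (intro exI[of _ "y - y'"]) (auto simp: frag_extend_diff aug_simps frag_cmul_diff_distrib)
  qed
  then show ?thesis
    using assms(2) by simp
qed

definition kset :: "('x, 'e list set) right_set" where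
  "kset = \<lparr>points = pts, act = actm\<rparr>"

abbreviation (input) "kcat \<equiv> elements_cat M kset"

lemma kcat_simps [simp]:
  "obj kcat = pts"
  "src kcat (x, \<mu>, y) = x" "tgt kcat (x, \<mu>, y) = y"
  "idm kcat x = (x, \<one>\<^bsub>M\<^esub>, x)"
  "cmps kcat (x, \<mu>, y) (x', \<nu>, y') = (x, \<mu> \<odot> \<nu>, y')"
  by (simp_all add: elements_cat_def kset_def)

lemma mor_kcat: "(x, \<mu>, y) \<in> mor kcat \<longleftrightarrow> x \<in> pts \<and> \<mu> \<in> carrier M \<and> y = actm x \<mu>"
  using actm_closed by (auto simp: elements_cat_def kset_def)

lemma mor_kcatE:
  assumes "f \<in> mor kcat"
  obtains x \<mu> where "f = (x, \<mu>, actm x \<mu>)" "x \<in> pts" "\<mu> \<in> carrier M" "actm x \<mu> \<in> pts"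
  using assms actm_closed by (cases f) (auto simp: mor_kcat)

lemma src_tgt_closed_kcat: "src_tgt_closed kcat"
  by (auto simp: src_tgt_closed_def elim!: mor_kcatE)

definition tr :: "'e list set \<Rightarrow> 'x \<times> 'e set \<times> 'e list set \<Rightarrow> ('x \<times> 'e set \<times> 'e list set) \<Rightarrow>\<^sub>0 int" where
  "tr \<nu> = (\<lambda>(x, \<sigma>, \<mu>). frag_of (x, \<sigma>, \<mu> \<odot> \<nu>))"

lemma gens_mult:
  assumes "(x, \<sigma>, \<mu>) \<in> gens n c" "\<nu> \<in> carrier M"
  shows "(x, \<sigma>, \<mu> \<odot> \<nu>) \<in> gens n (actm c \<nu>)"
  using gensD[OF assms(1)] assms(2) fronts_mult[OF _ assms(2), of \<mu>]
  by (auto simp: gens_def mult_closed actm_mult)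

lemma keys_tr: "b \<in> gens n c \<Longrightarrow> \<nu> \<in> carrier M \<Longrightarrow> supp (tr \<nu> b) \<subseteq> gens n (actm c \<nu>)"
  by (cases b) (simp add: tr_def gens_mult)

definition kos :: "nat \<Rightarrow> ('x, 'x \<times> 'e list set \<times> 'x, ('x \<times> 'e set \<times> 'e list set) \<Rightarrow>\<^sub>0 int) ab_fun" where
  "kos n = \<lparr>fobj = (\<lambda>c. free_Abelian_group (gens n c)), fmor = (\<lambda>(x, \<nu>, y). frag_extend (tr \<nu>))\<rparr>"

lemma kos_simps [simp]:
  "fobj (kos n) c = free_Abelian_group (gens n c)"
  "fmor (kos n) (x, \<nu>, y) = frag_extend (tr \<nu>)"
  by (simp_all add: kos_def)

lemma frag_extend_tr:
  assumes "supp z \<subseteq> gens n c"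
  shows "frag_extend (tr \<one>\<^bsub>M\<^esub>) z = z"
    and "\<nu> \<in> carrier M \<Longrightarrow> \<rho> \<in> carrier M \<Longrightarrow>
      frag_extend (tr (\<nu> \<odot> \<rho>)) z = frag_extend (tr \<rho>) (frag_extend (tr \<nu>) z)"
    and "\<nu> \<in> carrier M \<Longrightarrow> frag_extend bd (frag_extend (tr \<nu>) z) = frag_extend (tr \<nu>) (frag_extend bd z)"
proof -
  have "frag_extend (tr \<one>\<^bsub>M\<^esub>) z = frag_extend frag_of z"
    by (rule frag_extend_eq) (use assms gensD(2) in \<open>auto simp: tr_def mult_one\<close>)
  then show "frag_extend (tr \<one>\<^bsub>M\<^esub>) z = z"
    by (simp add: frag_expansion[symmetric])
  show "frag_extend (tr (\<nu> \<odot> \<rho>)) z = frag_extend (tr \<rho>) (frag_extend (tr \<nu>) z)"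
    if "\<nu> \<in> carrier M" "\<rho> \<in> carrier M"
    unfolding frag_extend_frag_extend
    by (rule frag_extend_eq) (use assms gensD(2) that in \<open>auto simp: tr_def mult_assoc\<close>)
  show "frag_extend bd (frag_extend (tr \<nu>) z) = frag_extend (tr \<nu>) (frag_extend bd z)"
    if "\<nu> \<in> carrier M"
    unfolding frag_extend_frag_extend
  proof (rule frag_extend_eq)
    fix b assume "b \<in> supp z"
    moreover obtain x \<sigma> \<mu> where b: "b = (x, \<sigma>, \<mu>)" by (cases b)
    ultimately have g: "(x, \<sigma>, \<mu>) \<in> gens n c" using assms by blast
    note g = gensD[OF g]
    have lq: "lquot e (\<mu> \<odot> \<nu>) = lquot e \<mu> \<odot> \<nu>" if "e \<in> \<sigma>" for e
      using lquot_mult[OF g(2) \<open>\<nu> \<in> carrier M\<close>] g(3) that by blast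
    have "bd (x, \<sigma>, \<mu> \<odot> \<nu>) = frag_extend (tr \<nu>) (bd (x, \<sigma>, \<mu>))"
      unfolding bd_eq frag_extend_sum[OF g(6)] o_def frag_extend_cmul frag_extend_diff
      by (rule sum.cong) (simp_all add: tr_def lq)
    then show "frag_extend bd (tr \<nu> b) = frag_extend (tr \<nu>) (bd b)"
      by (simp add: b tr_def)
  qed
qed

lemma ab_functor_kos: "ab_functor kcat (kos n)"
  unfolding ab_functor_def
proof (intro conjI ballI impI)
  show "comm_group (fobj (kos n) c)" for c
    by (simp add: abelian_free_Abelian_group)
  show "fmor (kos n) f \<in> hom (fobj (kos n) (src kcat f)) (fobj (kos n) (tgt kcat f))" if "f \<in> mor kcat" for f
    using that
  proof (rule mor_kcatE)
    fix x \<mu> assume f: "f = (x, \<mu>, actm x \<mu>)" "\<mu> \<in> carrier M"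
    show ?thesis
      using frag_extend_hom[OF keys_tr[OF _ f(2)]] by (simp add: f(1))
  qed
  show "fmor (kos n) (idm kcat c) z = z" if "z \<in> carrier (fobj (kos n) c)" for c z
    using that frag_extend_tr(1) by simp
  show "fmor (kos n) (cmps kcat f g) z = fmor (kos n) g (fmor (kos n) f z)"
    if f: "f \<in> mor kcat" and g: "g \<in> mor kcat" and "tgt kcat f = src kcat g"
      and z: "z \<in> carrier (fobj (kos n) (src kcat f))" for f g z
    using f
  proof (rule mor_kcatE)
    fix x \<mu> assume f: "f = (x, \<mu>, actm x \<mu>)" "\<mu> \<in> carrier M"
    from g show ?thesis
    proof (rule mor_kcatE)
      fix y \<nu> assume g: "g = (y, \<nu>, actm y \<nu>)" "\<nu> \<in> carrier M"
      show ?thesis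
        using z frag_extend_tr(2)[OF _ f(2) g(2)] by (simp add: f(1) g(1))
    qed
  qed
qed

lemma nat_trans_bd: "nat_trans kcat (kos (Suc n)) (kos n) (\<lambda>c. frag_extend bd)"
  unfolding nat_trans_def
proof (intro conjI ballI)
  show "frag_extend bd \<in> hom (fobj (kos (Suc n)) c) (fobj (kos n) c)" for c
    using frag_extend_hom[OF keys_bd] by simp
  show "frag_extend bd (fmor (kos (Suc n)) f z) = fmor (kos n) f (frag_extend bd z)"
    if "f \<in> mor kcat" "z \<in> carrier (fobj (kos (Suc n)) (src kcat f))" for f z
    using that(1) by (rule mor_kcatE) (use that(2) frag_extend_tr(3) in auto)
qed

lemma nat_trans_aug: "nat_trans kcat (kos 0) (const_functor integer_group) (\<lambda>c. aug)"
  unfolding nat_trans_def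
proof (intro conjI ballI)
  show "aug \<in> hom (fobj (kos 0) c) (fobj (const_functor integer_group) c)" for c
    by (auto simp: const_functor_def integer_group_def aug_simps intro!: homI)
  show "aug (fmor (kos 0) f z) = fmor (const_functor integer_group) f (aug z)"
    if "f \<in> mor kcat" for f z
    using that
  proof (rule mor_kcatE)
    fix x \<nu> assume f: "f = (x, \<nu>, actm x \<nu>)"
    have "frag_extend (\<lambda>_. frag_of ()) (frag_extend (tr \<nu>) z) = frag_extend (\<lambda>_. frag_of ()) z"
      unfolding frag_extend_frag_extend by (rule frag_extend_eq) (auto simp: tr_def split: prod.splits)
    then show ?thesis
      by (simp add: f const_functor_def aug_def)
  qed
qed

text \<open>The generator of a free functor indexed by \<open>(x, \<sigma>)\<close> lives at the object \<open>x \<cdot> \<sigma>\<close>.\<close>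

definition corner :: "'x \<Rightarrow> 'e set \<Rightarrow> 'x" where
  "corner x \<sigma> = actm x (clique_elem \<sigma>)"

lemma corner_gens:
  assumes "x \<in> pts" "clique \<sigma>" "card \<sigma> = n"
  shows "(x, \<sigma>, clique_elem \<sigma>) \<in> gens n (corner x \<sigma>)" "corner x \<sigma> \<in> pts"
  using assms fronts_clique_elem clique_elem_closed actm_closed by (auto simp: gens_def corner_def)

definition cquot :: "'e set \<Rightarrow> 'e list set \<Rightarrow> 'e list set" where
  "cquot \<sigma> \<mu> = (THE \<nu>. \<nu> \<in> carrier M \<and> clique_elem \<sigma> \<odot> \<nu> = \<mu>)"

lemma cquot:
  assumes "(x, \<sigma>, \<mu>) \<in> gens n c"
  shows "clique \<sigma>" "cquot \<sigma> \<mu> \<in> carrier M" "clique_elem \<sigma> \<odot> cquot \<sigma> \<mu> = \<mu>"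
    "actm (corner x \<sigma>) (cquot \<sigma> \<mu>) = c" "(corner x \<sigma>, cquot \<sigma> \<mu>, c) \<in> mor kcat"
    "\<nu> \<in> carrier M \<Longrightarrow> cquot \<sigma> (\<mu> \<odot> \<nu>) = cquot \<sigma> \<mu> \<odot> \<nu>"
proof -
  note g = gensD[OF assms]
  show cl: "clique \<sigma>" by (rule clique_fronts[OF g(2,3)])
  from theI'[OF clique_elem_factor[OF this g(2,3)]]
  show q: "cquot \<sigma> \<mu> \<in> carrier M" "clique_elem \<sigma> \<odot> cquot \<sigma> \<mu> = \<mu>"
    by (simp_all add: cquot_def)
  show a: "actm (corner x \<sigma>) (cquot \<sigma> \<mu>) = c"
    using actm_mult[OF g(1) clique_elem_closed[OF cl] q(1)] q(2) g(5) by (simp add: corner_def)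
  show "(corner x \<sigma>, cquot \<sigma> \<mu>, c) \<in> mor kcat"
    using a q(1) corner_gens(2)[OF g(1) cl g(4)] by (simp add: mor_kcat)
  show "cquot \<sigma> (\<mu> \<odot> \<nu>) = cquot \<sigma> \<mu> \<odot> \<nu>" if \<nu>: "\<nu> \<in> carrier M"
    unfolding cquot_def[of \<sigma> "\<mu> \<odot> \<nu>"]
  proof (rule the1_equality)
    show "\<exists>!\<rho>. \<rho> \<in> carrier M \<and> clique_elem \<sigma> \<odot> \<rho> = \<mu> \<odot> \<nu>"
      using clique_elem_factor[OF cl mult_closed[OF g(2) \<nu>]] fronts_mult[OF g(2) \<nu>] g(3) by blast
    show "cquot \<sigma> \<mu> \<odot> \<nu> \<in> carrier M \<and> clique_elem \<sigma> \<odot> (cquot \<sigma> \<mu> \<odot> \<nu>) = \<mu> \<odot> \<nu>"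
      using mult_assoc[OF clique_elem_closed[OF cl] q(1) \<nu>] q \<nu> by (simp add: mult_closed)
  qed
qed

lemma kos_lift:
  assumes G: "ab_functor kcat G" and H: "ab_functor kcat H" and \<epsilon>: "epi_trans kcat G H \<epsilon>"
    and \<eta>: "nat_trans kcat (kos n) H \<eta>"
  shows "\<exists>\<theta>. nat_trans kcat (kos n) G \<theta> \<and>
    (\<forall>c\<in>obj kcat. \<forall>z\<in>carrier (fobj (kos n) c). \<epsilon> c (\<theta> c z) = \<eta> c z)"
proof -
  let ?F = "\<lambda>c. free_Abelian_group (gens n c)" and ?e = "\<lambda>x \<sigma>. frag_of (x, \<sigma>, clique_elem \<sigma>)"
  have \<epsilon>n: "nat_trans kcat G H \<epsilon>" using \<epsilon> by (simp add: epi_trans_def)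
  have "\<exists>g. g \<in> carrier (fobj G (corner x \<sigma>)) \<and> \<epsilon> (corner x \<sigma>) g = \<eta> (corner x \<sigma>) (?e x \<sigma>)"
    if "x \<in> pts" "clique \<sigma>" "card \<sigma> = n" for x \<sigma>
  proof -
    note cg = corner_gens[OF that]
    then have "\<eta> (corner x \<sigma>) (?e x \<sigma>) \<in> carrier (fobj H (corner x \<sigma>))"
      using nat_transD(2)[OF \<eta>] by simp
    moreover have "\<epsilon> (corner x \<sigma>) ` carrier (fobj G (corner x \<sigma>)) = carrier (fobj H (corner x \<sigma>))"
      using \<epsilon> cg(2) by (simp add: epi_trans_def)
    ultimately have "\<eta> (corner x \<sigma>) (?e x \<sigma>) \<in> \<epsilon> (corner x \<sigma>) ` carrier (fobj G (corner x \<sigma>))"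
      by simp
    then obtain y where "y \<in> carrier (fobj G (corner x \<sigma>))"
      "\<eta> (corner x \<sigma>) (?e x \<sigma>) = \<epsilon> (corner x \<sigma>) y" by (rule imageE)
    then show ?thesis by (intro exI[of _ y]) simp
  qed
  note ex = someI_ex[OF this]
  define g where "g x \<sigma> = (SOME g. g \<in> carrier (fobj G (corner x \<sigma>)) \<and>
    \<epsilon> (corner x \<sigma>) g = \<eta> (corner x \<sigma>) (?e x \<sigma>))" for x \<sigma>
  have g: "\<And>x \<sigma>. x \<in> pts \<Longrightarrow> clique \<sigma> \<Longrightarrow> card \<sigma> = n \<Longrightarrow> g x \<sigma> \<in> carrier (fobj G (corner x \<sigma>))"
    "\<And>x \<sigma>. x \<in> pts \<Longrightarrow> clique \<sigma> \<Longrightarrow> card \<sigma> = n \<Longrightarrow>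
      \<epsilon> (corner x \<sigma>) (g x \<sigma>) = \<eta> (corner x \<sigma>) (?e x \<sigma>)"
    unfolding g_def using ex by blast+
  define \<phi> where "\<phi> c = (\<lambda>(x, \<sigma>, \<mu>). fmor G (corner x \<sigma>, cquot \<sigma> \<mu>, c) (g x \<sigma>))" for c
  have gb: "g x \<sigma> \<in> carrier (fobj G (corner x \<sigma>))" "\<phi> c (x, \<sigma>, \<mu>) \<in> carrier (fobj G c)"
    if "(x, \<sigma>, \<mu>) \<in> gens n c" for x \<sigma> \<mu> c
  proof -
    show gc: "g x \<sigma> \<in> carrier (fobj G (corner x \<sigma>))"
      using g(1) gensD[OF that] cquot(1)[OF that] by blast
    then show "\<phi> c (x, \<sigma>, \<mu>) \<in> carrier (fobj G c)"
      using ab_functorD(4)[OF G cquot(5)[OF that]] by (simp add: \<phi>_def)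
  qed
  have "\<exists>h. h \<in> hom (?F c) (fobj G c) \<and> (\<forall>b\<in>gens n c. h (frag_of b) = \<phi> c b)"
    if "c \<in> pts" for c
  proof -
    interpret comm_group "fobj G c" using ab_functorD(1)[OF G] that by simp
    have "\<phi> c ` gens n c \<subseteq> carrier (fobj G c)" using gb by auto
    then show ?thesis
    proof (rule free_Abelian_group_universal)
      fix h assume "h \<in> hom (?F c) (fobj G c)"
        "\<And>b. b \<in> gens n c \<Longrightarrow> h (frag_of b) = \<phi> c b"
      then show ?thesis by (intro exI[of _ h]) simp
    qed
  qed
  note ex\<theta> = someI_ex[OF this]
  define \<theta> where "\<theta> c = (SOME h. h \<in> hom (?F c) (fobj G c) \<and> (\<forall>b\<in>gens n c. h (frag_of b) = \<phi> c b))" for c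
  have \<theta>0: "\<theta> c \<in> hom (?F c) (fobj G c) \<and> (\<forall>b\<in>gens n c. \<theta> c (frag_of b) = \<phi> c b)"
    if "c \<in> pts" for c
    unfolding \<theta>_def by (rule ex\<theta>[OF that])
  have \<theta>: "\<And>c. c \<in> pts \<Longrightarrow> \<theta> c \<in> hom (?F c) (fobj G c)"
    "\<And>c b. c \<in> pts \<Longrightarrow> b \<in> gens n c \<Longrightarrow> \<theta> c (frag_of b) = \<phi> c b"
    using \<theta>0 by simp_all
  have "nat_trans kcat (kos n) G \<theta>"
    unfolding nat_trans_def
  proof (intro conjI ballI)
    show "\<theta> c \<in> hom (fobj (kos n) c) (fobj G c)" if "c \<in> obj kcat" for c
      using \<theta>(1) that by simp
    fix f z assume f: "f \<in> mor kcat" and z: "z \<in> carrier (fobj (kos n) (src kcat f))"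
    from f show "\<theta> (tgt kcat f) (fmor (kos n) f z) = fmor G f (\<theta> (src kcat f) z)"
    proof (rule mor_kcatE)
      fix c \<nu> assume c: "f = (c, \<nu>, actm c \<nu>)" "c \<in> pts" "\<nu> \<in> carrier M" "actm c \<nu> \<in> pts"
      let ?c' = "actm c \<nu>"
      have fG: "fmor G f \<in> hom (fobj G c) (fobj G ?c')"
        using ab_functorD(3)[OF G f] by (simp add: c(1))
      have grp: "group (fobj G ?c')" using ab_functorD(2)[OF G] c(4) by simp
      have "\<theta> ?c' (frag_extend (tr \<nu>) z) = fmor G f (\<theta> c z)"
      proof (rule free_Abelian_group_hom_eqI[OF grp])
        show "(\<lambda>z. \<theta> ?c' (frag_extend (tr \<nu>) z)) \<in> hom (?F c) (fobj G ?c')"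
          using hom_compose[OF frag_extend_hom[OF keys_tr[OF _ c(3)]] \<theta>(1)[OF c(4)]] by (simp add: o_def)
        show "(\<lambda>z. fmor G f (\<theta> c z)) \<in> hom (?F c) (fobj G ?c')"
          using hom_compose[OF \<theta>(1)[OF c(2)] fG] by (simp add: o_def)
        show "supp z \<subseteq> gens n c" using z by (simp add: c(1))
        fix b assume b: "b \<in> gens n c"
        obtain x \<sigma> \<mu> where beq: "b = (x, \<sigma>, \<mu>)" by (cases b)
        note b = b[unfolded beq]
        have m: "cmps kcat (corner x \<sigma>, cquot \<sigma> \<mu>, c) f = (corner x \<sigma>, cquot \<sigma> \<mu> \<odot> \<nu>, ?c')"
          by (simp add: c(1))
        have "\<theta> ?c' (frag_extend (tr \<nu>) (frag_of b)) = fmor G (corner x \<sigma>, cquot \<sigma> \<mu> \<odot> \<nu>, ?c') (g x \<sigma>)"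
          using \<theta>(2)[OF c(4) gens_mult[OF b c(3)]] by (simp add: beq tr_def \<phi>_def cquot(6)[OF b c(3)])
        also have "\<dots> = fmor G f (fmor G (corner x \<sigma>, cquot \<sigma> \<mu>, c) (g x \<sigma>))"
          unfolding m[symmetric]
          by (rule ab_functor_cmps[OF G cquot(5)[OF b] f]) (use gb(1)[OF b] in \<open>simp_all add: c(1)\<close>)
        also have "\<dots> = fmor G f (\<theta> c (frag_of b))"
          using \<theta>(2)[OF c(2) b] by (simp add: beq \<phi>_def)
        finally show "\<theta> ?c' (frag_extend (tr \<nu>) (frag_of b)) = fmor G f (\<theta> c (frag_of b))" .
      qed
      then show ?thesis by (simp add: c(1))
    qed
  qed
  moreover have "\<epsilon> c (\<theta> c z) = \<eta> c z" if c: "c \<in> pts" and z: "supp z \<subseteq> gens n c" for c z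
  proof (rule free_Abelian_group_hom_eqI[OF _ _ _ _ z])
    show "group (fobj H c)" using ab_functorD(2)[OF H] c by simp
    show "(\<lambda>z. \<epsilon> c (\<theta> c z)) \<in> hom (?F c) (fobj H c)"
      using hom_compose[OF \<theta>(1)[OF c] nat_transD(1)[OF \<epsilon>n]] c by (simp add: o_def)
    show "\<eta> c \<in> hom (?F c) (fobj H c)"
      using nat_transD(1)[OF \<eta>, of c] c by simp
    fix b assume b: "b \<in> gens n c"
    obtain x \<sigma> \<mu> where beq: "b = (x, \<sigma>, \<mu>)" by (cases b)
    note b = b[unfolded beq]
    note g' = gensD[OF b] and q = cquot[OF b]
    have "\<epsilon> c (\<theta> c (frag_of b)) = \<epsilon> c (fmor G (corner x \<sigma>, cquot \<sigma> \<mu>, c) (g x \<sigma>))"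
      using \<theta>(2)[OF c b] by (simp add: beq \<phi>_def)
    also have "\<dots> = fmor H (corner x \<sigma>, cquot \<sigma> \<mu>, c) (\<epsilon> (corner x \<sigma>) (g x \<sigma>))"
      using nat_transD(3)[OF \<epsilon>n q(5)] gb(1)[OF b] by simp
    also have "\<dots> = fmor H (corner x \<sigma>, cquot \<sigma> \<mu>, c) (\<eta> (corner x \<sigma>) (?e x \<sigma>))"
      using g(2)[OF g'(1) q(1) g'(4)] by simp
    also have "\<dots> = \<eta> c (fmor (kos n) (corner x \<sigma>, cquot \<sigma> \<mu>, c) (?e x \<sigma>))"
      using nat_transD(3)[OF \<eta> q(5), of "frag_of (x, \<sigma>, clique_elem \<sigma>)"] corner_gens(1)[OF g'(1) q(1) g'(4)] by simp
    also have "\<dots> = \<eta> c (frag_of b)"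
      using q(3) by (simp add: tr_def beq)
    finally show "\<epsilon> c (\<theta> c (frag_of b)) = \<eta> c (frag_of b)" .
  qed
  ultimately show ?thesis
    by auto
qed

text \<open>The keys of the universe are lists of pairs of a morphism and an integer, so the clique \<open>\<sigma>\<close> is
  recorded as the set of its one-letter words, which has the type of a monoid element.\<close>

definition code :: "'x \<times> 'e set \<times> 'e list set \<Rightarrow> (('x \<times> 'e list set \<times> 'x) \<times> int) list" where
  "code = (\<lambda>(x, \<sigma>, \<mu>). [((x, \<mu>, x), 0), ((x, (\<lambda>e. [e]) ` \<sigma>, x), 0)])"

lemma inj_code: "inj code"
proof (rule injI)
  fix a b :: "'x \<times> 'e set \<times> 'e list set"
  assume "code a = code b"
  moreover have "inj (\<lambda>e::'e. [e])" by (rule injI) simp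
  ultimately show "a = b"
    by (cases a; cases b) (simp add: code_def inj_image_eq_iff)
qed

definition emb :: "(('x \<times> 'e set \<times> 'e list set) \<Rightarrow>\<^sub>0 int) \<Rightarrow> ('x \<times> 'e list set \<times> 'x, int) universe" where
  "emb z = (\<lambda>k. if k \<in> range code then poly_mapping.lookup z (the_inv code k) else 0)"

lemma inj_emb: "inj emb"
proof (rule injI)
  fix y z assume eq: "emb y = emb z"
  have "poly_mapping.lookup y b = poly_mapping.lookup z b" for b
    using fun_cong[OF eq, of "code b"] by (simp add: emb_def the_inv_f_f[OF inj_code])
  then show "y = z" by (rule poly_mapping_eqI)
qed

definition res :: "nat \<Rightarrow> ('x, 'x \<times> 'e list set \<times> 'x, ('x \<times> 'e list set \<times> 'x, int) universe) ab_fun" where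
  "res n = copy_functor emb (kos n)"

definition res_d :: "'x \<Rightarrow> ('x \<times> 'e list set \<times> 'x, int) universe \<Rightarrow> ('x \<times> 'e list set \<times> 'x, int) universe" where
  "res_d c y = emb (frag_extend bd (the_inv emb y))"

definition res_aug :: "'x \<Rightarrow> ('x \<times> 'e list set \<times> 'x, int) universe \<Rightarrow> int" where
  "res_aug c y = aug (the_inv emb y)"

lemma carrier_res: "carrier (fobj (res n) c) = emb ` {z. supp z \<subseteq> gens n c}"
  by (auto simp: res_def copy_group_simps[OF inj_emb])

lemma res_emb [simp]: "res_d c (emb z) = emb (frag_extend bd z)" "res_aug c (emb z) = aug z"
  by (simp_all add: res_d_def res_aug_def the_inv_f_f[OF inj_emb])

lemma one_res: "\<one>\<^bsub>fobj (res n) c\<^esub> = emb 0"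
  by (simp add: res_def copy_group_simps[OF inj_emb])

lemma projective_resolution_res:
  "projective_resolution kcat (const_functor integer_group) res (\<lambda>n. res_d) res_aug"
  unfolding projective_resolution_def
proof (intro conjI allI ballI)
  show "projective_functor kcat (res n)" for n
    unfolding res_def
    by (rule projective_functor_copy[OF src_tgt_closed_kcat inj_emb ab_functor_kos kos_lift])
  show "nat_trans kcat (res (Suc n)) (res n) res_d" for n
    unfolding res_def res_d_def[abs_def]
    by (rule nat_trans_comp[OF src_tgt_closed_kcat _ nat_trans_copy(1)[OF inj_emb]])
      (rule nat_trans_comp[OF src_tgt_closed_kcat nat_trans_copy(2)[OF inj_emb] nat_trans_bd])
  show "epi_trans kcat (res 0) (const_functor integer_group) res_aug"
    unfolding epi_trans_def
  proof (intro conjI ballI)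
    show "nat_trans kcat (res 0) (const_functor integer_group) res_aug"
      unfolding res_def res_aug_def[abs_def]
      by (rule nat_trans_comp[OF src_tgt_closed_kcat nat_trans_copy(2)[OF inj_emb] nat_trans_aug])
    fix c assume "c \<in> obj kcat"
    then have "(c, {}, \<one>\<^bsub>M\<^esub>) \<in> gens 0 c"
      by (simp add: gens_def one_closed actm_one)
    then have "emb (frag_cmul i (frag_of (c, {}, \<one>\<^bsub>M\<^esub>))) \<in> carrier (fobj (res 0) c)" for i
      using keys_cmul[of i "frag_of (c, {}, \<one>\<^bsub>M\<^esub>)"] by (auto simp: carrier_res)
    moreover have "res_aug c (emb (frag_cmul i (frag_of (c, {}, \<one>\<^bsub>M\<^esub>)))) = i" for i
      by (simp add: aug_def frag_extend_cmul)
    ultimately have "i \<in> res_aug c ` carrier (fobj (res 0) c)" for i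
      by (metis imageI)
    then show "res_aug c ` carrier (fobj (res 0) c) = carrier (fobj (const_functor integer_group) c)"
      by (auto simp: const_functor_def)
  qed
  show "res_d c ` carrier (fobj (res 1) c) =
      kernel (fobj (res 0) c) (fobj (const_functor integer_group) c) (res_aug c)" for c
  proof (intro equalityI subsetI)
    fix y assume "y \<in> res_d c ` carrier (fobj (res 1) c)"
    then obtain z where z: "supp z \<subseteq> gens (Suc 0) c" "y = emb (frag_extend bd z)"
      by (auto simp: carrier_res)
    then show "y \<in> kernel (fobj (res 0) c) (fobj (const_functor integer_group) c) (res_aug c)"
      using aug_bd[OF z(1)] keys_frag_extend_subset[OF z(1) keys_bd]
      by (auto simp: kernel_def carrier_res const_functor_def integer_group_def)
  next
    fix y assume "y \<in> kernel (fobj (res 0) c) (fobj (const_functor integer_group) c) (res_aug c)"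
    then obtain z where z: "supp z \<subseteq> gens 0 c" "aug z = 0" "y = emb z"
      by (auto simp: kernel_def carrier_res const_functor_def integer_group_def)
    with aug_exact[OF z(1,2)] show "y \<in> res_d c ` carrier (fobj (res 1) c)"
      by (auto simp: carrier_res image_iff)
  qed
  show "res_d c ` carrier (fobj (res (Suc (Suc n))) c) = kernel (fobj (res (Suc n)) c) (fobj (res n) c) (res_d c)" for n c
  proof (intro equalityI subsetI)
    fix y assume "y \<in> res_d c ` carrier (fobj (res (Suc (Suc n))) c)"
    then obtain z where z: "supp z \<subseteq> gens (Suc (Suc n)) c" "y = emb (frag_extend bd z)"
      by (auto simp: carrier_res)
    have "frag_extend bd (frag_extend bd z) = 0"
      unfolding frag_extend_frag_extend by (rule frag_extend_eq_0) (use z(1) bd_bd in blast)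
    then show "y \<in> kernel (fobj (res (Suc n)) c) (fobj (res n) c) (res_d c)"
      using z keys_frag_extend_subset[OF z(1) keys_bd] by (auto simp: kernel_def carrier_res one_res)
  next
    fix y assume "y \<in> kernel (fobj (res (Suc n)) c) (fobj (res n) c) (res_d c)"
    then obtain z where z: "supp z \<subseteq> gens (Suc n) c" "frag_extend bd z = 0" "y = emb z"
      by (auto simp: kernel_def carrier_res one_res inj_eq[OF inj_emb])
    with bd_exact[OF z(1,2)] show "y \<in> res_d c ` carrier (fobj (res (Suc (Suc n))) c)"
      by (auto simp: carrier_res image_iff)
  qed
qed

section \<open>The complex of cells\<close>

definition cells :: "nat \<Rightarrow> ('x \<times> 'e set) set" where
  "cells n = {(x, \<sigma>). x \<in> pts \<and> clique \<sigma> \<and> card \<sigma> = n}"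

definition kbd :: "'x \<times> 'e set \<Rightarrow> ('x \<times> 'e set) \<Rightarrow>\<^sub>0 int" where
  "kbd = (\<lambda>(x, \<sigma>). \<Sum>e\<in>\<sigma>. frag_cmul (sg \<sigma> e) (frag_of (x, \<sigma> - {e}) - frag_of (st x e, \<sigma> - {e})))"

definition proj :: "'x \<times> 'e set \<times> 'e list set \<Rightarrow> ('x \<times> 'e set) \<Rightarrow>\<^sub>0 int" where
  "proj = (\<lambda>(x, \<sigma>, \<mu>). frag_of (x, \<sigma>))"

lemma keys_kbd:
  assumes "b \<in> cells (Suc n)"
  shows "supp (kbd b) \<subseteq> cells n"
proof -
  obtain x \<sigma> where b: "b = (x, \<sigma>)" by (cases b)
  have x: "x \<in> pts" "clique \<sigma>" "card \<sigma> = Suc n" using assms by (auto simp: b cells_def)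
  have "(x, \<sigma> - {e}) \<in> cells n" "(st x e, \<sigma> - {e}) \<in> cells n" if "e \<in> \<sigma>" for e
    using x that st_closed[of x e] clique_subset[OF x(2), of "\<sigma> - {e}"] by (auto simp: cells_def clique_def)
  then have "supp (frag_cmul (sg \<sigma> e) (frag_of (x, \<sigma> - {e}) - frag_of (st x e, \<sigma> - {e}))) \<subseteq> cells n"
    if "e \<in> \<sigma>" for e
    using that keys_cmul[of "sg \<sigma> e" "frag_of (x, \<sigma> - {e}) - frag_of (st x e, \<sigma> - {e})"]
      keys_diff[of "frag_of (x, \<sigma> - {e})" "frag_of (st x e, \<sigma> - {e})"] by auto
  then show ?thesis
    unfolding b kbd_def prod.case by (rule keys_sum_subset)
qed

lemma keys_proj: "b \<in> gens n c \<Longrightarrow> supp (proj b) \<subseteq> cells n"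
  using clique_fronts by (cases b) (auto simp: proj_def cells_def gens_def)

lemma proj_bd:
  assumes "supp z \<subseteq> gens n c"
  shows "frag_extend proj (frag_extend bd z) = frag_extend kbd (frag_extend proj z)"
  unfolding frag_extend_frag_extend
proof (rule frag_extend_eq)
  fix b assume "b \<in> supp z"
  moreover obtain x \<sigma> \<mu> where b: "b = (x, \<sigma>, \<mu>)" by (cases b)
  ultimately have fin: "finite \<sigma>"
    using assms gensD(6) by blast
  show "frag_extend proj (bd b) = frag_extend kbd (proj b)"
    by (simp add: b bd_eq proj_def kbd_def frag_extend_sum[OF fin] o_def frag_extend_cmul frag_extend_diff)
qed

definition kos_group :: "nat \<Rightarrow> (('x \<times> 'e set) \<Rightarrow>\<^sub>0 int) monoid" where
  "kos_group n = free_Abelian_group (cells n)"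

lemma cell_corner:
  assumes "(x, \<sigma>) \<in> cells n"
  shows "(x, \<sigma>, clique_elem \<sigma>) \<in> gens n (corner x \<sigma>)" "corner x \<sigma> \<in> pts"
  using corner_gens assms by (auto simp: cells_def)

lemma kbd_kbd:
  assumes "supp z \<subseteq> cells n"
  shows "frag_extend kbd (frag_extend kbd z) = 0"
  unfolding frag_extend_frag_extend
proof (rule frag_extend_eq_0)
  fix b assume "b \<in> supp z"
  moreover obtain x \<sigma> where b: "b = (x, \<sigma>)" by (cases b)
  ultimately have "(x, \<sigma>) \<in> cells n" using assms by blast
  note g = cell_corner(1)[OF this]
  have "clique \<sigma>" using \<open>(x, \<sigma>) \<in> cells n\<close> by (simp add: cells_def)
  have 1: "kbd b = frag_extend proj (bd (x, \<sigma>, clique_elem \<sigma>))"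
    using proj_bd[of "frag_of (x, \<sigma>, clique_elem \<sigma>)"] g by (simp add: proj_def b)
  have "frag_extend kbd (kbd b) = frag_extend proj (frag_extend bd (bd (x, \<sigma>, clique_elem \<sigma>)))"
  proof (cases n)
    case 0
    then have "\<sigma> = {}" using gensD(4,6)[OF g] by simp
    then show ?thesis by (simp add: b kbd_def bd_eq)
  next
    case (Suc i)
    show ?thesis
      unfolding 1 using proj_bd[OF keys_bd[OF g[unfolded Suc]]] by simp
  qed
  then show "frag_extend kbd (kbd b) = 0"
    by (simp add: bd_bd[OF g])
qed

lemma chain_complex_kos_group: "chain_complex kos_group (\<lambda>n. frag_extend kbd)"
  unfolding chain_complex_def kos_group_def
  using kbd_kbd frag_extend_hom[OF keys_kbd] by (auto simp: abelian_free_Abelian_group)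

lemma emb_hom: "emb \<in> hom (free_Abelian_group (gens n c)) (fobj (res n) c)"
  using copy_group_hom(1)[OF inj_emb, of "free_Abelian_group (gens n c)"] by (simp add: res_def)

lemma colimit_res: "colimit kcat (res n)"
  using src_tgt_closed_kcat ab_functor_copy[OF inj_emb ab_functor_kos]
  by unfold_locales (simp_all add: res_def)

lemma colim_res_iso:
  "\<exists>f. f \<in> iso (colim kcat (res n)) (kos_group n) \<and>
    (\<forall>c\<in>pts. \<forall>z. supp z \<subseteq> gens n c \<longrightarrow> f (colim_inj kcat (res n) c (emb z)) = frag_extend proj z)"
proof -
  let ?R = "colim kcat (res n)" and ?inj = "colim_inj kcat (res n)" and ?K = "kos_group n"
  interpret R: colimit kcat "res n" by (rule colimit_res)
  have K: "comm_group ?K" by (simp add: kos_group_def abelian_free_Abelian_group)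
  have gK: "group ?K" using K by (simp add: comm_group_def)
  have "\<exists>h. h \<in> hom ?R ?K \<and>
      (\<forall>c\<in>obj kcat. \<forall>y\<in>carrier (fobj (res n) c). h (?inj c y) = frag_extend proj (the_inv emb y))"
  proof (rule R.colim_universal[OF K])
    show "(\<lambda>y. frag_extend proj (the_inv emb y)) \<in> hom (fobj (res n) c) ?K" if "c \<in> obj kcat" for c
      using hom_compose[OF copy_group_hom(2)[OF inj_emb, of "free_Abelian_group (gens n c)"]
        frag_extend_hom[OF keys_proj]] by (simp add: o_def res_def kos_group_def)
    fix f y assume f: "f \<in> mor kcat" and y: "y \<in> carrier (fobj (res n) (src kcat f))"
    from f show "frag_extend proj (the_inv emb (fmor (res n) f y)) = frag_extend proj (the_inv emb y)"
    proof (rule mor_kcatE)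
      fix x \<nu> assume f: "f = (x, \<nu>, actm x \<nu>)"
      obtain z where z: "y = emb z" "supp z \<subseteq> gens n x"
        using y by (auto simp: f carrier_res)
      have "frag_extend proj (frag_extend (tr \<nu>) z) = frag_extend proj z"
        unfolding frag_extend_frag_extend
        by (rule frag_extend_eq) (auto simp: tr_def proj_def split: prod.splits)
      then show ?thesis
        by (simp add: f z res_def the_inv_f_f[OF inj_emb])
    qed
  qed
  then obtain h where h: "h \<in> hom ?R ?K"
    "\<And>c y. c \<in> pts \<Longrightarrow> y \<in> carrier (fobj (res n) c) \<Longrightarrow>
      h (?inj c y) = frag_extend proj (the_inv emb y)"
    by auto
  then have h_emb: "h (?inj c (emb z)) = frag_extend proj z"
    if "c \<in> pts" "supp z \<subseteq> gens n c" for c z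
    using that by (simp add: carrier_res the_inv_f_f[OF inj_emb])
  let ?\<gamma> = "\<lambda>(x, \<sigma>). ?inj (corner x \<sigma>) (emb (frag_of (x, \<sigma>, clique_elem \<sigma>)))"
  have corner_car: "emb (frag_of (x, \<sigma>, clique_elem \<sigma>)) \<in> carrier (fobj (res n) (corner x \<sigma>))"
    if "(x, \<sigma>) \<in> cells n" for x \<sigma>
    using cell_corner[OF that] by (simp add: carrier_res)
  have "?\<gamma> ` cells n \<subseteq> carrier ?R"
    using R.colim_inj_closed corner_car cell_corner(2) by auto
  then obtain g where g: "g \<in> hom ?K ?R"
    "\<forall>b\<in>cells n. g (frag_of b) = ?\<gamma> b"
  proof (rule R.Q.free_Abelian_group_universal)
    fix g assume "g \<in> hom (free_Abelian_group (cells n)) ?R"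
      "\<And>b. b \<in> cells n \<Longrightarrow> g (frag_of b) = ?\<gamma> b"
      and *: "\<And>g. g \<in> hom ?K ?R \<Longrightarrow> \<forall>b\<in>cells n. g (frag_of b) = ?\<gamma> b \<Longrightarrow> thesis"
    then show thesis by (intro *[of g]) (auto simp: kos_group_def)
  qed
  have gh: "g (h y) = y" if y: "y \<in> carrier ?R" for y
  proof (rule R.colim_hom_eqI[OF R.Q.is_group _ _ _ y])
    show "(\<lambda>y. g (h y)) \<in> hom ?R ?R"
      using hom_compose[OF h(1) g(1)] by (simp add: o_def)
    show "(\<lambda>y. y) \<in> hom ?R ?R"
      by (auto simp: hom_def)
    fix c y assume c: "c \<in> obj kcat" and y: "y \<in> carrier (fobj (res n) c)"
    then have cp: "c \<in> pts" by simp
    obtain z where z: "y = emb z" "supp z \<subseteq> gens n c"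
      using y by (auto simp: carrier_res)
    have "g (frag_extend proj z) = ?inj c (emb z)"
    proof (rule free_Abelian_group_hom_eqI[OF R.Q.is_group _ _ _ z(2)])
      show "(\<lambda>z. g (frag_extend proj z)) \<in> hom (free_Abelian_group (gens n c)) ?R"
        using hom_compose[OF frag_extend_hom[OF keys_proj] g(1)[unfolded kos_group_def]] by (simp add: o_def)
      show "(\<lambda>z. ?inj c (emb z)) \<in> hom (free_Abelian_group (gens n c)) ?R"
        using hom_compose[OF emb_hom R.colim_inj_hom[OF c]] by (simp add: o_def)
      fix b assume b: "b \<in> gens n c"
      obtain x \<sigma> \<mu> where beq: "b = (x, \<sigma>, \<mu>)" by (cases b)
      note b = b[unfolded beq]
      note q = cquot[OF b]
      have cell: "(x, \<sigma>) \<in> cells n"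
        using gensD[OF b] q(1) by (simp add: cells_def)
      have "g (frag_extend proj (frag_of b)) = ?inj (corner x \<sigma>) (emb (frag_of (x, \<sigma>, clique_elem \<sigma>)))"
        using g(2) cell by (simp add: beq proj_def)
      also have "\<dots> = ?inj c (fmor (res n) (corner x \<sigma>, cquot \<sigma> \<mu>, c) (emb (frag_of (x, \<sigma>, clique_elem \<sigma>))))"
        using R.colim_inj_fmor[OF q(5)] corner_car[OF cell] by simp
      also have "fmor (res n) (corner x \<sigma>, cquot \<sigma> \<mu>, c) (emb (frag_of (x, \<sigma>, clique_elem \<sigma>))) = emb (frag_of b)"
        using q(3) by (simp add: res_def the_inv_f_f[OF inj_emb] tr_def beq)
      finally show "g (frag_extend proj (frag_of b)) = ?inj c (emb (frag_of b))" .
    qed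
    then show "g (h (?inj c y)) = ?inj c y"
      using h_emb[OF cp z(2)] by (simp add: z(1))
  qed
  have hg: "h (g y) = y" if y: "y \<in> carrier ?K" for y
  proof (rule free_Abelian_group_hom_eqI[OF gK])
    show "(\<lambda>y. h (g y)) \<in> hom (free_Abelian_group (cells n)) ?K"
      using hom_compose[OF g(1) h(1)] by (simp add: o_def kos_group_def)
    show "(\<lambda>y. y) \<in> hom (free_Abelian_group (cells n)) ?K"
      by (auto simp: hom_def kos_group_def)
    show "supp y \<subseteq> cells n" using y by (simp add: kos_group_def)
    fix b assume b: "b \<in> cells n"
    obtain x \<sigma> where beq: "b = (x, \<sigma>)" by (cases b)
    show "h (g (frag_of b)) = frag_of b"
      using g(2) b h_emb cell_corner[of x \<sigma> n] by (simp add: beq proj_def)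
  qed
  have "bij_betw h (carrier ?R) (carrier ?K)"
    by (rule bij_betw_byWitness[of _ g])
      (use gh hg hom_in_carrier[OF h(1)] hom_in_carrier[OF g(1)] in auto)
  then show ?thesis
    using h(1) h_emb by (intro exI[of _ h]) (auto simp: iso_def)
qed

lemma colim_res_homology:
  "chain_homology (\<lambda>n. colim kcat (res n)) (\<lambda>n. colim_map kcat (res n) res_d) k \<cong>
    chain_homology kos_group (\<lambda>n. frag_extend kbd) k"
proof -
  note P = projective_resolution_res and cc = src_tgt_closed_kcat
  note p = projective_resolutionD[OF P]
  obtain f where f: "\<And>n. f n \<in> iso (colim kcat (res n)) (kos_group n)"
    "\<And>n c z. c \<in> pts \<Longrightarrow> supp z \<subseteq> gens n c \<Longrightarrow> f n (colim_inj kcat (res n) c (emb z)) = frag_extend proj z"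
    using colim_res_iso by metis
  note D = colim_map[OF cc p(2) p(2) p(3)]
  show ?thesis
  proof (rule chain_homology_iso_of_bij[OF chain_complex_colim[OF cc P] chain_complex_kos_group f(1)])
    fix n y assume y: "y \<in> carrier (colim kcat (res (Suc n)))"
    interpret R: colimit kcat "res (Suc n)" by (rule colimit_res)
    have fh: "f n \<in> hom (colim kcat (res n)) (kos_group n)" for n
      using f(1) by (simp add: iso_def)
    have gK: "group (kos_group n)" by (simp add: kos_group_def)
    show "f n (colim_map kcat (res n) res_d y) = frag_extend kbd (f (Suc n) y)"
    proof (rule R.colim_hom_eqI[OF gK _ _ _ y])
      show "(\<lambda>y. f n (colim_map kcat (res n) res_d y)) \<in> hom (colim kcat (res (Suc n))) (kos_group n)"
        using hom_compose[OF D(1) fh] by (simp add: o_def)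
      show "(\<lambda>y. frag_extend kbd (f (Suc n) y)) \<in> hom (colim kcat (res (Suc n))) (kos_group n)"
        using hom_compose[OF fh[of "Suc n", unfolded kos_group_def] frag_extend_hom[OF keys_kbd]]
        by (simp add: o_def kos_group_def)
      fix c y assume c: "c \<in> obj kcat" "y \<in> carrier (fobj (res (Suc n)) c)"
      then obtain z where z: "y = emb z" "supp z \<subseteq> gens (Suc n) c"
        by (auto simp: carrier_res)
      have "supp (frag_extend bd z) \<subseteq> gens n c"
        by (rule keys_frag_extend_subset[OF z(2) keys_bd])
      then show "f n (colim_map kcat (res n) res_d (colim_inj kcat (res (Suc n)) c y)) =
          frag_extend kbd (f (Suc n) (colim_inj kcat (res (Suc n)) c y))"
        using c f(2) proj_bd[OF z(2)] by (simp add: D(2) z)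
    qed
  qed
qed

theorem fpc_homology_iso:
  assumes k: "k \<ge> 1"
  shows "fpc_homology E I k kset \<cong> chain_homology kos_group (\<lambda>n. frag_extend kbd) k"
    and "comm_group (fpc_homology E I k kset)"
proof -
  let ?F = "const_functor integer_group :: ('x, 'x \<times> 'e list set \<times> 'x, int) ab_fun"
  let ?R = "\<lambda>(P :: nat \<Rightarrow> ('x, 'x \<times> 'e list set \<times> 'x, ('x \<times> 'e list set \<times> 'x, int) universe) ab_fun, d, \<epsilon>).
    projective_resolution kcat ?F P d \<epsilon>"
  have "\<exists>p. ?R p"
    by (rule exI[of _ "(res, \<lambda>n. res_d, res_aug)"]) (simp add: projective_resolution_res)
  from someI_ex[OF this] obtain P d \<epsilon> where some: "(SOME p. ?R p) = (P, d, \<epsilon>)"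
    and P: "projective_resolution kcat ?F P d \<epsilon>"
    by (metis (no_types, lifting) case_prodE)
  have hom: "fpc_homology E I k kset = chain_homology (\<lambda>n. colim kcat (P n)) (\<lambda>n. colim_map kcat (P n) (d n)) k"
    unfolding fpc_homology_def left_derived_colim_def some by simp
  have F: "ab_functor kcat ?F"
    by (auto simp: ab_functor_def const_functor_def abelian_integer_group hom_def)
  have j: "inj (\<lambda>i. (\<lambda>_. i) :: ('x \<times> 'e list set \<times> 'x, int) universe)"
    by (rule injI) (metis)
  show "comm_group (fpc_homology E I k kset)"
    unfolding hom by (rule comm_group_chain_homology[OF chain_complex_colim[OF src_tgt_closed_kcat P]])
  have "fpc_homology E I k kset \<cong> chain_homology (\<lambda>n. colim kcat (res n)) (\<lambda>n. colim_map kcat (res n) res_d) k"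
    unfolding hom by (rule resolution_homology_unique[OF src_tgt_closed_kcat F j P projective_resolution_res k])
  also note colim_res_homology
  finally show "fpc_homology E I k kset \<cong> chain_homology kos_group (\<lambda>n. frag_extend kbd) k" .
qed

end

section \<open>Homology of the chain sets\<close>

definition next_pt :: "nat \<Rightarrow> pt \<Rightarrow> pt" where
  "next_pt N x = (case x of Base \<Rightarrow> Base | Pt i \<Rightarrow> if Suc i < N then Pt (Suc i) else Base)"

lemma chain_step_eq: "chain_step (int N - 1) x e = next_pt N x"
  by (cases x) (auto simp: chain_step_def next_pt_def)

locale fpc_chain = fpc E I for E :: "'e set" and I +
  fixes lt :: "'e \<Rightarrow> 'e \<Rightarrow> bool" and N :: nat
  assumes lt: "\<not> lt a a" "lt a b \<Longrightarrow> lt b c \<Longrightarrow> lt a c" "a \<noteq> b \<Longrightarrow> lt a b \<or> lt b a"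
begin

sublocale fpc_act E I lt "insert Base (Pt ` {..<N})" "chain_step (int N - 1)"
proof unfold_locales
  show "\<not> lt a a" for a by (rule lt(1))
  show "lt a c" if "lt a b" "lt b c" for a b c by (rule lt(2)[OF that])
  show "lt a b \<or> lt b a" if "a \<noteq> b" for a b by (rule lt(3)[OF that])
qed (auto simp: chain_step_eq next_pt_def split: pt.splits)

lemma kset_eq: "kset = chain_set (int N - 1)"
proof -
  have pts: "insert Base (Pt ` {..<N}) = insert Base {Pt i |i. int i \<le> int N - 1}"
    by auto
  show ?thesis
    unfolding kset_def chain_set_def actm_def[abs_def] unfolding pts ..
qed

definition cliques :: "nat \<Rightarrow> 'e set set" where
  "cliques n = {\<sigma>. clique \<sigma> \<and> card \<sigma> = n}"

definition cbd :: "'e set \<Rightarrow> 'e set \<Rightarrow>\<^sub>0 int" where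
  "cbd \<sigma> = (\<Sum>e\<in>\<sigma>. frag_cmul (sg \<sigma> e) (frag_of (\<sigma> - {e})))"

definition comp :: "pt \<Rightarrow> ((pt \<times> 'e set) \<Rightarrow>\<^sub>0 int) \<Rightarrow> ('e set \<Rightarrow>\<^sub>0 int)" where
  "comp y = frag_extend (\<lambda>(x, \<sigma>). if x = y then frag_of \<sigma> else 0)"

definition tot :: "((pt \<times> 'e set) \<Rightarrow>\<^sub>0 int) \<Rightarrow> ('e set \<Rightarrow>\<^sub>0 int)" where
  "tot = frag_extend (\<lambda>(x, \<sigma>). frag_of \<sigma>)"

definition ins :: "pt \<Rightarrow> ('e set \<Rightarrow>\<^sub>0 int) \<Rightarrow> ((pt \<times> 'e set) \<Rightarrow>\<^sub>0 int)" where
  "ins x = frag_extend (\<lambda>\<sigma>. frag_of (x, \<sigma>))"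

lemma comp_linear:
  "comp y (frag_of (x, \<sigma>)) = (if x = y then frag_of \<sigma> else 0)"
  "comp y 0 = 0" "comp y (a + b) = comp y a + comp y b" "comp y (a - b) = comp y a - comp y b"
  "comp y (frag_cmul n a) = frag_cmul n (comp y a)"
  by (simp_all add: comp_def frag_extend_add frag_extend_diff frag_extend_cmul)

lemma tot_linear:
  "tot (frag_of (x, \<sigma>)) = frag_of \<sigma>"
  "tot 0 = 0" "tot (a + b) = tot a + tot b" "tot (a - b) = tot a - tot b"
  "tot (frag_cmul n a) = frag_cmul n (tot a)"
  by (simp_all add: tot_def frag_extend_add frag_extend_diff frag_extend_cmul)

lemma comp_sum: "finite A \<Longrightarrow> comp y (sum f A) = (\<Sum>a\<in>A. comp y (f a))"
  by (induction A rule: finite_induct) (simp_all add: comp_linear)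

lemma tot_sum: "finite A \<Longrightarrow> tot (sum f A) = (\<Sum>a\<in>A. tot (f a))"
  by (induction A rule: finite_induct) (simp_all add: tot_linear)

lemma comp_ins: "comp y (ins x c) = (if x = y then c else 0)"
proof -
  have "comp y (ins x c) = frag_extend (\<lambda>\<sigma>. if x = y then frag_of \<sigma> else 0) c"
    unfolding comp_def ins_def frag_extend_frag_extend by simp
  also have "\<dots> = (if x = y then c else 0)"
    by (cases "x = y") (simp_all add: frag_expansion[symmetric] frag_extend_eq_0)
  finally show ?thesis .
qed

lemma tot_ins: "tot (ins x c) = c"
  unfolding tot_def ins_def frag_extend_frag_extend using frag_expansion[of c] by simp

lemma comp_kbd:
  "comp y (kbd (x, \<sigma>)) = (if x = y then cbd \<sigma> else 0) - (if next_pt N x = y then cbd \<sigma> else 0)"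
  "tot (kbd (x, \<sigma>)) = 0"
proof -
  show "comp y (kbd (x, \<sigma>)) = (if x = y then cbd \<sigma> else 0) - (if next_pt N x = y then cbd \<sigma> else 0)"
  proof (cases "finite \<sigma>")
    case True
    then show ?thesis
      by (simp add: kbd_def comp_sum comp_linear chain_step_eq cbd_def sum_subtractf frag_cmul_diff_distrib2)
  qed (simp add: kbd_def cbd_def comp_linear)
  show "tot (kbd (x, \<sigma>)) = 0"
  proof (cases "finite \<sigma>")
    case True
    then show ?thesis by (simp add: kbd_def tot_sum tot_linear)
  qed (simp add: kbd_def tot_linear)
qed

lemma comp_boundary_0: "comp (Pt 0) (frag_extend kbd z) = frag_extend cbd (comp (Pt 0) z)"
  unfolding comp_def frag_extend_frag_extend
  by (rule frag_extend_eq)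
    (auto simp: comp_kbd[unfolded comp_def] next_pt_def split: pt.splits)

lemma comp_boundary_Suc:
  assumes "Suc i < N"
  shows "comp (Pt (Suc i)) (frag_extend kbd z) =
    frag_extend cbd (comp (Pt (Suc i)) z) - frag_extend cbd (comp (Pt i) z)"
  unfolding comp_def frag_extend_frag_extend frag_extend_fun_diff[symmetric]
  by (rule frag_extend_eq)
    (use assms in \<open>auto simp: comp_kbd[unfolded comp_def] next_pt_def split: pt.splits\<close>)

lemma tot_boundary: "tot (frag_extend kbd z) = 0"
  unfolding tot_def frag_extend_frag_extend
  by (rule frag_extend_eq_0) (auto simp: comp_kbd[unfolded tot_def])

lemma lookup_comp: "poly_mapping.lookup (comp x z) \<sigma> = poly_mapping.lookup z (x, \<sigma>)"
  using subset_UNIV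
proof (induction z rule: frag_induction)
  case (one b)
  then show ?case by (cases b) (auto simp: comp_linear)
qed (simp_all add: comp_linear lookup_minus)

lemma tot_eq:
  assumes "supp z \<subseteq> cells n"
  shows "tot z = comp Base z + (\<Sum>i<N. comp (Pt i) z)"
  using assms
proof (induction z rule: frag_induction)
  case (one b)
  then obtain x \<sigma> where b: "b = (x, \<sigma>)" "x = Base \<or> (\<exists>i<N. x = Pt i)"
    by (cases b) (auto simp: cells_def)
  then show ?case by (auto simp: tot_linear comp_linear)
qed (simp_all add: comp_linear tot_linear sum_subtractf)

lemma cells_eq_0:
  assumes z: "supp z \<subseteq> cells n" and "tot z = 0" "\<And>i. i < N \<Longrightarrow> comp (Pt i) z = 0"
  shows "z = 0"
proof (rule poly_mapping_eqI)
  fix b :: "pt \<times> 'e set"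
  obtain x \<sigma> where b: "b = (x, \<sigma>)" by (cases b)
  have "comp Base z = 0"
    using tot_eq[OF z] assms(2,3) by simp
  then have "comp x z = 0" if "x \<in> insert Base (Pt ` {..<N})"
    using that assms(3) by auto
  then show "poly_mapping.lookup z b = poly_mapping.lookup 0 b"
    using z lookup_comp[of x z \<sigma>] by (cases "b \<in> cells n") (auto simp: b cells_def in_keys_iff)
qed

definition assemble :: "(nat \<Rightarrow> ('e set \<Rightarrow>\<^sub>0 int)) \<Rightarrow> ((pt \<times> 'e set) \<Rightarrow>\<^sub>0 int)" where
  "assemble c = (\<Sum>i<N. ins (Pt i) (c i)) - ins Base (\<Sum>i<N. c i)"

lemma comp_assemble: "i < N \<Longrightarrow> comp (Pt i) (assemble c) = c i"
  by (simp add: assemble_def comp_linear comp_sum comp_ins)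

lemma tot_assemble: "tot (assemble c) = 0"
  by (simp add: assemble_def tot_linear tot_sum tot_ins)

lemma keys_ins:
  assumes "supp c \<subseteq> cliques n" "x \<in> insert Base (Pt ` {..<N})"
  shows "supp (ins x c) \<subseteq> cells n"
  unfolding ins_def
  by (rule keys_frag_extend_subset[OF assms(1)]) (use assms(2) in \<open>auto simp: cells_def cliques_def\<close>)

lemma keys_assemble:
  assumes "\<And>i. i < N \<Longrightarrow> supp (c i) \<subseteq> cliques n"
  shows "supp (assemble c) \<subseteq> cells n"
proof -
  have "supp (\<Sum>i<N. ins (Pt i) (c i)) \<subseteq> cells n"
    by (rule keys_sum_subset) (use assms keys_ins in blast)
  moreover have "supp (ins Base (\<Sum>i<N. c i)) \<subseteq> cells n"
    by (rule keys_ins, rule keys_sum_subset) (use assms in auto)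
  ultimately show ?thesis
    unfolding assemble_def using keys_diff[of "\<Sum>i<N. ins (Pt i) (c i)" "ins Base (\<Sum>i<N. c i)"] by blast
qed

lemma keys_comp:
  assumes "supp z \<subseteq> cells n"
  shows "supp (comp x z) \<subseteq> cliques n"
  unfolding comp_def
  by (rule keys_frag_extend_subset[OF assms]) (auto simp: cells_def cliques_def split: if_splits)

lemma keys_cbd:
  assumes "\<sigma> \<in> cliques (Suc n)"
  shows "supp (cbd \<sigma>) \<subseteq> cliques n"
  unfolding cbd_def
proof (rule keys_sum_subset)
  fix e assume "e \<in> \<sigma>"
  then have "\<sigma> - {e} \<in> cliques n"
    using assms clique_subset[of \<sigma> "\<sigma> - {e}"] by (auto simp: cliques_def clique_def)
  then show "supp (frag_cmul (sg \<sigma> e) (frag_of (\<sigma> - {e}))) \<subseteq> cliques n"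
    using keys_cmul[of "sg \<sigma> e" "frag_of (\<sigma> - {e})"] by auto
qed

lemma boundary_iff:
  assumes z: "supp z \<subseteq> cells n"
  shows "z \<in> frag_extend kbd ` carrier (kos_group (Suc n)) \<longleftrightarrow>
    tot z = 0 \<and> (\<forall>i<N. comp (Pt i) z \<in> frag_extend cbd ` carrier (free_Abelian_group (cliques (Suc n))))"
proof (intro iffI conjI allI impI)
  assume "z \<in> frag_extend kbd ` carrier (kos_group (Suc n))"
  then obtain w where w: "supp w \<subseteq> cells (Suc n)" "z = frag_extend kbd w"
    by (auto simp: kos_group_def)
  show "tot z = 0" by (simp add: w(2) tot_boundary)
  fix i assume i: "i < N"
  show "comp (Pt i) z \<in> frag_extend cbd ` carrier (free_Abelian_group (cliques (Suc n)))"
  proof (cases i)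
    case 0
    then show ?thesis
      using keys_comp[OF w(1)] by (auto simp: w(2) comp_boundary_0)
  next
    case (Suc j)
    have "comp (Pt i) z = frag_extend cbd (comp (Pt i) w - comp (Pt j) w)"
      using i by (simp add: w(2) Suc comp_boundary_Suc frag_extend_diff)
    moreover have "supp (comp (Pt i) w - comp (Pt j) w) \<subseteq> cliques (Suc n)"
      using keys_diff[of "comp (Pt i) w" "comp (Pt j) w"] keys_comp[OF w(1)] by blast
    ultimately show ?thesis by auto
  qed
next
  assume r: "tot z = 0 \<and> (\<forall>i<N. comp (Pt i) z \<in> frag_extend cbd ` carrier (free_Abelian_group (cliques (Suc n))))"
  then have "\<forall>i. \<exists>c. i < N \<longrightarrow> supp c \<subseteq> cliques (Suc n) \<and> comp (Pt i) z = frag_extend cbd c"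
    by (metis carrier_free_Abelian_group_iff imageE)
  then obtain c where c: "\<And>i. i < N \<Longrightarrow> supp (c i) \<subseteq> cliques (Suc n)"
    "\<And>i. i < N \<Longrightarrow> comp (Pt i) z = frag_extend cbd (c i)"
    by metis
  define w where "w = assemble (\<lambda>i. \<Sum>j\<le>i. c j)"
  have w: "supp w \<subseteq> cells (Suc n)"
    unfolding w_def by (intro keys_assemble keys_sum_subset) (use c(1) in auto)
  have "comp (Pt i) (frag_extend kbd w) = frag_extend cbd (c i)" if "i < N" for i
    using that by (cases i)
      (simp_all add: comp_boundary_0 comp_boundary_Suc w_def comp_assemble frag_extend_add)
  note comp_w = this
  have "z - frag_extend kbd w = 0"
  proof (rule cells_eq_0)
    show "supp (z - frag_extend kbd w) \<subseteq> cells n"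
      using z keys_diff[of z "frag_extend kbd w"] keys_frag_extend_subset[of w "cells (Suc n)" kbd "cells n"]
        w keys_kbd by blast
  qed (use r c(2) comp_w in \<open>simp_all add: tot_linear tot_boundary comp_linear\<close>)
  then show "z \<in> frag_extend kbd ` carrier (kos_group (Suc n))"
    using w by (auto simp: kos_group_def)
qed

definition clique_torsion :: "nat \<Rightarrow> ('e set \<Rightarrow>\<^sub>0 int) set monoid" where
  "clique_torsion n = torsion_subgroup
    (free_Abelian_group (cliques n) Mod (frag_extend cbd ` carrier (free_Abelian_group (cliques (Suc n)))))"

lemma subgroup_cbd:
  "subgroup (frag_extend cbd ` carrier (free_Abelian_group (cliques (Suc n)))) (free_Abelian_group (cliques n))"
proof -
  interpret group_hom "free_Abelian_group (cliques (Suc n))" "free_Abelian_group (cliques n)" "frag_extend cbd"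
    using frag_extend_hom[OF keys_cbd] by (simp add: group_hom_def group_hom_axioms_def)
  show ?thesis by (rule img_is_subgroup)
qed

lemma comm_group_clique_torsion: "comm_group (clique_torsion n)"
  unfolding clique_torsion_def
  by (intro comm_group_torsion_subgroup comm_group.abelian_FactGroup abelian_free_Abelian_group subgroup_cbd)

lemma torsion_homology_iso:
  assumes n: "n \<ge> 1"
  shows "torsion_subgroup (chain_homology kos_group (\<lambda>n. frag_extend kbd) n) \<cong>
    product_group {..<N} (\<lambda>_. clique_torsion n)"
proof -
  let ?Z = "chain_cycles kos_group (\<lambda>n. frag_extend kbd) n"
  let ?G = "subgroup_generated (kos_group n) ?Z"
  let ?B = "frag_extend kbd ` carrier (kos_group (Suc n))"
  let ?C = "free_Abelian_group (cliques n)"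
  let ?Bc = "frag_extend cbd ` carrier (free_Abelian_group (cliques (Suc n)))"
  let ?P = "product_group {..<N} (\<lambda>_. clique_torsion n)"
  note cc = chain_complex_cycles[OF chain_complex_kos_group, of n]
  interpret C: comm_group ?C by (rule abelian_free_Abelian_group)
  interpret Q: comm_group "?C Mod ?Bc" by (rule C.abelian_FactGroup[OF subgroup_cbd])
  interpret B0: normal ?Bc ?C by (rule C.subgroup_imp_normal[OF subgroup_cbd])
  obtain i where i: "n = Suc i" using n by (cases n) auto
  have Z: "z \<in> ?Z \<longleftrightarrow> supp z \<subseteq> cells n \<and> frag_extend kbd z = 0" for z
    by (simp add: i chain_cycles_def kernel_def kos_group_def)
  have pow: "z [^]\<^bsub>?G\<^esub> k = frag_cmul (int k) z" for z and k :: nat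
    by (simp add: pow_subgroup_generated kos_group_def)
  have keys_cmul_cells: "supp (frag_cmul k z) \<subseteq> cells n" if "supp z \<subseteq> cells n" for k z
    using keys_cmul[of k z] that by blast
  have torsion: "?Bc #>\<^bsub>?C\<^esub> c \<in> carrier (clique_torsion n) \<longleftrightarrow> (\<exists>k::nat>0. frag_cmul (int k) c \<in> ?Bc)"
    if "supp c \<subseteq> cliques n" for c
  proof -
    have c: "c \<in> carrier ?C" using that by simp
    have "(?Bc #>\<^bsub>?C\<^esub> c) [^]\<^bsub>?C Mod ?Bc\<^esub> k = \<one>\<^bsub>?C Mod ?Bc\<^esub> \<longleftrightarrow> frag_cmul (int k) c \<in> ?Bc" for k :: nat
      using B0.FactGroup_pow[OF c, of k] C.r_coset_eq_self_iff[OF subgroup_cbd C.nat_pow_closed[OF c]] by simp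
    moreover have "?Bc #>\<^bsub>?C\<^esub> c \<in> carrier (?C Mod ?Bc)"
      using c by (auto simp: carrier_FactGroup)
    ultimately show ?thesis
      unfolding clique_torsion_def carrier_torsion_subgroup[OF Q.comm_group_axioms] by simp
  qed
  define D where "D = {z \<in> carrier ?G. \<exists>k::nat. k > 0 \<and> z [^]\<^bsub>?G\<^esub> k \<in> ?B}"
  have D: "z \<in> D \<longleftrightarrow> supp z \<subseteq> cells n \<and> tot z = 0 \<and>
      (\<forall>i<N. \<exists>k::nat>0. frag_cmul (int k) (comp (Pt i) z) \<in> ?Bc)" for z
  proof
    assume "z \<in> D"
    then obtain k :: nat where k: "k > 0" "frag_cmul (int k) z \<in> ?B" and z: "supp z \<subseteq> cells n"
      by (auto simp: D_def cc(4) Z pow)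
    from boundary_iff[OF keys_cmul_cells[OF z]] k(2)
    have "tot (frag_cmul (int k) z) = 0" "\<And>i. i < N \<Longrightarrow> comp (Pt i) (frag_cmul (int k) z) \<in> ?Bc"
      by blast+
    then show "supp z \<subseteq> cells n \<and> tot z = 0 \<and>
      (\<forall>i<N. \<exists>k::nat>0. frag_cmul (int k) (comp (Pt i) z) \<in> ?Bc)"
      using k(1) z by (auto simp: tot_linear comp_linear)
  next
    assume r: "supp z \<subseteq> cells n \<and> tot z = 0 \<and>
      (\<forall>i<N. \<exists>k::nat>0. frag_cmul (int k) (comp (Pt i) z) \<in> ?Bc)"
    then have z: "supp z \<subseteq> cells n" by blast
    from r obtain k :: "nat \<Rightarrow> nat" where k: "\<And>i. i < N \<Longrightarrow> k i > 0"
      "\<And>i. i < N \<Longrightarrow> frag_cmul (int (k i)) (comp (Pt i) z) \<in> ?Bc"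
      by metis
    let ?k = "\<Prod>i<N. k i"
    have k0: "?k > 0" using k(1) by (simp add: prod_pos)
    have "frag_cmul (int ?k) (comp (Pt i) z) \<in> ?Bc" if i: "i < N" for i
    proof -
      obtain c where c: "supp c \<subseteq> cliques (Suc n)" "frag_cmul (int (k i)) (comp (Pt i) z) = frag_extend cbd c"
        using k(2)[OF i] by auto
      have "?k = (\<Prod>j\<in>{..<N} - {i}. k j) * k i"
        using i by (simp add: prod.remove[of "{..<N}" i] mult.commute)
      then have "frag_cmul (int ?k) (comp (Pt i) z) =
          frag_cmul (int (\<Prod>j\<in>{..<N} - {i}. k j)) (frag_cmul (int (k i)) (comp (Pt i) z))"
        by (simp only: frag_cmul_cmul of_nat_mult)
      also have "\<dots> = frag_extend cbd (frag_cmul (int (\<Prod>j\<in>{..<N} - {i}. k j)) c)"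
        by (simp only: c(2) frag_extend_cmul)
      finally show ?thesis
        using c(1) keys_cmul[of "int (\<Prod>j\<in>{..<N} - {i}. k j)" c] by auto
    qed
    then have kB: "frag_cmul (int ?k) z \<in> ?B"
      using r boundary_iff[OF keys_cmul_cells[OF z]] by (simp add: tot_linear comp_linear)
    then obtain w where w: "supp w \<subseteq> cells (Suc n)" "frag_cmul (int ?k) z = frag_extend kbd w"
      by (auto simp: kos_group_def)
    have "frag_cmul (int ?k) (frag_extend kbd z) = 0"
      using kbd_kbd[OF w(1)] w(2) by (simp only: frag_extend_cmul[symmetric])
    then have "int ?k = 0 \<or> frag_extend kbd z = 0"
      by (simp only: frag_cmul_eq_0_iff)
    then have "frag_extend kbd z = 0"
      using k0 by (metis of_nat_eq_0_iff less_irrefl)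
    then have "z \<in> carrier ?G"
      using z by (simp only: cc(4) Z)
    moreover have "z [^]\<^bsub>?G\<^esub> ?k \<in> ?B"
      unfolding pow by (rule kB)
    ultimately show "z \<in> D"
      unfolding D_def using k0 by blast
  qed
  define \<Theta> where "\<Theta> z = (\<lambda>i\<in>{..<N}. ?Bc #>\<^bsub>?C\<^esub> comp (Pt i) z)" for z
  interpret T: comm_group "clique_torsion n" by (rule comm_group_clique_torsion)
  have mult_T: "(?Bc #>\<^bsub>?C\<^esub> a) \<otimes>\<^bsub>clique_torsion n\<^esub> (?Bc #>\<^bsub>?C\<^esub> b) = ?Bc #>\<^bsub>?C\<^esub> (a + b)"
    if "supp a \<subseteq> cliques n" "supp b \<subseteq> cliques n" for a b
    unfolding clique_torsion_def torsion_subgroup_def mult_subgroup_generated mult_FactGroup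
    using B0.rcos_sum[of a b] that by (simp only: carrier_free_Abelian_group_iff mult_free_Abelian_group)
  have one_T: "\<one>\<^bsub>clique_torsion n\<^esub> = ?Bc"
    by (simp add: clique_torsion_def torsion_subgroup_def)
  have compC: "supp (comp x z) \<subseteq> cliques n" if "z \<in> D" for x z
    using keys_comp that D by blast
  show ?thesis
    unfolding chain_homology_def
  proof (rule torsion_Mod_iso[OF cc(3,2) _ D_def, of _ \<Theta>])
    show "group ?P"
      by (simp add: T.is_group)
    show "\<Theta> (z \<otimes>\<^bsub>?G\<^esub> w) = \<Theta> z \<otimes>\<^bsub>?P\<^esub> \<Theta> w"
      if "z \<in> D" "w \<in> D" for z w
      using compC that by (auto simp: \<Theta>_def kos_group_def comp_linear mult_T intro!: restrict_ext)
    show "\<Theta> z = \<one>\<^bsub>?P\<^esub> \<longleftrightarrow> z \<in> ?B" if "z \<in> D" for z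
    proof -
      have "\<Theta> z = \<one>\<^bsub>?P\<^esub> \<longleftrightarrow> (\<forall>i<N. ?Bc #>\<^bsub>?C\<^esub> comp (Pt i) z = ?Bc)"
        by (auto simp: \<Theta>_def one_T restrict_def fun_eq_iff)
      also have "\<dots> \<longleftrightarrow> (\<forall>i<N. comp (Pt i) z \<in> ?Bc)"
        using C.r_coset_eq_self_iff[OF subgroup_cbd] compC[OF that] by simp
      also have "\<dots> \<longleftrightarrow> z \<in> ?B"
        using boundary_iff[of z n] that D by blast
      finally show ?thesis .
    qed
    show "\<Theta> ` D = carrier ?P"
    proof (intro equalityI subsetI)
      fix y assume "y \<in> \<Theta> ` D"
      then obtain z where z: "z \<in> D" "y = \<Theta> z" by blast
      have "?Bc #>\<^bsub>?C\<^esub> comp (Pt i) z \<in> carrier (clique_torsion n)" if "i < N" for i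
        using torsion[OF compC[OF z(1)]] z(1) that unfolding D by blast
      then show "y \<in> carrier ?P"
        by (simp add: z(2) \<Theta>_def)
    next
      fix y assume y: "y \<in> carrier ?P"
      have "\<exists>c. supp c \<subseteq> cliques n \<and> y i = ?Bc #>\<^bsub>?C\<^esub> c" if "i < N" for i
      proof -
        have "y i \<in> carrier (clique_torsion n)" using y that by auto
        then have "y i \<in> carrier (?C Mod ?Bc)"
          unfolding clique_torsion_def carrier_torsion_subgroup[OF Q.comm_group_axioms] by blast
        then obtain c where "c \<in> carrier ?C" "y i = ?Bc #>\<^bsub>?C\<^esub> c"
          unfolding carrier_FactGroup by blast
        then show ?thesis by (intro exI[of _ c] conjI) simp_all
      qed
      then obtain c where c: "\<And>i. i < N \<Longrightarrow> supp (c i) \<subseteq> cliques n"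
        "\<And>i. i < N \<Longrightarrow> y i = ?Bc #>\<^bsub>?C\<^esub> c i"
        by metis
      have "assemble c \<in> D"
        unfolding D
      proof (intro conjI allI impI)
        show "supp (assemble c) \<subseteq> cells n" by (rule keys_assemble[OF c(1)])
        show "tot (assemble c) = 0" by (rule tot_assemble)
        fix i assume i: "i < N"
        have "y i \<in> carrier (clique_torsion n)" using y i by auto
        then show "\<exists>k::nat>0. frag_cmul (int k) (comp (Pt i) (assemble c)) \<in> ?Bc"
          using torsion[OF c(1)[OF i]] c(2)[OF i] comp_assemble[OF i] by simp
      qed
      moreover have "\<Theta> (assemble c) = y"
      proof (rule extensionalityI[of _ "{..<N}"])
        show "\<Theta> (assemble c) \<in> extensional {..<N}" by (simp add: \<Theta>_def)
        show "y \<in> extensional {..<N}" using y by (auto simp: PiE_def)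
        show "\<Theta> (assemble c) i = y i" if "i \<in> {..<N}" for i
          using that c(2) by (simp add: \<Theta>_def comp_assemble)
      qed
      ultimately show "y \<in> \<Theta> ` D" by blast
    qed
  qed
qed

theorem torsion_fpc_homology:
  assumes "k \<ge> 1"
  shows "torsion_subgroup (fpc_homology E I k (chain_set (int N - 1))) \<cong>
    product_group {..<N} (\<lambda>_. clique_torsion k)"
    and "group (torsion_subgroup (fpc_homology E I k (chain_set (int N - 1))))"
proof -
  let ?H = "torsion_subgroup (fpc_homology E I k (chain_set (int N - 1)))"
  let ?P = "product_group {..<N} (\<lambda>_. clique_torsion k)"
  have "torsion_subgroup (fpc_homology E I k kset) \<cong>
      torsion_subgroup (chain_homology kos_group (\<lambda>n. frag_extend kbd) k)"
    using fpc_homology_iso[OF assms] comm_group_chain_homology[OF chain_complex_kos_group]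
    by (intro torsion_subgroup_iso)
  also have "\<dots> \<cong> ?P"
    by (rule torsion_homology_iso[OF assms])
  finally show "?H \<cong>
      ?P"
    by (simp add: kset_eq)
  show "group ?H"
    using comm_group_torsion_subgroup[OF fpc_homology_iso(2)[OF assms]]
    by (simp add: kset_eq comm_group_def)
qed

end

lemma product_group_Suc_iso:
  fixes T :: "'a monoid"
  assumes "group T"
  shows "product_group {..<Suc N} (\<lambda>_. T) \<cong> product_group {..<N} (\<lambda>_. T) \<times>\<times> product_group {..<1::nat} (\<lambda>_. T)"
proof -
  let ?P = "\<lambda>n::nat. product_group {..<n} (\<lambda>_. T)"
  define f where "f y = (restrict y {..<N}, \<lambda>i\<in>{..<1::nat}. y N)" for y :: "nat \<Rightarrow> 'a"
  define g where "g = (\<lambda>(y :: nat \<Rightarrow> 'a, z :: nat \<Rightarrow> 'a). \<lambda>i\<in>{..<Suc N}. if i = N then z 0 else y i)"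
  have "f \<in> iso (?P (Suc N)) (?P N \<times>\<times> ?P 1)"
  proof (rule isoI)
    show f: "f \<in> hom (?P (Suc N)) (?P N \<times>\<times> ?P 1)"
    proof (rule homI)
      show "f y \<in> carrier (?P N \<times>\<times> ?P 1)" if "y \<in> carrier (?P (Suc N))" for y
        using that by (auto simp: f_def PiE_iff)
      show "f (y \<otimes>\<^bsub>?P (Suc N)\<^esub> z) = f y \<otimes>\<^bsub>?P N \<times>\<times> ?P 1\<^esub> f z" for y z
        by (simp add: f_def restrict_def fun_eq_iff)
    qed
    show "bij_betw f (carrier (?P (Suc N))) (carrier (?P N \<times>\<times> ?P 1))"
    proof (rule bij_betw_byWitness[of _ g])
      show "\<forall>y\<in>carrier (?P (Suc N)). g (f y) = y"
        by (auto simp: f_def g_def PiE_iff extensional_def fun_eq_iff)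
      show "\<forall>p\<in>carrier (?P N \<times>\<times> ?P 1). f (g p) = p"
        by (auto simp: f_def g_def PiE_iff extensional_def fun_eq_iff)
      show "f ` carrier (?P (Suc N)) \<subseteq> carrier (?P N \<times>\<times> ?P 1)"
        using hom_carrier[OF f] .
      show "g ` carrier (?P N \<times>\<times> ?P 1) \<subseteq> carrier (?P (Suc N))"
      proof (rule image_subsetI)
        fix p assume p: "p \<in> carrier (?P N \<times>\<times> ?P 1)"
        obtain y z where yz: "p = (y, z)" by (cases p)
        have "y i \<in> carrier T" if "i < N" for i
          using p that by (auto simp: yz PiE_iff)
        moreover have "z 0 \<in> carrier T"
          using p by (auto simp: yz PiE_iff)
        ultimately show "g p \<in> carrier (?P (Suc N))"
          by (simp add: yz g_def less_Suc_eq)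
      qed
    qed
  qed
  then show ?thesis by (rule is_isoI)
qed

theorem corollary1p2:
  fixes E :: "'e set" and I :: "('e \<times> 'e) set" and m :: int and k :: nat
  assumes "I \<subseteq> E \<times> E" and "irrefl I" and "sym I"
    and "m \<ge> -1" and "k \<ge> 1"
  shows "torsion_subgroup (fpc_homology E I k (chain_set (m + 1))) \<cong>
         torsion_subgroup (fpc_homology E I k (chain_set m)) \<times>\<times>
         torsion_subgroup (fpc_homology E I k (chain_set 0))"
proof -
  obtain N where N: "m = int N - 1"
    using assms(4) by (metis add.commute diff_add_cancel diff_ge_0_iff_ge nonneg_int_cases uminus_add_conv_diff diff_minus_eq_add)
  obtain r :: "'e rel" where r: "well_order_on UNIV r"
    using well_order_on by blast
  define lt where "lt a b \<longleftrightarrow> (a, b) \<in> r \<and> a \<noteq> b" for a b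
  have lt: "\<not> lt a a" "lt a b \<Longrightarrow> lt b c \<Longrightarrow> lt a c" "a \<noteq> b \<Longrightarrow> lt a b \<or> lt b a" for a b c
    using r unfolding lt_def well_order_on_def linear_order_on_def partial_order_on_def preorder_on_def
      antisym_def trans_def total_on_def by blast+
  have chain: "fpc_chain E I lt"
    using assms(1-3) lt by unfold_locales
  define T where "T = fpc_chain.clique_torsion E I lt k"
  have T: "torsion_subgroup (fpc_homology E I k (chain_set (int n - 1))) \<cong> product_group {..<n} (\<lambda>_. T)" for n
    unfolding T_def by (rule fpc_chain.torsion_fpc_homology(1)[OF chain assms(5)])
  have gT: "group T"
    unfolding T_def using fpc_chain.comm_group_clique_torsion[OF chain] by (simp add: comm_group_def)
  have sym: "product_group {..<n} (\<lambda>_. T) \<cong> torsion_subgroup (fpc_homology E I k (chain_set (int n - 1)))" for n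
    by (rule group.iso_sym[OF fpc_chain.torsion_fpc_homology(2)[OF chain assms(5)] T])
  have "torsion_subgroup (fpc_homology E I k (chain_set (m + 1))) \<cong> product_group {..<Suc N} (\<lambda>_. T)"
    using T[of "Suc N"] by (simp add: N)
  also have "\<dots> \<cong> product_group {..<N} (\<lambda>_. T) \<times>\<times> product_group {..<1::nat} (\<lambda>_. T)"
    by (rule product_group_Suc_iso[OF gT])
  also have "\<dots> \<cong> torsion_subgroup (fpc_homology E I k (chain_set m)) \<times>\<times>
         torsion_subgroup (fpc_homology E I k (chain_set 0))"
    using group.DirProd_iso_trans[OF _ sym sym, of N 1] gT by (simp add: N)
  finally show ?thesis .
qed

end
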